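(* Let $\mathcal Q_{\Lambda,s}=\{(w_{i,s},x_i): w_{i,s}\ge0,\ x_i\in\Lambda\}$, $\Lambda=\{x_i\}_{i=1}^{|D|}\subset\mathbb S^d$, be a positive quadrature rule on $\mathbb S^d$ of degree $s\in\mathbb N$. Let $\phi$ be a positive definite function with $\hat\phi_k\sim k^{-2\gamma}$, $\gamma>d/2$. Then for any $0\le v<1$ and $0<\lambda<1$, $$\|(\mathcal L_\phi+\lambda I)^{-v}(L_{\phi,D,W_s}-\mathcal L_\phi)\|\le\tilde c\,\big(\lambda^{-v}s^{-\gamma}+s^{-(1-v)\gamma}\big),$$ where $\tilde c$ is a constant depending only on $\gamma$, $v$ and $d$, and $\|\cdot\|$ is the operator (spectral) norm on $\mathcal N_\phi$.
   Context: $\mathbb S^d$ is the unit sphere of $\mathbb R^{d+1}$, $d\omega$ its Lebesgue (surface) measure and $\Omega_d$ its volume. $\Pi_s^d$ is the space of spherical polynomials of degree at most $s$ on $\mathbb S^d$, $\mathbb H_k^d$ the space of spherical harmonics of degree $k$, $d_k^d=\dim\mathbb H_k^d$, and $\{Y_{k,\ell}\}_{\ell=1}^{d_k^d}$ an orthonormal basis of $\mathbb H_k^d$ in $L^2(\mathbb S^d)$. $P_k^{d+1}$ is the Legendre polynomial of degree $k$ with $P_k^{d+1}(1)=1$, orthogonal on $[-1,1]$ with weight $(1-t^2)^{(d-2)/2}$, so that $\sum_{\ell}Y_{k,\ell}(x)Y_{k,\ell}(x')=\frac{d_k^d}{\Omega_d}P_k^{d+1}(x\cdot x')$. A function $\phi(t)=\sum_{k=0}^\infty\hat\phi_k\frac{d_k^d}{\Omega_d}P_k^{d+1}(t)$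 with all $\hat\phi_k>0$ and $\sum_k\hat\phi_k\frac{d_k^d}{\Omega_d}<\infty$ is called positive definite. Its native space is $\mathcal N_\phi=\{f=\sum_k\sum_{\ell}\hat f_{k,\ell}Y_{k,\ell}:\ \|f\|_\phi^2:=\sum_k\hat\phi_k^{-1}\sum_{\ell}|\hat f_{k,\ell}|^2<\infty\}$, $\hat f_{k,\ell}=\int_{\mathbb S^d}fY_{k,\ell}\,d\omega$, a reproducing kernel Hilbert space with kernel $(x,x')\mapsto\phi(x\cdot x')$; write $\phi_x=\phi(x\cdot\,)$. $\mathcal L_\phi:\mathcal N_\phi\to\mathcal N_\phi$ is the integral operator $\mathcal L_\phi f(x)=\int_{\mathbb S^d}\phi(x\cdot x')f(x')\,d\omega(x')=\sum_k\hat\phi_k\sum_\ell\hat f_{k,\ell}Y_{k,\ell}(x)$, and functions of it are defined by spectral calculus: $\eta(\mathcal L_\phi)f=\sum_k\eta(\hat\phi_k)\sum_\ell\hat f_{k,\ell}Y_{k,\ell}$. The empirical operator is $L_{\phi,D,W_s}f=\sum_{i=1}^{|D|}w_{i,s}f(x_i)\phi_{x_i}$ on $\mathcal N_\phi$. A positive quadrature rule of degree $s$ is a set $\{(w_{i,s},x_i)\}$ with $w_{i,s}\ge0$ and $\int_{\mathbb S^d}P\,d\omega=\sum_{x_i\in\Lambda}w_{i,s}P(x_i)$ for all $P\in\Pi_s^d$. $a\sim b$ means $\hat c_1b\le a\le\hat c_2b$ with absolute constants $\hat c_1,\hat c_2>0$ (here for all $k\ge1$); $\phi$ and these implied constants are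 regarded as fixed and dependence on them is not tracked. *)

theory Defs
  imports "HOL-Analysis.Analysis" "HOL-Library.Function_Algebras"
begin

interpretation fun_vs: vector_space "\<lambda>(c::real) (f::'a \<Rightarrow> real) x. c * f x"
  by unfold_locales (auto simp: fun_eq_iff algebra_simps)

section \<open>The sphere and its surface measure\<close>

text \<open>
  The sphere $S^d$ is the unit sphere \<open>sphere 0 1\<close> of \<open>real ^ 'n\<close> with
  \<open>CARD('n) = d + 1\<close>.  The surface measure is the cone measure: the measure of \<open>A\<close> is
  $d + 1$ times the Lebesgue volume of the cone of all \<open>r *\<^sub>R y\<close> with
  \<open>y \<in> A\<close> and \<open>0 < r \<le> 1\<close>.
\<close>

definition surface_measure :: "(real ^ 'n::finite) measure" where
  "surface_measure = scale_measure (of_nat CARD('n))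
     (distr (restrict_space lborel (cball 0 1 - {0})) (restrict_space borel (sphere 0 1)) sgn)"

definition sphere_volume :: "'n::finite itself \<Rightarrow> real" where
  "sphere_volume _ = measure (surface_measure :: (real ^ 'n) measure) (sphere 0 1)"

text \<open>
  A function on the sphere is represented by its extension by zero to \<open>real ^ 'n\<close>.
\<close>

definition on_sphere :: "(real ^ 'n::finite \<Rightarrow> real) \<Rightarrow> real ^ 'n \<Rightarrow> real" where
  "on_sphere f x = (if x \<in> sphere 0 1 then f x else 0)"

section \<open>Spherical polynomials and spherical harmonics\<close>

definition monomial_fun :: "('n::finite \<Rightarrow> nat) \<Rightarrow> real ^ 'n \<Rightarrow> real" where
  "monomial_fun \<alpha> x = (\<Prod>i\<in>UNIV. (x $ i) ^ \<alpha> i)"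

definition spherical_polys :: "nat \<Rightarrow> (real ^ 'n::finite \<Rightarrow> real) set" where
  "spherical_polys s = on_sphere ` fun_vs.span (monomial_fun ` {\<alpha>. (\<Sum>i\<in>UNIV. \<alpha> i) \<le> s})"

definition homogeneous_polys :: "nat \<Rightarrow> (real ^ 'n::finite \<Rightarrow> real) set" where
  "homogeneous_polys k = fun_vs.span (monomial_fun ` {\<alpha>. (\<Sum>i\<in>UNIV. \<alpha> i) = k})"

definition partial_deriv :: "'n::finite \<Rightarrow> (real ^ 'n \<Rightarrow> real) \<Rightarrow> real ^ 'n \<Rightarrow> real" where
  "partial_deriv i f x = deriv (\<lambda>t. f (x + t *\<^sub>R axis i 1)) 0"

definition laplacian :: "(real ^ 'n::finite \<Rightarrow> real) \<Rightarrow> real ^ 'n \<Rightarrow> real" where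
  "laplacian f x = (\<Sum>i\<in>UNIV. partial_deriv i (partial_deriv i f) x)"

definition spherical_harmonics :: "nat \<Rightarrow> (real ^ 'n::finite \<Rightarrow> real) set" where
  "spherical_harmonics k = on_sphere ` {p \<in> homogeneous_polys k. \<forall>x. laplacian p x = 0}"

definition harmonic_dim :: "'n::finite itself \<Rightarrow> nat \<Rightarrow> nat" where
  "harmonic_dim _ k = fun_vs.dim (spherical_harmonics k :: (real ^ 'n \<Rightarrow> real) set)"

definition harmonic_onb :: "(nat \<Rightarrow> nat \<Rightarrow> real ^ 'n::finite \<Rightarrow> real) \<Rightarrow> bool" where
  "harmonic_onb Y \<longleftrightarrow> (\<forall>k.
     fun_vs.span (Y k ` {1..harmonic_dim TYPE('n) k}) = spherical_harmonics k \<and>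
     (\<forall>l\<in>{1..harmonic_dim TYPE('n) k}. \<forall>l'\<in>{1..harmonic_dim TYPE('n) k}.
        (\<integral>x. Y k l x * Y k l' x \<partial>surface_measure) = (if l = l' then 1 else 0)))"

text \<open>
  The superscript $d + 1$ of the Legendre polynomial is the argument \<open>n\<close>, so the
  weight exponent $(d - 2) / 2$ is $(n - 3) / 2$.
\<close>

definition legendre_poly :: "nat \<Rightarrow> nat \<Rightarrow> real poly" where
  "legendre_poly n k = (THE p. degree p = k \<and> poly p 1 = 1 \<and>
     (\<forall>q. q = 0 \<or> degree q < k \<longrightarrow>
        (LBINT t:{-1..1}. poly p t * poly q t * (1 - t\<^sup>2) powr ((real n - 3) / 2)) = 0))"

section \<open>Positive definite functions and native spaces\<close>

definition positive_definite_with ::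
    "'n::finite itself \<Rightarrow> (real \<Rightarrow> real) \<Rightarrow> (nat \<Rightarrow> real) \<Rightarrow> bool" where
  "positive_definite_with T \<phi> \<phi>h \<longleftrightarrow>
     (\<forall>k. \<phi>h k > 0) \<and>
     summable (\<lambda>k. \<phi>h k * (real (harmonic_dim T k) / sphere_volume T)) \<and>
     (\<forall>t\<in>{-1..1}. (\<lambda>k. \<phi>h k * (real (harmonic_dim T k) / sphere_volume T) *
                          poly (legendre_poly CARD('n) k) t) sums \<phi> t)"

definition harmonic_coeff ::
    "(nat \<Rightarrow> nat \<Rightarrow> real ^ 'n::finite \<Rightarrow> real) \<Rightarrow> (real ^ 'n \<Rightarrow> real) \<Rightarrow> nat \<Rightarrow> nat \<Rightarrow> real" where
  "harmonic_coeff Y f k l = (\<integral>x. f x * Y k l x \<partial>surface_measure)"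

text \<open>
  Members of the native space are genuine functions rather than $L^2$ classes: the
  expansion is required to converge to \<open>f\<close> at every point of the sphere, as is needed
  for point evaluation.
\<close>

definition native_space ::
    "(nat \<Rightarrow> nat \<Rightarrow> real ^ 'n::finite \<Rightarrow> real) \<Rightarrow> (nat \<Rightarrow> real) \<Rightarrow> (real ^ 'n \<Rightarrow> real) set" where
  "native_space Y \<phi>h = {f.
     (\<forall>x. x \<notin> sphere 0 1 \<longrightarrow> f x = 0) \<and>
     f \<in> borel_measurable surface_measure \<and>
     integrable surface_measure (\<lambda>x. (f x)\<^sup>2) \<and>
     (\<forall>x\<in>sphere 0 1.
        (\<lambda>k. \<Sum>l = 1..harmonic_dim TYPE('n) k. harmonic_coeff Y f k l * Y k l x) sums f x) \<and>
     summable (\<lambda>k. inverse (\<phi>h k) *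
        (\<Sum>l = 1..harmonic_dim TYPE('n) k. (harmonic_coeff Y f k l)\<^sup>2))}"

definition native_norm ::
    "(nat \<Rightarrow> nat \<Rightarrow> real ^ 'n::finite \<Rightarrow> real) \<Rightarrow> (nat \<Rightarrow> real) \<Rightarrow> (real ^ 'n \<Rightarrow> real) \<Rightarrow> real" where
  "native_norm Y \<phi>h f = sqrt (\<Sum>k. inverse (\<phi>h k) *
     (\<Sum>l = 1..harmonic_dim TYPE('n) k. (harmonic_coeff Y f k l)\<^sup>2))"

text \<open>
  The operator norm takes extended real values, so that a finite upper bound entails
  boundedness.  It is meaningful for operators mapping the native space into itself.
\<close>

definition native_op_norm ::
    "(nat \<Rightarrow> nat \<Rightarrow> real ^ 'n::finite \<Rightarrow> real) \<Rightarrow> (nat \<Rightarrow> real) \<Rightarrow>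
     ((real ^ 'n \<Rightarrow> real) \<Rightarrow> (real ^ 'n \<Rightarrow> real)) \<Rightarrow> ereal" where
  "native_op_norm Y \<phi>h A =
     (SUP f\<in>{f \<in> native_space Y \<phi>h. native_norm Y \<phi>h f \<le> 1}. ereal (native_norm Y \<phi>h (A f)))"

section \<open>The operators and quadrature rules\<close>

definition integral_op ::
    "(real \<Rightarrow> real) \<Rightarrow> (real ^ 'n::finite \<Rightarrow> real) \<Rightarrow> (real ^ 'n \<Rightarrow> real)" where
  "integral_op \<phi> f = on_sphere (\<lambda>x. \<integral>x'. \<phi> (x \<bullet> x') * f x' \<partial>surface_measure)"

text \<open>\<open>spectral_op Y \<phi>h \<eta>\<close> is $\eta(\mathcal{L}_\phi)$.\<close>

definition spectral_op ::
    "(nat \<Rightarrow> nat \<Rightarrow> real ^ 'n::finite \<Rightarrow> real) \<Rightarrow> (nat \<Rightarrow> real) \<Rightarrow> (real \<Rightarrow> real) \<Rightarrow>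
     (real ^ 'n \<Rightarrow> real) \<Rightarrow> (real ^ 'n \<Rightarrow> real)" where
  "spectral_op Y \<phi>h \<eta> f = on_sphere (\<lambda>x. \<Sum>k. \<eta> (\<phi>h k) *
     (\<Sum>l = 1..harmonic_dim TYPE('n) k. harmonic_coeff Y f k l * Y k l x))"

definition empirical_op ::
    "(real \<Rightarrow> real) \<Rightarrow> nat \<Rightarrow> (nat \<Rightarrow> real) \<Rightarrow> (nat \<Rightarrow> real ^ 'n::finite) \<Rightarrow>
     (real ^ 'n \<Rightarrow> real) \<Rightarrow> (real ^ 'n \<Rightarrow> real)" where
  "empirical_op \<phi> N w p f = on_sphere (\<lambda>x. \<Sum>i = 1..N. w i * f (p i) * \<phi> (p i \<bullet> x))"

definition positive_quadrature ::
    "nat \<Rightarrow> nat \<Rightarrow> (nat \<Rightarrow> real) \<Rightarrow> (nat \<Rightarrow> real ^ 'n::finite) \<Rightarrow> bool" where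
  "positive_quadrature s N w p \<longleftrightarrow>
     (\<forall>i\<in>{1..N}. w i \<ge> 0 \<and> p i \<in> sphere 0 1) \<and>
     (\<forall>P\<in>spherical_polys s. (\<integral>x. P x \<partial>surface_measure) = (\<Sum>i = 1..N. w i * P (p i)))"

end

theory Submission imports Defs begin

text \<open>
  Tested against an arbitrary element of the native space, the operator difference is the
  quadrature error of a product of two native functions, and the factor
  $(\mathcal{L}_\phi + \lambda I)^{-v}$ costs at most $\lambda^{-v}$.  Split both factors into
  their parts of degree at most and above $s/2$.  The product of the low parts is integrated
  exactly.  For the high parts one needs a Marcinkiewicz--Zygmund type inequality: for
  polynomials $f$ of degree at most $m$, with $m \ge s$,
  $\sum_i w_i f(x_i)^2 \le C (m/s)^d \|f\|_2^2$.  It holds because averaging over caps of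
  radius of order $1/m$ is boundedly invertible in degrees up to $m$ (Funk--Hecke, as Legendre
  polynomials of degree at most $m$ exceed $1/2$ on such caps), while a power of the Fejer kernel
  shows that a cap of radius of order $1/s$ carries weight at most $C s^{-d}$.  Dyadic summation,
  convergent as $\gamma > d/2$, then bounds the discrete norm of a high part by $C s^{-\gamma}$.
  The error is therefore at most $C \lambda^{-v} s^{-\gamma}$.
\<close>

section \<open>The surface measure\<close>

text \<open>The obstacle is the high part at the nodes: exactness says nothing above degree s, and a
  sup-norm bound, with weights summing to the volume of the sphere, would give only s^(d/2 - gamma).
  A sampling inequality of L2 type saves the factor s^(d/2): its loss (m/s)^d on degrees near m is
  repaid by the decay m^(-2 gamma) of the kernel coefficients. The harmonic analysis is built from
  one fact, the invariance of the surface measure under orthogonal maps: differentiated along plane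
  rotations it yields orthogonality of different degrees, and applied to the kernel of one degree it
  yields the addition formula and Funk-Hecke. \<open>legendre_poly\<close> is a definite
  description, so it is identified through a zonal harmonic, in the degrees where
  \<open>harmonic_dim\<close> is positive; the other degrees contribute empty sums. The theorem
  fixes c before the basis, the rule and lambda. Hence all constants are functions of the type,
  gamma and the bounds on the coefficients alone, defined outside the locales.\<close>

lemma space_surface_measure [simp]: "space (surface_measure :: (real^'n::finite) measure) = sphere 0 1"
  by (simp add: surface_measure_def space_scale_measure space_restrict_space)

lemma sets_surface_measure [measurable_cong]:
  "sets (surface_measure :: (real^'n::finite) measure) = sets (restrict_space borel (sphere 0 1))"
  by (simp add: surface_measure_def)

lemma sgn_measurable_sphere:
  "sgn \<in> measurable (restrict_space lborel (cball 0 1 - {0::real^'n::finite}))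
     (restrict_space borel (sphere 0 1))"
proof (rule measurable_restrict_space3)
  show "sgn \<in> measurable lborel (borel :: (real^'n) measure)"
    unfolding sgn_div_norm[abs_def] by measurable
  show "sgn \<in> cball 0 1 - {0} \<rightarrow> sphere (0::real^'n) 1"
    by (auto simp: norm_sgn)
qed

lemma emeasure_surface_measure:
  fixes A :: "(real^'n::finite) set"
  assumes "A \<in> sets surface_measure"
  shows "emeasure surface_measure A =
    of_nat CARD('n) * emeasure lborel {x \<in> cball 0 1 - {0}. sgn x \<in> A}"
proof -
  have "emeasure surface_measure A = of_nat CARD('n) *
      emeasure (restrict_space lborel (cball 0 1 - {0})) (sgn -` A \<inter> (cball 0 1 - {0}))"
    using assms unfolding surface_measure_def
    by (subst emeasure_scale_measure, subst emeasure_distr[OF sgn_measurable_sphere])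
       (auto simp: space_restrict_space)
  also have "emeasure (restrict_space lborel (cball 0 1 - {0})) (sgn -` A \<inter> (cball 0 1 - {0}))
      = emeasure lborel (sgn -` A \<inter> (cball 0 1 - {0}))"
    by (subst emeasure_restrict_space) auto
  also have "sgn -` A \<inter> (cball 0 1 - {0}) = {x \<in> cball 0 1 - {0}. sgn x \<in> A}"
    by auto
  finally show ?thesis .
qed

section \<open>Invariance of Lebesgue and surface measure under orthogonal maps\<close>

lemma orthogonal_transformation_measurable:
  fixes f :: "real^'n::finite \<Rightarrow> real^'n"
  assumes f: "orthogonal_transformation f"
  shows "f \<in> measurable borel borel"
  using f orthogonal_transformation_linear linear_conv_bounded_linear
  by (metis borel_measurable_continuous_onI linear_continuous_on)

text \<open>Both signs occur in the next proof: c = 1 shifts the variable, c = -1 handles an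
  integrand in f x - y integrated over y.\<close>

lemma nn_integral_lborel_translate:
  fixes g :: "real^'n::finite \<Rightarrow> ennreal"
  assumes [measurable]: "g \<in> borel_measurable borel" and c: "c = 1 \<or> c = -1"
  shows "(\<integral>\<^sup>+x. g (t + c *\<^sub>R x) \<partial>lborel) = (\<integral>\<^sup>+x. g x \<partial>lborel)"
proof -
  have "distr lborel borel (\<lambda>x. t + c *\<^sub>R x) = (lborel :: (real^'n) measure)"
  proof -
    have "c \<noteq> 0" "\<bar>c\<bar> = 1" using c by auto
    then show ?thesis using lborel_affine[of c t] by (simp add: density_1)
  qed
  then have "(\<integral>\<^sup>+x. g x \<partial>lborel) = (\<integral>\<^sup>+x. g x \<partial>distr lborel borel (\<lambda>x. t + c *\<^sub>R x))" by simp
  also have "\<dots> = (\<integral>\<^sup>+x. g (t + c *\<^sub>R x) \<partial>lborel)"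
    by (rule nn_integral_distr) simp_all
  finally show ?thesis by simp
qed

text \<open>
  Comparing the product of an arbitrary set with the unit ball, which an orthogonal map
  preserves, Fubini and translation invariance identify the image measure.
\<close>

lemma distr_lborel_orthogonal:
  fixes f :: "real^'n::finite \<Rightarrow> real^'n"
  assumes f: "orthogonal_transformation f"
  shows "distr lborel borel f = lborel"
proof (rule measure_eqI)
  note lin = orthogonal_transformation_linear[OF f]
  have meas [measurable]: "f \<in> measurable borel borel"
    using f by (rule orthogonal_transformation_measurable)
  define g where "g = inv f"
  have g: "orthogonal_transformation g"
    using f by (simp add: g_def orthogonal_transformation_inv)
  have fg: "f (g y) = y" for y
    unfolding g_def using orthogonal_transformation_surj[OF f] by (simp add: surj_f_inv_f)
  have [measurable]: "g \<in> measurable borel borel"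
    using g by (rule orthogonal_transformation_measurable)
  show "sets (distr lborel borel f) = sets lborel" by simp
  fix A assume "A \<in> sets (distr lborel borel f)"
  then have A [measurable]: "A \<in> sets borel" by simp
  define B where "B = ball (0::real^'n) 1"
  have B [measurable]: "B \<in> sets borel" by (simp add: B_def)
  have fB: "indicator B (f x) = (indicator B x :: ennreal)" for x
    by (simp add: B_def indicator_def orthogonal_transformation_norm[OF f])
  let ?a = "indicator A :: _ \<Rightarrow> ennreal" and ?b = "indicator B :: _ \<Rightarrow> ennreal"
  have "emeasure (distr lborel borel f) A * emeasure lborel B
      = (\<integral>\<^sup>+x. ?a (f x) * emeasure lborel B \<partial>lborel)"
  proof -
    have "emeasure (distr lborel borel f) A = (\<integral>\<^sup>+x. ?a x \<partial>distr lborel borel f)" by simp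
    also have "\<dots> = (\<integral>\<^sup>+x. ?a (f x) \<partial>lborel)" by (rule nn_integral_distr) simp_all
    finally show ?thesis by (simp add: nn_integral_multc)
  qed
  also have "\<dots> = (\<integral>\<^sup>+x. \<integral>\<^sup>+y. ?a (f x) * ?b (f x + 1 *\<^sub>R y) \<partial>lborel \<partial>lborel)"
    by (subst nn_integral_cmult, simp, subst nn_integral_lborel_translate) simp_all
  also have "\<dots> = (\<integral>\<^sup>+y. \<integral>\<^sup>+x. ?a (f x) * ?b (f x + 1 *\<^sub>R y) \<partial>lborel \<partial>lborel)"
    by (rule lborel_pair.Fubini'[symmetric]) simp
  \<comment> \<open>The shift of x by - g y replaces f x by f x - y because f (g y) = y. The ball
    factor becomes free of y, and the y integral of the other factor is the measure of A.\<close>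
  also have "\<dots> = (\<integral>\<^sup>+y. \<integral>\<^sup>+x. ?a (f (- g y + 1 *\<^sub>R x)) * ?b (f (- g y + 1 *\<^sub>R x) + 1 *\<^sub>R y) \<partial>lborel \<partial>lborel)"
    by (intro nn_integral_cong
        nn_integral_lborel_translate[where g = "\<lambda>x. ?a (f x) * ?b (f x + 1 *\<^sub>R _)", symmetric]) auto
  also have "\<dots> = (\<integral>\<^sup>+y. \<integral>\<^sup>+x. ?a (f x + (-1) *\<^sub>R y) * ?b (f x) \<partial>lborel \<partial>lborel)"
    by (simp add: linear_add[OF lin] linear_diff[OF lin] fg linear_neg[OF lin])
  also have "\<dots> = (\<integral>\<^sup>+x. \<integral>\<^sup>+y. ?a (f x + (-1) *\<^sub>R y) * ?b (f x) \<partial>lborel \<partial>lborel)"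
    by (rule lborel_pair.Fubini') simp
  also have "\<dots> = (\<integral>\<^sup>+x. emeasure lborel A * ?b (f x) \<partial>lborel)"
    by (subst nn_integral_multc, simp, subst nn_integral_lborel_translate) simp_all
  also have "\<dots> = emeasure lborel A * emeasure lborel B"
    by (simp add: nn_integral_cmult fB)
  finally have eq: "emeasure (distr lborel borel f) A * emeasure lborel B
      = emeasure lborel A * emeasure lborel B" .
  have "emeasure lborel B \<noteq> 0"
    using content_ball_pos[of 1 "0::real^'n"] by (auto simp: measure_def B_def)
  moreover have "emeasure lborel B \<noteq> \<infinity>"
    unfolding B_def using emeasure_lborel_ball_finite[of "0::real^'n" 1] by simp
  ultimately show "emeasure (distr lborel borel f) A = emeasure lborel A"
    using eq by (metis ennreal_mult_cancel_left infinity_ennreal_def mult.commute)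
qed

lemma orthogonal_transformation_measurable_surface:
  fixes f :: "real^'n::finite \<Rightarrow> real^'n"
  assumes f: "orthogonal_transformation f"
  shows "f \<in> measurable surface_measure surface_measure"
proof -
  have "f \<in> measurable (restrict_space borel (sphere 0 1)) (restrict_space borel (sphere 0 1))"
    using f by (intro measurable_restrict_space3 orthogonal_transformation_measurable)
      (auto simp: orthogonal_transformation_norm)
  then show ?thesis
    by (simp cong: measurable_cong_sets add: sets_surface_measure)
qed

text \<open>\<open>sgn\<close> commutes with f, so the cone over a preimage is the preimage of the
  cone, and the invariance of Lebesgue measure carries over.\<close>

lemma distr_surface_measure_orthogonal:
  fixes f :: "real^'n::finite \<Rightarrow> real^'n"
  assumes f: "orthogonal_transformation f"
  shows "distr surface_measure surface_measure f = surface_measure"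
proof (rule measure_eqI)
  note mf = orthogonal_transformation_measurable_surface[OF f]
  note lin = orthogonal_transformation_linear[OF f]
  show "sets (distr surface_measure surface_measure f) = sets surface_measure" by simp
  fix A assume "A \<in> sets (distr surface_measure surface_measure f)"
  then have A: "A \<in> sets surface_measure" by simp
  let ?B = "{x \<in> cball 0 1 - {0}. sgn x \<in> A}"
  have sgnf: "sgn (f x) = f (sgn x)" for x
    using f by (simp add: sgn_div_norm orthogonal_transformation_norm linear_scale[OF lin])
  have f0: "f x = 0 \<longleftrightarrow> x = 0" for x
    using orthogonal_transformation_norm[OF f, of x] by (metis norm_eq_zero)
  have B: "?B \<in> sets borel"
    using measurable_sets[OF sgn_measurable_sphere, of A] A
    by (auto simp: sets_surface_measure space_restrict_space sets_restrict_space_iff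
        vimage_def Int_def conj_commute)
  have A': "f -` A \<inter> sphere 0 1 \<in> sets surface_measure"
    using measurable_sets[OF mf A] by simp
  have eq: "{x \<in> cball 0 1 - {0}. sgn x \<in> f -` A \<inter> sphere 0 1} = f -` ?B"
    using f by (auto simp: orthogonal_transformation_norm f0 sgnf norm_sgn)
  have "emeasure (distr surface_measure surface_measure f) A
      = emeasure surface_measure (f -` A \<inter> sphere 0 1)"
    using A by (subst emeasure_distr[OF mf]) simp_all
  also have "\<dots> = of_nat CARD('n) * emeasure lborel (f -` ?B)"
    using emeasure_surface_measure[OF A'] by (simp only: eq)
  also have "emeasure lborel (f -` ?B) = emeasure (distr lborel borel f) ?B"
    using B orthogonal_transformation_measurable[OF f] by (subst emeasure_distr) auto
  also have "of_nat CARD('n) * \<dots> = emeasure surface_measure A"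
    by (simp only: distr_lborel_orthogonal[OF f] emeasure_surface_measure[OF A])
  finally show "emeasure (distr surface_measure surface_measure f) A = emeasure surface_measure A" .
qed

lemma integral_surface_orthogonal:
  fixes f :: "real^'n::finite \<Rightarrow> real^'n" and g :: "real^'n \<Rightarrow> real"
  assumes f: "orthogonal_transformation f" and g: "g \<in> borel_measurable surface_measure"
  shows "(\<integral>x. g (f x) \<partial>surface_measure) = (\<integral>x. g x \<partial>surface_measure)"
  using integral_distr[OF orthogonal_transformation_measurable_surface[OF f] g]
  by (simp add: distr_surface_measure_orthogonal[OF f])

section \<open>Integrability on the sphere and volumes of caps\<close>

lemma finite_measure_surface: "finite_measure (surface_measure :: (real^'n::finite) measure)"
proof
  have "emeasure (surface_measure :: (real^'n) measure) (sphere 0 1)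
      \<le> of_nat CARD('n) * emeasure lborel (cball (0::real^'n) 1)"
    by (subst emeasure_surface_measure)
       (auto simp: sets_surface_measure sets_restrict_space_iff intro!: mult_left_mono emeasure_mono)
  also have "\<dots> < \<infinity>"
    using emeasure_lborel_cball_finite[of "0::real^'n" 1]
    by (simp add: ennreal_mult_less_top of_nat_less_top)
  finally show "emeasure (surface_measure :: (real^'n) measure) (space surface_measure) \<noteq> \<infinity>"
    by simp
qed

interpretation surface: finite_measure "surface_measure :: (real^'n::finite) measure"
  by (rule finite_measure_surface)

lemma sphere_in_sets_surface [simp, measurable]: "sphere 0 1 \<in> sets (surface_measure :: (real^'n::finite) measure)"
  by (metis sets.top space_surface_measure)

lemma borel_measurable_surface:
  "f \<in> borel_measurable borel \<Longrightarrow> f \<in> borel_measurable (surface_measure :: (real^'n::finite) measure)"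
  by (subst measurable_cong_sets[OF sets_surface_measure refl]) (rule measurable_restrict_space1)

lemma sets_surfaceI: "A \<in> sets borel \<Longrightarrow> A \<subseteq> sphere 0 1 \<Longrightarrow> A \<in> sets (surface_measure :: (real^'n::finite) measure)"
  by (auto simp: sets_surface_measure sets_restrict_space_iff)

lemma integrable_surface_bounded:
  fixes f :: "real^'n::finite \<Rightarrow> real"
  assumes "f \<in> borel_measurable surface_measure" "\<And>x. x \<in> sphere 0 1 \<Longrightarrow> \<bar>f x\<bar> \<le> B"
  shows "integrable surface_measure f"
  using assms by (intro surface.integrable_const_bound[of _ B]) auto

lemma integrable_surface_continuous:
  fixes f :: "real^'n::finite \<Rightarrow> real"
  assumes "continuous_on UNIV f"
  shows "integrable surface_measure f"
proof -
  have "compact (f ` sphere 0 1)"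
    by (intro compact_continuous_image continuous_on_subset[OF assms]) auto
  then obtain B where "\<forall>y\<in>f ` sphere 0 1. norm y \<le> B"
    using compact_imp_bounded bounded_iff by blast
  then show ?thesis
    using assms by (intro integrable_surface_bounded[of _ B] borel_measurable_surface
      borel_measurable_continuous_onI) auto
qed

text \<open>The cone over the cap contains a box whose long side points along the axis.\<close>

lemma measure_cap_lower:
  fixes e :: "real^'n::finite"
  assumes e: "norm e = 1" and u: "0 < u" "u \<le> 1"
  shows "measure surface_measure {x \<in> sphere 0 1. x \<bullet> e \<ge> 1 - u}
    \<ge> (1/4) * (sqrt u / (4 * real CARD('n))) ^ (CARD('n) - 1)"
proof -
  obtain i :: 'n where True by simp
  define n where "n = CARD('n)"
  have n1: "n \<ge> 1" by (simp add: n_def Suc_leI)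
  obtain R :: "real^'n \<Rightarrow> real^'n" where R: "orthogonal_transformation R" "R (axis i 1) = e"
    using orthogonal_transformation_exists[of "axis i (1::real)" e] e by (auto simp: norm_axis_1)
  let ?C = "\<lambda>e::real^'n. {x \<in> sphere 0 1. x \<bullet> e \<ge> 1 - u}"
  have Cb: "?C e \<in> sets surface_measure" for e
  proof (rule sets_surfaceI)
    have "closed ({x. x \<bullet> e \<ge> 1 - u} \<inter> sphere 0 1)"
      by (intro closed_Int closed_Collect_le continuous_intros closed_sphere)
    then show "?C e \<in> sets borel" by (simp add: Int_def conj_commute borel_closed)
  qed auto
  have "emeasure surface_measure (?C e) = emeasure (distr surface_measure surface_measure R) (?C e)"
    by (simp add: distr_surface_measure_orthogonal[OF R(1)])
  also have "\<dots> = emeasure surface_measure (R -` ?C e \<inter> sphere 0 1)"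
    using emeasure_distr[OF orthogonal_transformation_measurable_surface[OF R(1)] Cb[of e]] by simp
  also have "R -` ?C e \<inter> sphere 0 1 = ?C (axis i 1)"
    using R by (auto simp: orthogonal_transformation_norm R(2)[symmetric] orthogonal_transformation_def)
  finally have e1: "emeasure surface_measure (?C e) = emeasure surface_measure (?C (axis i 1))" .
  \<comment> \<open>With transverse half-width h, the off-axis part \<open>\<rho>\<close> of |x|^2
    is at most n^2 h^2 = u/64. The cap condition tolerates u (x_i)^2, which is at least u/16 on the
    long side [1/4, 1/2]. The width 2h = sqrt u / (4 n) is the base of the claimed power.\<close>
  define h where "h = sqrt u / (8 * real n)"
  have h0: "h > 0" "h \<le> 1/8" using u n1 by (auto simp: h_def divide_simps intro: order_trans[of _ 1])
  define a :: "real^'n" where "a = (\<chi> j. if j = i then 1/4 else - h)"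
  define b :: "real^'n" where "b = (\<chi> j. if j = i then 1/2 else h)"
  have le: "a $ j \<le> b $ j" for j using h0 by (simp add: a_def b_def)
  have sub: "cbox a b \<subseteq> {x \<in> cball 0 1 - {0}. sgn x \<in> ?C (axis i 1)}"
  proof
    fix x assume "x \<in> cbox a b"
    then have xb: "a $ j \<le> x $ j \<and> x $ j \<le> b $ j" for j by (auto simp: mem_box_cart)
    have xi: "1/4 \<le> x $ i" "x $ i \<le> 1/2" using xb[of i] by (auto simp: a_def b_def)
    have xj: "\<bar>x $ j\<bar> \<le> h" if "j \<noteq> i" for j using xb[of j] that by (auto simp: a_def b_def)
    define \<rho> where "\<rho> = (\<Sum>j\<in>UNIV - {i}. (x $ j)\<^sup>2)"
    have "\<rho> \<le> (\<Sum>j\<in>UNIV - {i}. h\<^sup>2)"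
      unfolding \<rho>_def using xj by (intro sum_mono) (auto simp: abs_le_square_iff[symmetric] h0 less_imp_le)
    also have "\<dots> = real (n - 1) * h\<^sup>2" by (simp add: n_def)
    also have "\<dots> \<le> (real n)\<^sup>2 * h\<^sup>2"
      using n1 by (intro mult_right_mono) (auto simp: power2_eq_square intro: order_trans[of _ "real n"])
    also have "\<dots> = u / 64" using u n1 by (simp add: h_def power_divide power_mult_distrib)
    finally have \<rho>: "\<rho> \<le> u / 64" .
    have \<rho>0: "\<rho> \<ge> 0" unfolding \<rho>_def by (intro sum_nonneg) auto
    have nx: "(norm x)\<^sup>2 = (x $ i)\<^sup>2 + \<rho>"
    proof -
      have "(norm x)\<^sup>2 = (\<Sum>j\<in>UNIV. (x $ j)\<^sup>2)"
        unfolding norm_vec_def L2_set_def by (subst real_sqrt_pow2) (auto intro!: sum_nonneg)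
      also have "\<dots> = (x $ i)\<^sup>2 + \<rho>" unfolding \<rho>_def by (rule sum.remove) simp_all
      finally show ?thesis .
    qed
    have xi2: "(x $ i)\<^sup>2 \<ge> 1/16" "(x $ i)\<^sup>2 \<le> 1/4"
      using power_mono[OF xi(1), of 2] power_mono[OF xi(2), of 2] xi(1) by (simp_all add: power_divide)
    have n1': "norm x \<le> 1"
    proof (rule power2_le_imp_le)
      show "(norm x)\<^sup>2 \<le> 1\<^sup>2" unfolding nx using xi2 \<rho> u by simp
    qed simp
    have np: "norm x > 0" using xi by auto
    have "(1 - u) * norm x \<le> x $ i"
    proof (rule power2_le_imp_le)
      have "((1 - u) * norm x)\<^sup>2 = (1 - u)\<^sup>2 * ((x $ i)\<^sup>2 + \<rho>)" by (simp add: power_mult_distrib nx)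
      also have "\<dots> \<le> (1 - u) * ((x $ i)\<^sup>2 + \<rho>)"
        using u \<rho>0 by (intro mult_right_mono) (auto simp: power2_eq_square mult_left_le_one_le)
      also have "\<dots> = (x $ i)\<^sup>2 + \<rho> - u * (x $ i)\<^sup>2 - u * \<rho>" by (simp add: algebra_simps)
      also have "\<dots> \<le> (x $ i)\<^sup>2"
      proof -
        have "u * (x $ i)\<^sup>2 \<ge> u * (1/16)" using u xi2 by (intro mult_left_mono) auto
        moreover have "u * \<rho> \<ge> 0" using u \<rho>0 by simp
        ultimately show ?thesis using \<rho> u by linarith
      qed
      finally show "((1 - u) * norm x)\<^sup>2 \<le> (x $ i)\<^sup>2" .
    qed (use xi in auto)
    then have "sgn x \<bullet> axis i 1 \<ge> 1 - u"
      using np by (simp add: sgn_div_norm inner_axis divide_simps mult.commute)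
    then show "x \<in> {x \<in> cball 0 1 - {0}. sgn x \<in> ?C (axis i 1)}"
      using n1' np by (auto simp: norm_sgn)
  qed
  have ins: "{x \<in> cball 0 1 - {0}. sgn x \<in> ?C (axis i 1)} \<in> sets lborel"
    using measurable_sets[OF sgn_measurable_sphere, of "?C (axis i 1)"] Cb[of "axis i 1"]
    by (auto simp: sets_surface_measure space_restrict_space sets_restrict_space_iff
        vimage_def Int_def conj_commute)
  have "ennreal ((1/4) * (2 * h) ^ (n - 1)) = (\<Prod>j\<in>UNIV. ennreal (b $ j - a $ j))"
  proof -
    have "(\<Prod>j\<in>UNIV. ennreal (b $ j - a $ j)) = ennreal (\<Prod>j\<in>UNIV. b $ j - a $ j)"
      using le by (intro prod_ennreal) auto
    also have "(\<Prod>j\<in>UNIV. b $ j - a $ j) = (b $ i - a $ i) * (\<Prod>j\<in>UNIV - {i}. b $ j - a $ j)"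
      by (simp add: prod.remove)
    also have "(\<Prod>j\<in>UNIV - {i}. b $ j - a $ j) = (\<Prod>j\<in>UNIV - {i}. 2 * h)"
      by (intro prod.cong) (auto simp: a_def b_def)
    finally show ?thesis by (simp add: a_def b_def n_def)
  qed
  also have "\<dots> = emeasure lborel (cbox a b)"
  proof -
    have Bas: "(Basis :: (real^'n) set) = range (\<lambda>j. axis j 1)" by (auto simp: Basis_vec_def)
    have inj: "inj (\<lambda>j::'n. axis j (1::real))" by (auto simp: inj_on_def axis_eq_axis)
    have "emeasure lborel (cbox a b) = ennreal (\<Prod>c\<in>Basis. (b - a) \<bullet> c)"
      using le by (intro emeasure_lborel_cbox) (auto simp: Bas inner_axis)
    also have "(\<Prod>c\<in>Basis. (b - a) \<bullet> c) = (\<Prod>j\<in>UNIV. b $ j - a $ j)"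
      unfolding Bas by (subst prod.reindex[OF inj]) (simp add: inner_axis)
    also have "ennreal \<dots> = (\<Prod>j\<in>UNIV. ennreal (b $ j - a $ j))"
      using le by (intro prod_ennreal[symmetric]) auto
    finally show ?thesis by simp
  qed
  also have "\<dots> \<le> emeasure lborel {x \<in> cball 0 1 - {0}. sgn x \<in> ?C (axis i 1)}"
    using sub ins by (rule emeasure_mono)
  \<comment> \<open>The normalising factor n of the cone measure is at least 1 and is given away
    here.\<close>
  also have "\<dots> \<le> of_nat n * emeasure lborel {x \<in> cball 0 1 - {0}. sgn x \<in> ?C (axis i 1)}"
  proof -
    have "(1::ennreal) \<le> of_nat n" using n1 by (metis of_nat_1 of_nat_mono)
    from mult_right_mono[OF this] show ?thesis by simp
  qed
  also have "\<dots> = emeasure surface_measure (?C (axis i 1))"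
    using emeasure_surface_measure[OF Cb] by (simp add: n_def)
  finally have "ennreal ((1/4) * (2 * h) ^ (n - 1)) \<le> emeasure surface_measure (?C e)"
    by (simp only: e1)
  then have "ennreal ((1/4) * (2 * h) ^ (n - 1)) \<le> ennreal (measure surface_measure (?C e))"
    by (simp only: surface.emeasure_eq_measure)
  then have "(1/4) * (2 * h) ^ (n - 1) \<le> measure surface_measure (?C e)"
    by (subst (asm) ennreal_le_iff) auto
  then show ?thesis by (simp add: h_def n_def)
qed

lemma sphere_volume_pos: "sphere_volume TYPE('n::finite) > 0"
proof -
  obtain i :: 'n where True by simp
  have "0 < (1/4) * (sqrt 1 / (4 * real CARD('n))) ^ (CARD('n) - 1)"
    by (intro mult_pos_pos zero_less_power divide_pos_pos) auto
  also have "\<dots> \<le> measure surface_measure {x \<in> sphere 0 1. x \<bullet> axis i 1 \<ge> 1 - (1::real)}"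
    by (rule measure_cap_lower) (auto simp: norm_axis_1)
  also have "\<dots> \<le> measure surface_measure (sphere (0::real^'n) 1)"
    by (rule surface.finite_measure_mono) auto
  finally show ?thesis by (simp add: sphere_volume_def)
qed

section \<open>Homogeneous polynomials\<close>

text \<open>Homogeneous polynomial functions built one coordinate factor at a time, so that
  derivatives, their symmetry, linear substitutions and great-circle restrictions go by rule
  induction without multi-indices. The zero function has every degree.\<close>

inductive hpoly :: "nat \<Rightarrow> (real ^ 'n::finite \<Rightarrow> real) \<Rightarrow> bool" where
  const: "hpoly 0 (\<lambda>_. c)"
| mult_coord: "hpoly k p \<Longrightarrow> hpoly (Suc k) (\<lambda>x. x $ i * p x)"
| add: "hpoly k p \<Longrightarrow> hpoly k q \<Longrightarrow> hpoly k (\<lambda>x. p x + q x)"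

lemma hpoly_zero: "hpoly k (\<lambda>_. 0)"
proof (induction k)
  case 0 show ?case by (rule hpoly.const)
next
  case (Suc k)
  from hpoly.mult_coord[OF this] show ?case by simp
qed

lemma hpoly_scale: "hpoly k p \<Longrightarrow> hpoly k (\<lambda>x. c * p x)"
proof (induction rule: hpoly.induct)
  case (const a) show ?case by (rule hpoly.const)
next
  case (mult_coord k p i)
  from hpoly.mult_coord[OF this(2), of i] show ?case by (simp add: mult.left_commute)
next
  case (add k p q)
  from hpoly.add[OF this(3,4)] show ?case by (simp add: distrib_left)
qed

lemma hpoly_sum: "(\<And>i. i \<in> I \<Longrightarrow> hpoly k (f i)) \<Longrightarrow> hpoly k (\<lambda>x. \<Sum>i\<in>I. f i x)"
  by (induction I rule: infinite_finite_induct) (auto intro: hpoly_zero hpoly.add)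

lemma hpoly_mult: "hpoly j p \<Longrightarrow> hpoly k q \<Longrightarrow> hpoly (j + k) (\<lambda>x. p x * q x)"
proof (induction rule: hpoly.induct)
  case (const c) then show ?case by (simp add: hpoly_scale)
next
  case (mult_coord j p i)
  from hpoly.mult_coord[OF mult_coord(2)[OF mult_coord(3)], of i] show ?case by (simp add: mult.assoc)
next
  case (add j p r)
  from hpoly.add[OF add(3,4)[OF add(5)]] show ?case by (simp add: distrib_right)
qed

lemma hpoly_coord: "hpoly 1 (\<lambda>x. x $ i)"
  using hpoly.mult_coord[OF hpoly.const[of 1], of i] by simp

lemma hpoly_power: "hpoly j p \<Longrightarrow> hpoly (j * k) (\<lambda>x. p x ^ k)"
proof (induction k)
  case 0 show ?case using hpoly.const[of 1] by simp
next
  case (Suc k) from hpoly_mult[OF Suc(2) Suc(1)[OF Suc(2)]] show ?case by (simp add: add.commute)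
qed

lemma hpoly_inner: "hpoly 1 (\<lambda>x. x \<bullet> a)"
proof -
  have "hpoly 1 (\<lambda>x. \<Sum>i\<in>UNIV. a $ i * x $ i)"
    by (intro hpoly_sum hpoly_scale hpoly_coord)
  then show ?thesis by (simp add: inner_vec_def mult.commute)
qed

lemma hpoly_continuous: "hpoly k p \<Longrightarrow> continuous_on UNIV p"
  by (induction rule: hpoly.induct) (auto intro!: continuous_intros)

text \<open>Monomials are products of coordinate powers; conversely, multiplying by a coordinate
  raises one exponent and so maps the span in degree k into the span in degree k + 1.\<close>

lemma homogeneous_polys_eq: "homogeneous_polys k = {p :: real^'n::finite \<Rightarrow> real. hpoly k p}"
proof (intro equalityI subsetI)
  have mono: "hpoly (\<Sum>i\<in>UNIV. \<alpha> i) (monomial_fun \<alpha>)" for \<alpha> :: "'n \<Rightarrow> nat"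
  proof -
    have "hpoly (\<Sum>i\<in>A. \<alpha> i) (\<lambda>x. \<Prod>i\<in>A. (x $ i) ^ \<alpha> i)" if "finite A" for A :: "'n set"
      using that
    proof (induction A)
      case empty show ?case using hpoly.const[of 1] by simp
    next
      case (insert i A)
      from hpoly_mult[OF hpoly_power[OF hpoly_coord[of i], of "\<alpha> i"] insert(3)] insert(1,2)
      show ?case by simp
    qed
    then show ?thesis unfolding monomial_fun_def[abs_def] by simp
  qed
  have sub: "fun_vs.subspace {p :: real^'n \<Rightarrow> real. hpoly k p}"
    unfolding fun_vs.subspace_def
    by (auto simp: zero_fun_def plus_fun_def intro: hpoly_zero hpoly.add hpoly_scale)
  fix p :: "real^'n \<Rightarrow> real" assume "p \<in> homogeneous_polys k"
  moreover have "homogeneous_polys k \<subseteq> {p :: real^'n \<Rightarrow> real. hpoly k p}"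
    unfolding homogeneous_polys_def by (rule fun_vs.span_minimal[OF _ sub]) (use mono in auto)
  ultimately show "p \<in> {p. hpoly k p}" by auto
next
  fix p :: "real^'n \<Rightarrow> real" assume "p \<in> {p. hpoly k p}"
  then have "hpoly k p" by simp
  then show "p \<in> homogeneous_polys k"
  proof (induction rule: hpoly.induct)
    case (const c)
    have "(\<lambda>x. c * monomial_fun (\<lambda>_. 0) x) \<in> homogeneous_polys 0"
      unfolding homogeneous_polys_def by (intro fun_vs.span_scale fun_vs.span_base) auto
    then show ?case by (simp add: monomial_fun_def)
  next
    case (mult_coord k p i)
    have sub: "fun_vs.subspace {p. (\<lambda>x. x $ i * p x) \<in> homogeneous_polys (Suc k)}"
      unfolding fun_vs.subspace_def homogeneous_polys_def
    proof (intro conjI ballI allI; clarsimp)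
      let ?S = "fun_vs.span (monomial_fun ` {\<alpha>::'n\<Rightarrow>nat. sum \<alpha> UNIV = Suc k})"
      show "(\<lambda>x. 0) \<in> ?S" using fun_vs.span_zero[of "monomial_fun ` {\<alpha>::'n\<Rightarrow>nat. sum \<alpha> UNIV = Suc k}"]
        by (simp add: zero_fun_def)
      show "(\<lambda>x. x $ i * (f x + g x)) \<in> ?S"
        if "(\<lambda>x. x $ i * f x) \<in> ?S" "(\<lambda>x. x $ i * g x) \<in> ?S" for f g
        using fun_vs.span_add[OF that] by (simp add: plus_fun_def distrib_left)
      show "(\<lambda>x. x $ i * (c * f x)) \<in> ?S" if "(\<lambda>x. x $ i * f x) \<in> ?S" for c f
        using fun_vs.span_scale[OF that, of c] by (simp add: mult.left_commute)
    qed
    have "homogeneous_polys k \<subseteq> {p. (\<lambda>x. x $ i * p x) \<in> homogeneous_polys (Suc k)}"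
      unfolding homogeneous_polys_def[of k]
    proof (rule fun_vs.span_minimal[OF _ sub], clarsimp)
      fix \<alpha> :: "'n \<Rightarrow> nat" assume k: "k = sum \<alpha> UNIV"
      have "(\<lambda>x. x $ i * monomial_fun \<alpha> x) = monomial_fun (\<alpha>(i := Suc (\<alpha> i)))"
        by (rule ext) (simp add: monomial_fun_def prod.remove[of UNIV i])
      moreover have "sum (\<alpha>(i := Suc (\<alpha> i))) UNIV = Suc (sum \<alpha> UNIV)"
        by (simp add: sum.remove[of UNIV i])
      ultimately show "(\<lambda>x. x $ i * monomial_fun \<alpha> x) \<in> homogeneous_polys (Suc (sum \<alpha> UNIV))"
        unfolding homogeneous_polys_def by (auto intro!: fun_vs.span_base)
    qed
    with mult_coord(2) show ?case by auto
  next
    case (add k p q)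
    have "p + q \<in> homogeneous_polys k"
      using add(3,4) unfolding homogeneous_polys_def by (rule fun_vs.span_add)
    then show ?case by (simp add: plus_fun_def)
  qed
qed

section \<open>Calculus of homogeneous polynomials\<close>

lemma linear_coordinate:
  fixes f :: "real^'n::finite \<Rightarrow> real^'n"
  assumes f: "linear f"
  shows "f x $ j = (\<Sum>i\<in>UNIV. x $ i * f (axis i 1) $ j)"
proof -
  have "f x = f (\<Sum>i\<in>UNIV. x $ i *\<^sub>R axis i 1)"
    using basis_expansion[of x] by (simp add: scalar_mult_eq_scaleR)
  also have "\<dots> = (\<Sum>i\<in>UNIV. x $ i *\<^sub>R f (axis i 1))"
    by (simp add: linear_sum[OF f] linear_scale[OF f])
  finally show ?thesis by simp
qed

lemma hpoly_linear_comp: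
  fixes f :: "real^'n::finite \<Rightarrow> real^'n"
  assumes f: "linear f"
  shows "hpoly k p \<Longrightarrow> hpoly k (\<lambda>x. p (f x))"
proof (induction rule: hpoly.induct)
  case (const c) show ?case by (rule hpoly.const)
next
  case (mult_coord k p i)
  have "hpoly 1 (\<lambda>x. f x $ i)"
  proof -
    have "hpoly 1 (\<lambda>x. \<Sum>j\<in>UNIV. f (axis j 1) $ i * x $ j)"
      by (intro hpoly_sum hpoly_scale hpoly_coord)
    also have "(\<lambda>x. \<Sum>j\<in>UNIV. f (axis j 1) $ i * x $ j) = (\<lambda>x. f x $ i)"
      by (rule ext, subst (2) linear_coordinate[OF f]) (simp add: mult.commute)
    finally show ?thesis .
  qed
  from hpoly_mult[OF this mult_coord(2)] show ?case by simp
next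
  case (add k p q) from hpoly.add[OF add(3,4)] show ?case .
qed

lemma partial_deriv_eqI:
  assumes "(f has_derivative (\<lambda>h. \<Sum>j\<in>UNIV. h $ j * g j)) (at x)"
  shows "partial_deriv i f x = g i"
proof -
  have "((\<lambda>t::real. x + t *\<^sub>R axis i 1) has_derivative (\<lambda>t. t *\<^sub>R axis i 1)) (at 0)"
    by (auto intro!: derivative_eq_intros)
  moreover have "(f has_derivative (\<lambda>h. \<Sum>j\<in>UNIV. h $ j * g j)) (at (x + 0 *\<^sub>R axis i 1))"
    using assms by simp
  ultimately have "((\<lambda>t::real. f (x + t *\<^sub>R axis i 1)) has_derivative
      (\<lambda>t. \<Sum>j\<in>UNIV. (t *\<^sub>R axis i 1) $ j * g j)) (at 0)"
    by (rule has_derivative_compose)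
  moreover have "(\<lambda>t::real. \<Sum>j\<in>UNIV. (t *\<^sub>R axis i 1) $ j * g j) = (*) (g i)"
    by (auto simp: axis_def if_distrib if_distribR cong: if_cong)
  ultimately have "((\<lambda>t::real. f (x + t *\<^sub>R axis i 1)) has_field_derivative g i) (at 0)"
    by (simp add: has_field_derivative_def)
  then show ?thesis unfolding partial_deriv_def by (rule DERIV_imp_deriv)
qed

text \<open>Gradient, degree and Euler's identity share one induction. The clause for k = 0 is there
  because \<open>k - 1\<close> truncates: degree 0 of the partial derivatives would not say that
  they vanish, and the step from degree 0 to 1 needs that.\<close>

lemma hpoly_derivative_exists:
  "hpoly k p \<Longrightarrow> \<exists>g. (\<forall>x. (p has_derivative (\<lambda>h. \<Sum>j\<in>UNIV. h $ j * g j x)) (at x)) \<and>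
     (\<forall>j. hpoly (k - 1) (g j) \<and> (k = 0 \<longrightarrow> g j = (\<lambda>_. 0))) \<and>
     (\<forall>x. (\<Sum>j\<in>UNIV. x $ j * g j x) = real k * p x)"
proof (induction rule: hpoly.induct)
  case (const c)
  show ?case by (rule exI[of _ "\<lambda>_ _. 0"]) (auto intro: hpoly.const)
next
  case (mult_coord k p i)
  from mult_coord(2) obtain g where g: "\<And>x. (p has_derivative (\<lambda>h. \<Sum>j\<in>UNIV. h $ j * g j x)) (at x)"
    "\<And>j. hpoly (k - 1) (g j)" "\<And>j. k = 0 \<Longrightarrow> g j = (\<lambda>_. 0)"
    "\<And>x. (\<Sum>j\<in>UNIV. x $ j * g j x) = real k * p x" by auto
  let ?g = "\<lambda>j x. (if j = i then p x else 0) + x $ i * g j x"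
  show ?case
  proof (rule exI[of _ ?g], intro conjI allI impI)
    fix x
    have s: "(\<Sum>j\<in>UNIV. h $ j * ?g j x) = h $ i * p x + x $ i * (\<Sum>j\<in>UNIV. h $ j * g j x)" for h
    proof -
      have "(\<Sum>j\<in>UNIV. h $ j * (if j = i then p x else 0)) = (\<Sum>j\<in>UNIV. if j = i then h $ i * p x else 0)"
        by (intro sum.cong) auto
      then show ?thesis by (simp add: distrib_left sum.distrib sum_distrib_left mult.left_commute)
    qed
    have "((\<lambda>x. x $ i * p x) has_derivative
      (\<lambda>h. x $ i * (\<Sum>j\<in>UNIV. h $ j * g j x) + h $ i * p x)) (at x)"
      by (rule has_derivative_mult[OF bounded_linear.has_derivative[OF bounded_linear_vec_nth has_derivative_ident] g(1)])
    then show "((\<lambda>x. x $ i * p x) has_derivative (\<lambda>h. \<Sum>j\<in>UNIV. h $ j * ?g j x)) (at x)"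
      unfolding s by (simp add: add.commute)
    show "(\<Sum>j\<in>UNIV. x $ j * ?g j x) = real (Suc k) * (x $ i * p x)"
      unfolding s g(4) by (simp add: algebra_simps)
  next
    fix j
    have 1: "hpoly k (\<lambda>x. if j = i then p x else 0)"
      using mult_coord(1) by (cases "j = i") (auto intro: hpoly_zero)
    have 2: "hpoly k (\<lambda>x. x $ i * g j x)"
    proof (cases k)
      case 0 then show ?thesis using g(3) by (simp add: hpoly_zero)
    next
      case (Suc l) then show ?thesis using hpoly.mult_coord[OF g(2)[of j], of i] by simp
    qed
    show "hpoly (Suc k - 1) (?g j)" using hpoly.add[OF 1 2] by simp
  qed auto
next
  case (add k p q)
  from add(3) obtain g where g: "\<And>x. (p has_derivative (\<lambda>h. \<Sum>j\<in>UNIV. h $ j * g j x)) (at x)"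
    "\<And>j. hpoly (k - 1) (g j)" "\<And>j. k = 0 \<Longrightarrow> g j = (\<lambda>_. 0)"
    "\<And>x. (\<Sum>j\<in>UNIV. x $ j * g j x) = real k * p x" by auto
  from add(4) obtain h where h: "\<And>x. (q has_derivative (\<lambda>d. \<Sum>j\<in>UNIV. d $ j * h j x)) (at x)"
    "\<And>j. hpoly (k - 1) (h j)" "\<And>j. k = 0 \<Longrightarrow> h j = (\<lambda>_. 0)"
    "\<And>x. (\<Sum>j\<in>UNIV. x $ j * h j x) = real k * q x" by auto
  show ?case
  proof (rule exI[of _ "\<lambda>j x. g j x + h j x"], intro conjI allI impI)
    fix x
    show "((\<lambda>x. p x + q x) has_derivative (\<lambda>d. \<Sum>j\<in>UNIV. d $ j * (g j x + h j x))) (at x)"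
      using has_derivative_add[OF g(1) h(1)] by (simp add: distrib_left sum.distrib)
    show "(\<Sum>j\<in>UNIV. x $ j * (g j x + h j x)) = real k * (p x + q x)"
      by (simp add: distrib_left sum.distrib g(4) h(4))
  next
    fix j
    show "hpoly (k - 1) (\<lambda>x. g j x + h j x)" using g(2) h(2) by (rule hpoly.add)
  qed (simp add: g(3) h(3))
qed

lemma
  assumes p: "hpoly k p"
  shows hpoly_has_derivative: "(p has_derivative (\<lambda>h. \<Sum>j\<in>UNIV. h $ j * partial_deriv j p x)) (at x)"
    and hpoly_partial_deriv: "hpoly (k - 1) (partial_deriv j p)"
    and hpoly_partial_deriv_0: "k = 0 \<Longrightarrow> partial_deriv j p = (\<lambda>_. 0)"
    and hpoly_euler: "(\<Sum>j\<in>UNIV. x $ j * partial_deriv j p x) = real k * p x"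
proof -
  from hpoly_derivative_exists[OF p] obtain g where
    g: "\<And>x. (p has_derivative (\<lambda>h. \<Sum>j\<in>UNIV. h $ j * g j x)) (at x)"
    "\<And>j. hpoly (k - 1) (g j)" "\<And>j. k = 0 \<Longrightarrow> g j = (\<lambda>_. 0)"
    "\<And>x. (\<Sum>j\<in>UNIV. x $ j * g j x) = real k * p x" by auto
  have eq: "partial_deriv j p = g j" for j
    by (rule ext) (rule partial_deriv_eqI[OF g(1)])
  show "(p has_derivative (\<lambda>h. \<Sum>j\<in>UNIV. h $ j * partial_deriv j p x)) (at x)"
    "hpoly (k - 1) (partial_deriv j p)" "k = 0 \<Longrightarrow> partial_deriv j p = (\<lambda>_. 0)"
    "(\<Sum>j\<in>UNIV. x $ j * partial_deriv j p x) = real k * p x"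
    using g by (simp_all add: eq)
qed

lemma partial_deriv_add:
  "hpoly j p \<Longrightarrow> hpoly k q \<Longrightarrow>
    partial_deriv i (\<lambda>x. p x + q x) = (\<lambda>x. partial_deriv i p x + partial_deriv i q x)"
proof (rule ext, rule partial_deriv_eqI)
  fix x assume p: "hpoly j p" and q: "hpoly k q"
  show "((\<lambda>x. p x + q x) has_derivative
      (\<lambda>h. \<Sum>j\<in>UNIV. h $ j * (partial_deriv j p x + partial_deriv j q x))) (at x)"
    using has_derivative_add[OF hpoly_has_derivative[OF p] hpoly_has_derivative[OF q], of x]
    by (simp add: distrib_left sum.distrib)
qed

lemma partial_deriv_scale:
  "hpoly j p \<Longrightarrow> partial_deriv i (\<lambda>x. c * p x) = (\<lambda>x. c * partial_deriv i p x)"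
proof (rule ext, rule partial_deriv_eqI)
  fix x assume p: "hpoly j p"
  show "((\<lambda>x. c * p x) has_derivative (\<lambda>h. \<Sum>j\<in>UNIV. h $ j * (c * partial_deriv j p x))) (at x)"
    using has_derivative_mult_right[OF hpoly_has_derivative[OF p], of c x]
    by (simp add: sum_distrib_left mult.left_commute)
qed

lemma partial_deriv_mult:
  assumes "hpoly j p" "hpoly k q"
  shows "partial_deriv i (\<lambda>x. p x * q x) = (\<lambda>x. partial_deriv i p x * q x + p x * partial_deriv i q x)"
proof (rule ext, rule partial_deriv_eqI)
  fix x
  have "(\<Sum>j\<in>UNIV. h $ j * (partial_deriv j p x * q x + p x * partial_deriv j q x)) =
     p x * (\<Sum>j\<in>UNIV. h $ j * partial_deriv j q x) + (\<Sum>j\<in>UNIV. h $ j * partial_deriv j p x) * q x" for h :: "real^'a"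
    by (simp add: sum_distrib_left sum_distrib_right distrib_left sum.distrib mult_ac)
  then show "((\<lambda>x. p x * q x) has_derivative
      (\<lambda>h. \<Sum>j\<in>UNIV. h $ j * (partial_deriv j p x * q x + p x * partial_deriv j q x))) (at x)"
    using has_derivative_mult[OF hpoly_has_derivative[OF assms(1), of x] hpoly_has_derivative[OF assms(2), of x]]
    by simp
qed

lemma partial_deriv_sum:
  assumes "finite I" "\<And>l. l \<in> I \<Longrightarrow> hpoly k (p l)"
  shows "partial_deriv i (\<lambda>x. \<Sum>l\<in>I. p l x) = (\<lambda>x. \<Sum>l\<in>I. partial_deriv i (p l) x)"
  using assms
proof (induction I)
  case empty
  show ?case using hpoly_partial_deriv_0[OF hpoly.const[of 0]] by simp
next
  case (insert a I)
  then have "partial_deriv i (\<lambda>x. p a x + (\<Sum>l\<in>I. p l x)) =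
      (\<lambda>x. partial_deriv i (p a) x + partial_deriv i (\<lambda>x. \<Sum>l\<in>I. p l x) x)"
    by (intro partial_deriv_add[of k _ k] hpoly_sum) auto
  with insert show ?case by simp
qed

lemma partial_deriv_coord: "partial_deriv i (\<lambda>x. x $ l) = (\<lambda>_. if i = l then 1 else 0)"
proof (rule ext, rule partial_deriv_eqI)
  fix x :: "real^'a"
  have "((\<lambda>x. x $ l) has_derivative (\<lambda>h. h $ l)) (at x)"
    by (intro bounded_linear.has_derivative[OF bounded_linear_vec_nth] has_derivative_ident)
  then show "((\<lambda>x. x $ l) has_derivative (\<lambda>h. \<Sum>j\<in>UNIV. h $ j * (if j = l then 1 else 0))) (at x)"
    by (simp add: if_distrib cong: if_cong)
qed

text \<open>Rule induction replaces Schwarz' theorem: after two product rules with a coordinate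
  factor the result is symmetric in i and j.\<close>

lemma partial_deriv_commute:
  "hpoly k p \<Longrightarrow> partial_deriv i (partial_deriv j p) = partial_deriv j (partial_deriv i p)"
proof (induction rule: hpoly.induct)
  case (const c)
  show ?case by (simp add: hpoly_partial_deriv_0[OF hpoly.const])
next
  case (mult_coord k p l)
  have 1: "partial_deriv i (\<lambda>x. x $ l * p x) = (\<lambda>x. (if i = l then 1 else 0) * p x + x $ l * partial_deriv i p x)" for i
    using partial_deriv_mult[OF hpoly_coord mult_coord(1)] by (simp add: partial_deriv_coord)
  have 2: "partial_deriv i (\<lambda>x. (if j = l then 1 else 0) * p x + x $ l * partial_deriv j p x) =
     (\<lambda>x. (if j = l then 1 else 0) * partial_deriv i p x +
        ((if i = l then 1 else 0) * partial_deriv j p x + x $ l * partial_deriv i (partial_deriv j p) x))" for i j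
    by (subst partial_deriv_add[OF hpoly_scale[OF mult_coord(1)] hpoly_mult[OF hpoly_coord hpoly_partial_deriv[OF mult_coord(1)]]],
        subst partial_deriv_scale[OF mult_coord(1)],
        subst partial_deriv_mult[OF hpoly_coord hpoly_partial_deriv[OF mult_coord(1)]])
       (simp add: partial_deriv_coord)
  show ?case unfolding 1 2 using mult_coord(2) by (simp add: algebra_simps)
next
  case (add k p q)
  show ?case
    by (simp add: partial_deriv_add[OF add(1,2)] add(3,4)
      partial_deriv_add[OF hpoly_partial_deriv[OF add(1)] hpoly_partial_deriv[OF add(2)]])
qed

lemma hpoly_laplacian: "hpoly k p \<Longrightarrow> hpoly (k - 2) (laplacian p)"
  unfolding laplacian_def[abs_def]
  using hpoly_partial_deriv[OF hpoly_partial_deriv[of k p]]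
  by (intro hpoly_sum) (simp add: numeral_2_eq_2)

lemma laplacian_mult:
  assumes p: "hpoly j p" and q: "hpoly k q"
  shows "laplacian (\<lambda>x. p x * q x) x = laplacian p x * q x
    + 2 * (\<Sum>i\<in>UNIV. partial_deriv i p x * partial_deriv i q x) + p x * laplacian q x"
proof -
  note p' = hpoly_partial_deriv[OF p] and q' = hpoly_partial_deriv[OF q]
  have "partial_deriv i (partial_deriv i (\<lambda>x. p x * q x)) x =
    partial_deriv i (partial_deriv i p) x * q x + 2 * (partial_deriv i p x * partial_deriv i q x)
      + p x * partial_deriv i (partial_deriv i q) x" for i
    by (subst partial_deriv_mult[OF p q], subst partial_deriv_add[OF hpoly_mult[OF p' q] hpoly_mult[OF p q']],
        subst partial_deriv_mult[OF p' q], subst partial_deriv_mult[OF p q']) simp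
  then show ?thesis
    by (simp add: laplacian_def sum.distrib sum_distrib_left sum_distrib_right)
qed

text \<open>Hence partial derivatives of harmonic polynomials are harmonic, on which the induction
  over degrees in the orthogonality proof relies.\<close>

lemma laplacian_partial_deriv:
  assumes p: "hpoly k p"
  shows "laplacian (partial_deriv i p) x = partial_deriv i (laplacian p) x"
proof -
  have "laplacian (partial_deriv i p) x = (\<Sum>j\<in>UNIV. partial_deriv i (partial_deriv j (partial_deriv j p)) x)"
    unfolding laplacian_def
    by (intro sum.cong refl)
       (metis partial_deriv_commute[OF p] partial_deriv_commute[OF hpoly_partial_deriv[OF p]])
  also have "\<dots> = partial_deriv i (laplacian p) x"
    unfolding laplacian_def[abs_def]
    using partial_deriv_sum[of UNIV "k - 1 - 1" "\<lambda>j. partial_deriv j (partial_deriv j p)" i]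
      hpoly_partial_deriv[OF hpoly_partial_deriv[OF p]] by simp
  finally show ?thesis .
qed

lemma partial_deriv_linear_comp:
  fixes f :: "real^'n::finite \<Rightarrow> real^'n"
  assumes f: "linear f" and p: "hpoly k p"
  shows "partial_deriv j (\<lambda>x. p (f x)) = (\<lambda>x. \<Sum>i\<in>UNIV. f (axis j 1) $ i * partial_deriv i p (f x))"
proof (rule ext, rule partial_deriv_eqI)
  fix x
  have "(f has_derivative f) (at x)"
    using f by (simp add: linear_conv_bounded_linear bounded_linear_imp_has_derivative)
  from has_derivative_compose[OF this hpoly_has_derivative[OF p]]
  have D: "((\<lambda>x. p (f x)) has_derivative (\<lambda>h. \<Sum>i\<in>UNIV. f h $ i * partial_deriv i p (f x))) (at x)" .
  have "(\<Sum>i\<in>UNIV. f h $ i * partial_deriv i p (f x))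
      = (\<Sum>j\<in>UNIV. h $ j * (\<Sum>i\<in>UNIV. f (axis j 1) $ i * partial_deriv i p (f x)))" for h
    unfolding linear_coordinate[OF f, of h]
    by (simp add: sum_distrib_left sum_distrib_right mult.assoc) (rule sum.swap)
  then show "((\<lambda>x. p (f x)) has_derivative (\<lambda>h. \<Sum>j\<in>UNIV. h $ j *
      (\<Sum>i\<in>UNIV. f (axis j 1) $ i * partial_deriv i p (f x)))) (at x)"
    by (intro has_derivative_eq_rhs[OF D] ext)
qed

text \<open>The chain rule gives the second derivatives of p with weights
  \<open>F i j * F l j\<close>; summing over j leaves the diagonal, since the matrix of f has
  orthonormal rows.\<close>

lemma laplacian_orthogonal:
  fixes f :: "real^'n::finite \<Rightarrow> real^'n"
  assumes f: "orthogonal_transformation f" and p: "hpoly k p"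
  shows "laplacian (\<lambda>x. p (f x)) x = laplacian p (f x)"
proof -
  note lin = orthogonal_transformation_linear[OF f]
  note h = hpoly_linear_comp[OF lin hpoly_partial_deriv[OF p]]
  define F where "F = (\<lambda>i j. f (axis j 1) $ i)"
  have F: "(\<Sum>j\<in>UNIV. F i j * F l j) = (if i = l then 1 else 0)" for i l
  proof -
    have "matrix f ** transpose (matrix f) = mat 1"
      using f by (simp add: orthogonal_transformation_matrix orthogonal_matrix_def)
    then have "(matrix f ** transpose (matrix f)) $ i $ l = mat 1 $ i $ l" by simp
    then show ?thesis by (simp add: matrix_matrix_mult_def transpose_def matrix_def mat_def F_def)
  qed
  have "partial_deriv j (partial_deriv j (\<lambda>x. p (f x))) x
      = (\<Sum>i\<in>UNIV. \<Sum>l\<in>UNIV. F i j * F l j * partial_deriv l (partial_deriv i p) (f x))" for j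
  proof -
    have "partial_deriv j (partial_deriv j (\<lambda>x. p (f x)))
      = partial_deriv j (\<lambda>x. \<Sum>i\<in>UNIV. F i j * partial_deriv i p (f x))"
      by (simp add: partial_deriv_linear_comp[OF lin p] F_def)
    also have "\<dots> = (\<lambda>x. \<Sum>i\<in>UNIV. F i j * partial_deriv j (\<lambda>x. partial_deriv i p (f x)) x)"
      by (subst partial_deriv_sum[of _ "k - 1"])
         (auto intro!: hpoly_scale h[unfolded One_nat_def] simp: partial_deriv_scale[OF h])
    finally show ?thesis
      by (simp add: partial_deriv_linear_comp[OF lin hpoly_partial_deriv[OF p]] F_def sum_distrib_left mult.assoc)
  qed
  then have "laplacian (\<lambda>x. p (f x)) x
      = (\<Sum>j\<in>UNIV. \<Sum>i\<in>UNIV. \<Sum>l\<in>UNIV. F i j * F l j * partial_deriv l (partial_deriv i p) (f x))"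
    by (simp add: laplacian_def)
  also have "\<dots> = (\<Sum>i\<in>UNIV. \<Sum>l\<in>UNIV. (\<Sum>j\<in>UNIV. F i j * F l j) * partial_deriv l (partial_deriv i p) (f x))"
    unfolding sum_distrib_right
    by (rule trans[OF sum.swap]) (intro sum.cong refl sum.swap)
  also have "\<dots> = laplacian p (f x)"
    by (simp add: F laplacian_def if_distrib if_distribR cong: if_cong)
  finally show ?thesis .
qed

section \<open>The Laplacian and the surface measure\<close>

lemma partial_deriv_const: "partial_deriv i (\<lambda>_. c) = (\<lambda>_. 0)"
  by (rule hpoly_partial_deriv_0[OF hpoly.const]) simp

text \<open>Rotation by the angle \<open>\<theta>\<close> in the coordinate plane of i and j,
  written as the identity plus a correction along two axes, so that linearity and the derivative in
  the angle are read off termwise.\<close>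

definition plane_rotation :: "'n::finite \<Rightarrow> 'n \<Rightarrow> real \<Rightarrow> real^'n \<Rightarrow> real^'n" where
  "plane_rotation i j \<theta> x = x + ((cos \<theta> - 1) * x $ i - sin \<theta> * x $ j) *\<^sub>R axis i 1
     + (sin \<theta> * x $ i + (cos \<theta> - 1) * x $ j) *\<^sub>R axis j 1"

lemma orthogonal_transformation_plane_rotation:
  assumes "i \<noteq> j"
  shows "orthogonal_transformation (plane_rotation i j \<theta>)"
  unfolding orthogonal_transformation
proof (intro conjI allI)
  show "linear (plane_rotation i j \<theta>)"
    by (rule linearI) (simp_all add: plane_rotation_def algebra_simps)
  fix x :: "real^'a"
  define a b where "a = x $ i" and "b = x $ j"
  define A B where "A = (cos \<theta> - 1) * a - sin \<theta> * b" and "B = sin \<theta> * a + (cos \<theta> - 1) * b"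
  have "plane_rotation i j \<theta> x \<bullet> plane_rotation i j \<theta> x = x \<bullet> x + (2 * (A * a + B * b) + (A\<^sup>2 + B\<^sup>2))"
  proof -
    have "axis i (1::real) $ j = 0" "axis j (1::real) $ i = 0"
      "axis i (1::real) $ i = 1" "axis j (1::real) $ j = 1"
      using assms by (simp_all add: axis_def)
    then show ?thesis
      by (simp add: plane_rotation_def inner_add_left inner_add_right inner_axis inner_axis'
        flip: a_def b_def A_def B_def) (simp add: power2_eq_square algebra_simps)
  qed
  also have "2 * (A * a + B * b) + (A\<^sup>2 + B\<^sup>2) = 0"
  proof -
    have "(sin \<theta>)\<^sup>2 = 1 - (cos \<theta>)\<^sup>2" by (simp add: sin_squared_eq)
    then show ?thesis unfolding A_def B_def by algebra
  qed
  finally show "norm (plane_rotation i j \<theta> x) = norm x" by (simp add: norm_eq_sqrt_inner)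
qed

lemma plane_rotation_0 [simp]: "plane_rotation i j 0 x = x"
  by (simp add: plane_rotation_def)

text \<open>Needed at every angle, not only at 0: the mean value theorem then bounds difference
  quotients by the rotation field at some rotated point.\<close>

lemma plane_rotation_has_derivative:
  assumes ij: "i \<noteq> j" and u: "hpoly k u"
  shows "((\<lambda>\<theta>. u (plane_rotation i j \<theta> x)) has_real_derivative
    (let y = plane_rotation i j \<theta> x in y $ i * partial_deriv j u y - y $ j * partial_deriv i u y)) (at \<theta>)"
proof -
  define y where "y = plane_rotation i j \<theta> x"
  have yi: "y $ i = cos \<theta> * x $ i - sin \<theta> * x $ j" "y $ j = sin \<theta> * x $ i + cos \<theta> * x $ j"
    using ij by (auto simp: y_def plane_rotation_def axis_def algebra_simps)
  have "((\<lambda>\<theta>. plane_rotation i j \<theta> x) has_derivative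
    (\<lambda>t. (- (t * y $ j)) *\<^sub>R axis i 1 + (t * y $ i) *\<^sub>R axis j 1)) (at \<theta>)"
    unfolding plane_rotation_def
    by (auto intro!: derivative_eq_intros simp: yi algebra_simps)
  from has_derivative_compose[OF this hpoly_has_derivative[OF u]]
  have D: "((\<lambda>\<theta>. u (plane_rotation i j \<theta> x)) has_derivative
    (\<lambda>t. \<Sum>l\<in>UNIV. ((- (t * y $ j)) *\<^sub>R axis i 1 + (t * y $ i) *\<^sub>R axis j 1) $ l * partial_deriv l u y)) (at \<theta>)"
    by (simp add: y_def)
  have S: "(\<Sum>l\<in>UNIV. ((- (t * y $ j)) *\<^sub>R axis i 1 + (t * y $ i) *\<^sub>R axis j 1) $ l * partial_deriv l u y)
     = (y $ i * partial_deriv j u y - y $ j * partial_deriv i u y) * t" for t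
  proof -
    have "(\<Sum>l\<in>UNIV. ((- (t * y $ j)) *\<^sub>R axis i 1 + (t * y $ i) *\<^sub>R axis j 1) $ l * partial_deriv l u y)
      = (\<Sum>l\<in>UNIV. (if l = i then - (t * y $ j) * partial_deriv i u y else 0)
          + (if l = j then t * y $ i * partial_deriv j u y else 0))"
      by (intro sum.cong) (use ij in \<open>auto simp: axis_def\<close>)
    then show ?thesis by (simp add: sum.distrib algebra_simps)
  qed
  show ?thesis
    using D[unfolded S] by (simp add: has_field_derivative_def Let_def y_def)
qed

lemma hpoly_measurable: "hpoly k p \<Longrightarrow> p \<in> borel_measurable surface_measure"
  by (intro borel_measurable_surface borel_measurable_continuous_onI hpoly_continuous)

lemma hpoly_integrable: "hpoly k p \<Longrightarrow> integrable surface_measure p"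
  by (rule integrable_surface_continuous[OF hpoly_continuous])

lemma hpoly_bounded:
  assumes "hpoly k (p :: real^'n::finite \<Rightarrow> real)"
  obtains B where "\<And>x. x \<in> sphere 0 1 \<Longrightarrow> \<bar>p x\<bar> \<le> B"
proof -
  have "compact (p ` sphere 0 1)"
    by (intro compact_continuous_image continuous_on_subset[OF hpoly_continuous[OF assms]]) auto
  then obtain B where "\<forall>y\<in>p ` sphere 0 1. norm y \<le> B"
    using compact_imp_bounded bounded_iff by blast
  then show ?thesis using that[of B] by auto
qed

text \<open>The integral of u composed with a rotation does not depend on the angle, and the field
  is the derivative at angle 0. Difference quotients are dominated by a bound of the field on the
  sphere, which permits the limit under the integral.\<close>

lemma integral_rotation_field:
  assumes ij: "i \<noteq> j" and u: "hpoly k (u :: real^'n::finite \<Rightarrow> real)"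
  shows "(\<integral>x. x $ i * partial_deriv j u x - x $ j * partial_deriv i u x \<partial>surface_measure) = 0"
proof -
  define D where "D = (\<lambda>x. x $ i * partial_deriv j u x - x $ j * partial_deriv i u x)"
  have D: "hpoly (1 + (k - 1)) D"
    using hpoly.add[OF hpoly_mult[OF hpoly_coord hpoly_partial_deriv[OF u, of j]]
        hpoly_scale[OF hpoly_mult[OF hpoly_coord hpoly_partial_deriv[OF u, of i]]], of i "-1" j]
    by (simp add: D_def)
  obtain B where B: "\<And>x. x \<in> sphere 0 1 \<Longrightarrow> \<bar>D x\<bar> \<le> B" using hpoly_bounded[OF D] by blast
  define R where "R = (\<lambda>\<theta>. plane_rotation i j \<theta> :: real^'n \<Rightarrow> real^'n)"
  have R: "orthogonal_transformation (R \<theta>)" for \<theta>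
    unfolding R_def using ij by (rule orthogonal_transformation_plane_rotation)
  have der: "((\<lambda>\<theta>. u (R \<theta> x)) has_real_derivative D (R \<theta> x)) (at \<theta>)" for x \<theta>
    using plane_rotation_has_derivative[OF ij u, of x \<theta>] by (simp add: Let_def D_def R_def)
  define h where "h = (\<lambda>n. inverse (real (Suc n)))"
  have h: "h n > 0" for n by (simp add: h_def)
  have uR: "(\<lambda>x. u (R \<theta> x)) \<in> borel_measurable surface_measure" for \<theta>
    by (rule hpoly_measurable[OF hpoly_linear_comp[OF orthogonal_transformation_linear[OF R] u]])
  have "(\<lambda>n. \<integral>x. (u (R (h n) x) - u x) / h n \<partial>surface_measure) \<longlonglongrightarrow> (\<integral>x. D x \<partial>surface_measure)"
  proof (rule integral_dominated_convergence[where w = "\<lambda>_. B"])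
    show "D \<in> borel_measurable surface_measure" by (rule hpoly_measurable[OF D])
    show "(\<lambda>x. (u (R (h n) x) - u x) / h n) \<in> borel_measurable surface_measure" for n
      using uR hpoly_measurable[OF u] by measurable
    show "AE x in surface_measure. (\<lambda>n. (u (R (h n) x) - u x) / h n) \<longlonglongrightarrow> D x"
    proof (rule AE_I2)
      fix x :: "real^'n"
      have "((\<lambda>t. (u (R (0 + t) x) - u (R 0 x)) / t) \<longlongrightarrow> D (R 0 x)) (at 0)"
        using der[of x 0] by (simp add: DERIV_def)
      moreover have "h \<longlonglongrightarrow> 0" unfolding h_def by (rule LIMSEQ_inverse_real_of_nat)
      ultimately show "(\<lambda>n. (u (R (h n) x) - u x) / h n) \<longlonglongrightarrow> D x"
        unfolding tendsto_at_iff_sequentially using h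
        by (auto simp: o_def R_def less_imp_neq[symmetric] dest!: spec[of _ h])
    qed
    show "AE x in surface_measure. norm ((u (R (h n) x) - u x) / h n) \<le> B" for n
    proof (rule AE_I2)
      fix x :: "real^'n" assume x: "x \<in> space surface_measure"
      obtain z where z: "u (R (h n) x) - u (R 0 x) = (h n - 0) * D (R z x)"
        using MVT2[OF h[of n], of "\<lambda>\<theta>. u (R \<theta> x)" "\<lambda>\<theta>. D (R \<theta> x)"] der by blast
      have "R z x \<in> sphere 0 1" using x by (simp add: orthogonal_transformation_norm[OF R])
      then show "norm ((u (R (h n) x) - u x) / h n) \<le> B"
        using z h[of n] B by (simp add: R_def)
    qed
  qed simp
  moreover have "(\<integral>x. (u (R (h n) x) - u x) / h n \<partial>surface_measure) = 0" for n
  proof -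
    have "integrable surface_measure (\<lambda>x. u (R (h n) x))"
      by (rule hpoly_integrable[OF hpoly_linear_comp[OF orthogonal_transformation_linear[OF R] u]])
    then show ?thesis
      using integral_surface_orthogonal[OF R hpoly_measurable[OF u], of "h n"] hpoly_integrable[OF u]
      by simp
  qed
  ultimately have "(\<lambda>n. 0) \<longlonglongrightarrow> (\<integral>x. D x \<partial>surface_measure)" by (simp only:)
  then show ?thesis unfolding D_def using LIMSEQ_unique tendsto_const by blast
qed

text \<open>
  Summing the rotation fields over all coordinate planes, applied to \<open>x $ i * partial_deriv j h\<close>,
  gives the Laplace--Beltrami operator.
\<close>

lemma integral_laplacian:
  assumes h: "hpoly m (h :: real^'n::finite \<Rightarrow> real)"
  shows "(\<integral>x. laplacian h x \<partial>surface_measure)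
    = real m * (real m + real CARD('n) - 2) * (\<integral>x. h x \<partial>surface_measure)"
proof -
  note h' = hpoly_partial_deriv[OF h]
  let ?u = "\<lambda>i j x. x $ i * partial_deriv j h x"
  have u: "hpoly (1 + (m - 1)) (?u i j)" for i j
    by (rule hpoly_mult[OF hpoly_coord h'])
  let ?I = "\<lambda>i j x. x $ i * partial_deriv j (?u i j) x - x $ j * partial_deriv i (?u i j) x"
  have I0: "(\<integral>x. ?I i j x \<partial>surface_measure) = 0" for i j
    by (cases "i = j") (simp, rule integral_rotation_field[OF _ u])
  have Iint: "integrable surface_measure (?I i j)" for i j
    by (intro Bochner_Integration.integrable_diff
        hpoly_integrable[OF hpoly_mult[OF hpoly_coord hpoly_partial_deriv[OF u]]])
  have pu: "partial_deriv l (?u i j) x = (if l = i then 1 else 0) * partial_deriv j h x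
      + x $ i * partial_deriv l (partial_deriv j h) x" for l i j x
    by (simp add: partial_deriv_mult[OF hpoly_coord h'] partial_deriv_coord)
  have sumI: "(\<Sum>i\<in>UNIV. \<Sum>j\<in>UNIV. ?I i j x)
      = laplacian h x - real m * (real m + real CARD('n) - 2) * h x" if x: "x \<in> sphere 0 1" for x
  proof -
    have xx: "(\<Sum>i\<in>UNIV. x $ i * x $ i) = 1"
      using x by (simp add: norm_eq_sqrt_inner inner_vec_def)
    have e: "(\<Sum>j\<in>UNIV. x $ j * partial_deriv j h x) = real m * h x" by (rule hpoly_euler[OF h])
    have e2: "(\<Sum>i\<in>UNIV. x $ i * partial_deriv i (partial_deriv j h) x) = real (m - 1) * partial_deriv j h x" for j
      by (rule hpoly_euler[OF h'])
    have "(\<Sum>i\<in>UNIV. \<Sum>j\<in>UNIV. ?I i j x) =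
       (\<Sum>i\<in>UNIV. \<Sum>j\<in>UNIV. (if j = i then x $ i * partial_deriv i h x else 0)
         + x $ i * x $ i * partial_deriv j (partial_deriv j h) x
         - x $ j * partial_deriv j h x - x $ j * (x $ i * partial_deriv i (partial_deriv j h) x))"
      by (intro sum.cong refl) (auto simp: pu algebra_simps)
    also have "\<dots> = real m * h x + laplacian h x - real CARD('n) * (real m * h x)
       - (\<Sum>i\<in>UNIV. \<Sum>j\<in>UNIV. x $ j * (x $ i * partial_deriv i (partial_deriv j h) x))"
    proof -
      have "(\<Sum>i\<in>UNIV. \<Sum>j\<in>UNIV. x $ i * x $ i * partial_deriv j (partial_deriv j h) x) = laplacian h x"
        by (simp add: laplacian_def sum_distrib_left[symmetric] sum_distrib_right[symmetric] xx)
      then show ?thesis by (simp add: sum.distrib sum_subtractf e)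
    qed
    also have "(\<Sum>i\<in>UNIV. \<Sum>j\<in>UNIV. x $ j * (x $ i * partial_deriv i (partial_deriv j h) x))
       = real (m - 1) * (real m * h x)"
    proof -
      have "(\<Sum>i\<in>UNIV. \<Sum>j\<in>UNIV. x $ j * (x $ i * partial_deriv i (partial_deriv j h) x))
          = (\<Sum>j\<in>UNIV. x $ j * (\<Sum>i\<in>UNIV. x $ i * partial_deriv i (partial_deriv j h) x))"
        by (subst sum.swap) (simp only: sum_distrib_left)
      also have "\<dots> = real (m - 1) * (\<Sum>j\<in>UNIV. x $ j * partial_deriv j h x)"
        unfolding e2 by (simp only: sum_distrib_left mult.left_commute)
      finally show ?thesis by (simp only: e)
    qed
    \<comment> \<open>At m = 0 the truncated \<open>m - 1\<close> is 0 instead of -1, but the factor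
      m vanishes.\<close>
    also have "real (m - 1) * (real m * h x) = (real m - 1) * (real m * h x)"
      by (cases m) auto
    finally show ?thesis by (simp add: algebra_simps)
  qed
  have "0 = (\<Sum>i\<in>UNIV. \<Sum>j\<in>UNIV. \<integral>x. ?I i j x \<partial>surface_measure)"
    by (simp only: I0) simp
  also have "\<dots> = (\<integral>x. (\<Sum>i\<in>UNIV. \<Sum>j\<in>UNIV. ?I i j x) \<partial>surface_measure)"
    using Iint by (subst Bochner_Integration.integral_sum)
      (auto intro!: Bochner_Integration.integrable_sum sum.cong Bochner_Integration.integral_sum[symmetric])
  also have "\<dots> = (\<integral>x. laplacian h x - real m * (real m + real CARD('n) - 2) * h x \<partial>surface_measure)"
    by (intro Bochner_Integration.integral_cong refl sumI) simp
  also have "\<dots> = (\<integral>x. laplacian h x \<partial>surface_measure)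
      - real m * (real m + real CARD('n) - 2) * (\<integral>x. h x \<partial>surface_measure)"
    using hpoly_integrable[OF hpoly_laplacian[OF h]] hpoly_integrable[OF h] by simp
  finally show ?thesis by simp
qed

text \<open>Integrate the Laplacian of p q, which is 2 grad p . grad q + p laplacian q because p is
  harmonic. Every term on the right pairs a harmonic polynomial with one of smaller degree than q,
  again below its own degree, so induction on j makes it 0. The factor (k + j) (k + j + n - 2) is
  nonzero since k > j and n \<ge> 2.\<close>

lemma harmonic_orthogonal_lower:
  fixes p q :: "real^'n::finite \<Rightarrow> real"
  assumes n: "CARD('n) \<ge> 2"
  shows "hpoly k p \<Longrightarrow> (\<And>x. laplacian p x = 0) \<Longrightarrow> hpoly j q \<Longrightarrow> j < k \<Longrightarrow>
    (\<integral>x. p x * q x \<partial>surface_measure) = 0"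
proof (induction j arbitrary: k p q rule: less_induct)
  case (less j)
  note p = less.prems(1) and lap = less.prems(2) and q = less.prems(3)
  have gr: "(\<integral>x. partial_deriv i p x * partial_deriv i q x \<partial>surface_measure) = 0" for i
  proof (cases "j = 0")
    case True then show ?thesis using hpoly_partial_deriv_0[OF q] by simp
  next
    case False
    have "laplacian (partial_deriv i p) x = 0" for x
    proof -
      have "laplacian p = (\<lambda>_. 0)" using lap by auto
      then show ?thesis
        by (simp add: laplacian_partial_deriv[OF p] partial_deriv_const)
    qed
    then show ?thesis
      using False less.prems(4)
      by (intro less.IH[of "j - 1" "k - 1"] hpoly_partial_deriv[OF p] hpoly_partial_deriv[OF q]) auto
  qed
  have lq: "(\<integral>x. p x * laplacian q x \<partial>surface_measure) = 0"
  proof (cases "j = 0")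
    case True
    then have "laplacian q x = 0" for x
      unfolding laplacian_def using hpoly_partial_deriv_0[OF q] by (simp add: partial_deriv_const)
    then show ?thesis by simp
  next
    case False
    then show ?thesis
      using less.prems(4) by (intro less.IH[of "j - 2" k] p lap hpoly_laplacian[OF q]) auto
  qed
  have "real (k + j) * (real (k + j) + real CARD('n) - 2) * (\<integral>x. p x * q x \<partial>surface_measure)
      = (\<integral>x. laplacian (\<lambda>x. p x * q x) x \<partial>surface_measure)"
    using integral_laplacian[OF hpoly_mult[OF p q]] by simp
  also have "\<dots> = (\<integral>x. 2 * (\<Sum>i\<in>UNIV. partial_deriv i p x * partial_deriv i q x) + p x * laplacian q x \<partial>surface_measure)"
    by (simp add: laplacian_mult[OF p q] lap)
  also have "\<dots> = 2 * (\<Sum>i\<in>UNIV. \<integral>x. partial_deriv i p x * partial_deriv i q x \<partial>surface_measure)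
      + (\<integral>x. p x * laplacian q x \<partial>surface_measure)"
  proof -
    have i1: "integrable surface_measure (\<lambda>x. partial_deriv i p x * partial_deriv i q x)" for i
      by (rule hpoly_integrable[OF hpoly_mult[OF hpoly_partial_deriv[OF p] hpoly_partial_deriv[OF q]]])
    have i2: "integrable surface_measure (\<lambda>x. p x * laplacian q x)"
      by (rule hpoly_integrable[OF hpoly_mult[OF p hpoly_laplacian[OF q]]])
    show ?thesis using i1 i2
      by (subst Bochner_Integration.integral_add)
         (auto intro!: Bochner_Integration.integrable_sum simp: Bochner_Integration.integral_sum)
  qed
  also have "\<dots> = 0" by (simp add: gr lq)
  finally show ?case using n less.prems(4) by auto
qed

section \<open>Legendre polynomials\<close>

definition legendre_weight :: "nat \<Rightarrow> real \<Rightarrow> real" where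
  "legendre_weight n t = (1 - t\<^sup>2) powr ((real n - 3) / 2)"

definition weight_integral :: "nat \<Rightarrow> real poly \<Rightarrow> real" where
  "weight_integral n q = (LBINT t:{-1..1}. poly q t * legendre_weight n t)"

text \<open>The most singular weight that occurs, at n = 2, with antiderivative arcsin. It dominates
  the weights of all n \<ge> 2.\<close>

lemma set_integrable_arcsin_weight: "set_integrable lborel {-1..1} (\<lambda>t::real. (1 - t\<^sup>2) powr (-1/2))"
proof -
  have "((\<lambda>t. (1 - t\<^sup>2) powr (-1/2)) has_integral (arcsin 1 - arcsin (-1))) {-1..1}"
  proof (rule fundamental_theorem_of_calculus_interior)
    show "(arcsin has_vector_derivative (1 - x\<^sup>2) powr (-1/2)) (at x)" if "x \<in> {-1<..<1}" for x :: real
    proof -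
      have "x\<^sup>2 < 1" using that by (simp add: abs_square_less_1 abs_less_iff)
      then have "(1 - x\<^sup>2) powr (-1/2) = inverse (sqrt (1 - x\<^sup>2))"
        by (simp add: powr_minus powr_half_sqrt[symmetric])
      then show ?thesis
        using DERIV_arcsin[of x] that by (simp add: has_real_derivative_iff_has_vector_derivative)
    qed
    show "continuous_on {-1..1} arcsin" by (rule continuous_on_arcsin')
  qed simp
  then have "(\<lambda>t::real. (1 - t\<^sup>2) powr (-1/2)) absolutely_integrable_on {-1..1}"
    by (intro nonnegative_absolutely_integrable_1) (auto simp: integrable_on_def)
  then show ?thesis
    unfolding set_integrable_def by (subst (asm) integrable_completion) simp_all
qed

lemma set_integrable_legendre_weight:
  assumes n: "n \<ge> 2" and f: "continuous_on {-1..1} f"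
  shows "set_integrable lborel {-1..1} (\<lambda>t. f t * legendre_weight n t)"
proof -
  have "compact (f ` {-1..1})" by (intro compact_continuous_image f) auto
  then obtain B where B: "\<forall>y\<in>f ` {-1..1}. norm y \<le> B"
    using compact_imp_bounded bounded_iff by blast
  have [measurable]: "(\<lambda>t. indicator {-1..1} t *\<^sub>R f t) \<in> borel_measurable borel"
    by (rule borel_measurable_continuous_on_indicator[OF _ f]) simp
  have meas: "(\<lambda>t. (indicator {-1..1} t *\<^sub>R f t) * legendre_weight n t) \<in> borel_measurable lborel"
    unfolding legendre_weight_def by measurable
  have "integrable lborel (\<lambda>t. B * (indicator {-1..1} t *\<^sub>R (1 - t\<^sup>2) powr (-1/2)))"
    using set_integrable_arcsin_weight unfolding set_integrable_def by (intro integrable_mult_right)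
  then have "integrable lborel (\<lambda>t. (indicator {-1..1} t *\<^sub>R f t) * legendre_weight n t)"
  proof (rule Bochner_Integration.integrable_bound[OF _ meas], intro AE_I2)
    fix t :: real
    show "norm ((indicator {-1..1} t *\<^sub>R f t) * legendre_weight n t)
       \<le> norm (B * (indicator {-1..1} t *\<^sub>R (1 - t\<^sup>2) powr (-1/2)))"
    proof (cases "t \<in> {-1..1}")
      case True
      then have t: "t\<^sup>2 \<le> 1" by (simp add: abs_square_le_1 abs_le_iff)
      have "legendre_weight n t \<le> (1 - t\<^sup>2) powr (-1/2)"
        unfolding legendre_weight_def using n t by (intro powr_mono') auto
      moreover have "\<bar>f t\<bar> \<le> B" using B True by auto
      moreover have "legendre_weight n t \<ge> 0" by (simp add: legendre_weight_def)
      ultimately show ?thesis using True by (auto simp: abs_mult intro!: mult_mono)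
    qed simp
  qed
  then show ?thesis by (simp add: set_integrable_def mult.assoc)
qed

lemma weight_integrable:
  "n \<ge> 2 \<Longrightarrow> set_integrable lborel {-1..1} (\<lambda>t. poly q t * legendre_weight n t)"
  by (rule set_integrable_legendre_weight) (auto intro!: continuous_intros)

lemma weight_integral_add:
  "n \<ge> 2 \<Longrightarrow> weight_integral n (p + q) = weight_integral n p + weight_integral n q"
  unfolding weight_integral_def
  by (simp add: distrib_right set_integral_add[OF weight_integrable weight_integrable])

lemma weight_integral_smult: "weight_integral n (smult c p) = c * weight_integral n p"
  unfolding weight_integral_def by (simp add: mult.assoc)

lemma weight_integral_diff:
  "n \<ge> 2 \<Longrightarrow> weight_integral n (p - q) = weight_integral n p - weight_integral n q"
  using weight_integral_add[of n p "smult (-1) q"] weight_integral_smult[of n "-1" q] by simp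

lemma weight_integral_0 [simp]: "weight_integral n 0 = 0"
  by (simp add: weight_integral_def)

text \<open>The weight is positive on the open interval and p has finitely many roots. This
  definiteness is what makes orthogonal polynomials unique below.\<close>

lemma weight_integral_square_pos:
  assumes n: "n \<ge> 2" and p: "p \<noteq> 0"
  shows "weight_integral n (p * p) > 0"
proof -
  let ?f = "\<lambda>t. indicator {-1..1} t *\<^sub>R (poly (p * p) t * legendre_weight n t)"
  have nonneg: "?f t \<ge> 0" for t by (auto simp: legendre_weight_def indicator_def)
  have int: "integrable lborel ?f" using weight_integrable[OF n, of "p * p"] by (simp add: set_integrable_def)
  have "weight_integral n (p * p) \<noteq> 0"
  proof
    assume "weight_integral n (p * p) = 0"
    then have "AE t in lborel. ?f t = 0"
      using integral_nonneg_eq_0_iff_AE[OF int] nonneg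
      by (simp add: weight_integral_def set_lebesgue_integral_def)
    then have "AE t in lborel. t \<notin> {-1<..<1} - {t. poly p t = 0}"
    proof eventually_elim
      case (elim t)
      have "t\<^sup>2 < 1" if "t \<in> {-1<..<1}"
        using that by (simp add: abs_square_less_1 abs_less_iff)
      with elim show ?case by (auto simp: legendre_weight_def)
    qed
    then have "emeasure lborel ({-1<..<1} - {t. poly p t = 0}) = 0"
      by (subst (asm) AE_iff_measurable[of "{-1<..<1} - {t. poly p t = 0}"])
         (auto simp: finite_imp_closed poly_roots_finite[OF p])
    moreover have "emeasure lborel ({-1<..<1} - {t. poly p t = 0}) = emeasure lborel {-1<..<(1::real)}"
      by (intro emeasure_Diff_null_set)
         (auto simp: finite_imp_null_set_lborel poly_roots_finite[OF p])
    ultimately show False by simp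
  qed
  moreover have "weight_integral n (p * p) \<ge> 0"
    unfolding weight_integral_def set_lebesgue_integral_def using nonneg by (rule Bochner_Integration.integral_nonneg)
  ultimately show ?thesis by simp
qed

lemma weight_integral_1_pos: "n \<ge> 2 \<Longrightarrow> weight_integral n 1 > 0"
  using weight_integral_square_pos[of n 1] by simp

text \<open>Raising the exponent of the weight by one gives a factor that vanishes at both ends for
  n \<ge> 2 and so removes boundary terms.\<close>

lemma one_minus_square_powr_derivative:
  fixes t :: real
  assumes "\<bar>t\<bar> < 1"
  shows "((\<lambda>t. (1 - t\<^sup>2) powr ((real n - 1) / 2)) has_real_derivative
    - ((real n - 1) * t * legendre_weight n t)) (at t)"
    and "(1 - t\<^sup>2) powr ((real n - 1) / 2) = (1 - t\<^sup>2) * legendre_weight n t"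
proof -
  have t: "1 - t\<^sup>2 > 0" using assms by (simp add: abs_square_less_1)
  have e: "(real n - 1) / 2 - 1 = (real n - 3) / 2" by (simp add: field_simps)
  have "((\<lambda>t. (1 - t\<^sup>2) powr ((real n - 1) / 2)) has_real_derivative
     (real n - 1) / 2 * (1 - t\<^sup>2) powr ((real n - 1) / 2 - 1) * (- (2 * t))) (at t)"
    using t by (auto intro!: derivative_eq_intros)
  then show "((\<lambda>t. (1 - t\<^sup>2) powr ((real n - 1) / 2)) has_real_derivative
    - ((real n - 1) * t * legendre_weight n t)) (at t)"
    unfolding e legendre_weight_def by (rule DERIV_cong) (simp add: field_simps)
  have "(1 - t\<^sup>2) powr ((real n - 1) / 2) = (1 - t\<^sup>2) powr (1 + (real n - 3) / 2)"
    by (simp add: field_simps)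
  then show "(1 - t\<^sup>2) powr ((real n - 1) / 2) = (1 - t\<^sup>2) * legendre_weight n t"
    using t by (simp add: powr_add legendre_weight_def)
qed

lemma continuous_on_one_minus_square_powr:
  assumes "n \<ge> 2" and S: "S \<subseteq> {-1..1}"
  shows "continuous_on S (\<lambda>t::real. (1 - t\<^sup>2) powr ((real n - 1) / 2))"
  using assms
  by (intro continuous_on_powr' continuous_intros) (auto simp: abs_square_le_1 abs_le_iff)

text \<open>The integrand is the derivative of q times (1 - t^2)^((n-1)/2), which is 0 at both
  ends.\<close>

lemma weight_integral_divergence:
  assumes n: "n \<ge> 2"
  shows "weight_integral n ([:1, 0, -1:] * pderiv q - smult (real n - 1) ([:0, 1:] * q)) = 0"
proof -
  let ?r = "[:1, 0, -1:] * pderiv q - smult (real n - 1) ([:0, 1:] * q)"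
  let ?F = "\<lambda>t. poly q t * (1 - t\<^sup>2) powr ((real n - 1) / 2)"
  have "((\<lambda>t. poly ?r t * legendre_weight n t) has_integral (?F 1 - ?F (-1))) {-1..1}"
  proof (rule fundamental_theorem_of_calculus_interior)
    show "continuous_on {-1..1} ?F"
      using n by (intro continuous_intros continuous_on_one_minus_square_powr) auto
    fix t :: real assume t: "t \<in> {-1<..<1}"
    then have t': "\<bar>t\<bar> < 1" by auto
    have "(?F has_real_derivative
       poly (pderiv q) t * (1 - t\<^sup>2) powr ((real n - 1) / 2)
         + (- ((real n - 1) * t * legendre_weight n t)) * poly q t) (at t)"
      by (rule DERIV_mult[OF poly_DERIV one_minus_square_powr_derivative(1)[OF t']])
    moreover have "poly (pderiv q) t * (1 - t\<^sup>2) powr ((real n - 1) / 2)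
         + (- ((real n - 1) * t * legendre_weight n t)) * poly q t = poly ?r t * legendre_weight n t"
      unfolding one_minus_square_powr_derivative(2)[OF t']
      by (simp add: algebra_simps power2_eq_square)
    ultimately show "(?F has_vector_derivative poly ?r t * legendre_weight n t) (at t)"
      by (simp add: has_real_derivative_iff_has_vector_derivative)
  qed simp
  then have "integral {-1..1} (\<lambda>t. poly ?r t * legendre_weight n t) = 0"
    by (simp add: integral_unique)
  then show ?thesis
    unfolding weight_integral_def by (subst set_borel_integral_eq_integral(2)[OF weight_integrable[OF n]])
qed

text \<open>The divergence identity for q = t^(m-1). At m = 1 the truncated exponent
  \<open>m - 2\<close> is harmless, as its coefficient m - 1 is 0.\<close>

lemma weight_integral_monom:
  assumes n: "n \<ge> 2" and m: "m \<ge> 1"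
  shows "(real m + real n - 2) * weight_integral n (monom 1 m)
    = (real m - 1) * weight_integral n (monom 1 (m - 2))"
proof -
  have "[:1, 0, -1:] * pderiv (monom 1 (m - 1)) - smult (real n - 1) ([:0, 1:] * monom 1 (m - 1))
     = smult (real m - 1) (monom 1 (m - 2)) - smult (real m + real n - 2) (monom 1 m)"
  proof -
    obtain l where l: "m = Suc l" using m by (cases m) auto
    have a: "[:1, 0, -1:] * r = r - pCons 0 (pCons 0 r)" "[:0, 1:] * r = pCons 0 r" for r :: "real poly"
      by simp_all
    show ?thesis
      unfolding a
      by (rule poly_eqI; cases l) (auto simp: l pderiv_monom coeff_pCons algebra_simps split: nat.splits)
  qed
  with weight_integral_divergence[OF n, of "monom 1 (m - 1)"] show ?thesis
    by (simp only: weight_integral_diff[OF n] weight_integral_smult)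
qed

text \<open>The value at 1 is left free and the degree is only bounded, so that multiples,
  differences and images under the differential operator stay in the class.\<close>

definition legendre_like :: "nat \<Rightarrow> nat \<Rightarrow> real poly \<Rightarrow> bool" where
  "legendre_like n k A \<longleftrightarrow> degree A \<le> k \<and>
     (\<forall>q. q = 0 \<or> degree q < k \<longrightarrow> weight_integral n (A * q) = 0)"

lemma legendre_like_smult: "legendre_like n k A \<Longrightarrow> legendre_like n k (smult c A)"
  by (auto simp: legendre_like_def weight_integral_smult intro: order_trans[OF degree_smult_le])

text \<open>The combination that cancels the coefficients of t^k has degree below k and is therefore
  orthogonal to itself, hence 0. The same argument shows that P has a nonzero coefficient at
  t^k.\<close>

lemma legendre_like_proportional:
  assumes n: "n \<ge> 2" and A: "legendre_like n k A" and P: "legendre_like n k P" and P1: "poly P 1 = 1"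
  shows "A = smult (poly A 1) P"
proof -
  define r where "r = smult (coeff P k) A - smult (coeff A k) P"
  have low: "R = 0" if "legendre_like n k R" "R = 0 \<or> degree R < k" for R
    using that weight_integral_square_pos[OF n, of R] by (force simp: legendre_like_def)
  have "degree r \<le> k"
    using A P unfolding r_def legendre_like_def
    by (intro degree_diff_le order_trans[OF degree_smult_le]) auto
  moreover have "coeff r k = 0" by (simp add: r_def)
  ultimately have deg: "r = 0 \<or> degree r < k"
    by (metis le_neq_implies_less leading_coeff_0_iff)
  have "legendre_like n k r"
    using A P \<open>degree r \<le> k\<close> unfolding legendre_like_def r_def
    by (simp add: left_diff_distrib weight_integral_diff[OF n] weight_integral_smult)
  from low[OF this deg] have r: "smult (coeff P k) A = smult (coeff A k) P" by (simp add: r_def)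
  have "coeff P k \<noteq> 0"
  proof
    assume "coeff P k = 0"
    then have "P = 0 \<or> degree P < k"
      using P unfolding legendre_like_def by (metis le_neq_implies_less leading_coeff_0_iff)
    from low[OF P this] P1 show False by simp
  qed
  then have "A = smult (coeff A k / coeff P k) P"
    using arg_cong[OF r, of "smult (1 / coeff P k)"] by simp
  moreover from arg_cong[OF this, of "\<lambda>p. poly p 1"] have "poly A 1 = coeff A k / coeff P k"
    using P1 by simp
  ultimately show ?thesis by simp
qed

lemma legendre_like_degree:
  assumes n: "n \<ge> 2" and A: "legendre_like n k A" and "A \<noteq> 0"
  shows "degree A = k"
  using assms weight_integral_square_pos[OF n, of A] unfolding legendre_like_def
  by (metis le_neq_implies_less order_less_irrefl)

text \<open>Makes the definite description usable: uniqueness is proportionality together with the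
  value at 1.\<close>

lemma legendre_poly_eqI:
  assumes n: "n \<ge> 2" and P: "legendre_like n k P" and P1: "poly P 1 = 1"
  shows "legendre_poly n k = P"
  unfolding legendre_poly_def
proof (rule the_equality)
  have int: "(LBINT t:{-1..1}. poly p t * poly q t * (1 - t\<^sup>2) powr ((real n - 3) / 2)) = weight_integral n (p * q)"
    for p q by (simp add: weight_integral_def legendre_weight_def)
  show "degree P = k \<and> poly P 1 = 1 \<and> (\<forall>q. q = 0 \<or> degree q < k \<longrightarrow>
        (LBINT t:{-1..1}. poly P t * poly q t * (1 - t\<^sup>2) powr ((real n - 3) / 2)) = 0)"
  proof -
    have "P \<noteq> 0" using P1 by auto
    then show ?thesis
      unfolding int using P P1 legendre_like_degree[OF n P] by (simp add: legendre_like_def)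
  qed
  fix p assume "degree p = k \<and> poly p 1 = 1 \<and> (\<forall>q. q = 0 \<or> degree q < k \<longrightarrow>
        (LBINT t:{-1..1}. poly p t * poly q t * (1 - t\<^sup>2) powr ((real n - 3) / 2)) = 0)"
  then have "legendre_like n k p" "poly p 1 = 1" unfolding int by (auto simp: legendre_like_def)
  from legendre_like_proportional[OF n this(1) P P1] this(2) show "p = P" by simp
qed

text \<open>The ultraspherical operator, that is, Laplace-Beltrami on the sphere of R^n acting on
  functions of x . e. In divergence form it is the derivative of (1 - t^2)^((n-1)/2) p' divided by
  the weight.\<close>

definition gegenbauer_op :: "nat \<Rightarrow> real poly \<Rightarrow> real poly" where
  "gegenbauer_op n p = [:1, 0, -1:] * pderiv (pderiv p) - smult (real n - 1) ([:0, 1:] * pderiv p)"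

text \<open>Both sides equal minus the weighted integral of (1 - t^2) p' q'.\<close>

lemma gegenbauer_op_adjoint:
  assumes n: "n \<ge> 2"
  shows "weight_integral n (gegenbauer_op n p * q) = weight_integral n (p * gegenbauer_op n q)"
proof -
  have "gegenbauer_op n p * q + [:1, 0, -1:] * (pderiv p * pderiv q)
      = [:1, 0, -1:] * pderiv (pderiv p * q) - smult (real n - 1) ([:0, 1:] * (pderiv p * q))" for p q
    by (simp add: gegenbauer_op_def pderiv_mult algebra_simps)
  then have *: "weight_integral n (gegenbauer_op n p * q)
      = - weight_integral n ([:1, 0, -1:] * (pderiv p * pderiv q))" for p q
    using weight_integral_divergence[OF n, of "pderiv p * q"] weight_integral_add[OF n]
    by (metis add_eq_0_iff2)
  show ?thesis using *[of p q] *[of q p] by (simp add: mult.commute)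
qed

text \<open>Shows that no degree is raised and that t^i is multiplied by - i (i + n - 2) up to lower
  degree, the later eigenvalue.\<close>

lemma coeff_gegenbauer_op:
  "coeff (gegenbauer_op n p) i =
     real (Suc (Suc i)) * real (Suc i) * coeff p (Suc (Suc i)) - real i * (real i + real n - 2) * coeff p i"
proof -
  have e1: "gegenbauer_op n p = pderiv (pderiv p) - pCons 0 (pCons 0 (pderiv (pderiv p)))
      - smult (real n - 1) (pCons 0 (pderiv p))"
    by (simp add: gegenbauer_op_def)
  have e2: "coeff (pCons 0 (pderiv p)) i = real i * coeff p i"
    by (cases i) (simp_all add: coeff_pderiv)
  have e3: "coeff (pCons 0 (pCons 0 (pderiv (pderiv p)))) i = real i * (real i - 1) * coeff p i"
    by (auto simp: coeff_pCons coeff_pderiv split: nat.split)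
  show ?thesis
    unfolding e1 coeff_diff coeff_smult e2 e3 by (simp add: coeff_pderiv algebra_simps)
qed

lemma degree_gegenbauer_op: "degree (gegenbauer_op n p) \<le> degree p"
  by (rule degree_le) (simp add: coeff_gegenbauer_op coeff_eq_0)

text \<open>Self-adjointness and the degree bound carry orthogonality to lower degrees over from P
  to its image, so the image is a multiple of P. The factor is read off the coefficient of
  t^k.\<close>

lemma legendre_ode:
  assumes n: "n \<ge> 2" and P: "legendre_like n k P" and P1: "poly P 1 = 1"
  shows "gegenbauer_op n P = smult (- (real k * (real k + real n - 2))) P"
proof -
  have L: "legendre_like n k (gegenbauer_op n P)"
    unfolding legendre_like_def
  proof (intro conjI allI impI)
    show "degree (gegenbauer_op n P) \<le> k"
      using degree_gegenbauer_op[of n P] P by (simp add: legendre_like_def)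
    fix q :: "real poly" assume "q = 0 \<or> degree q < k"
    then have "gegenbauer_op n q = 0 \<or> degree (gegenbauer_op n q) < k"
      using degree_gegenbauer_op[of n q] by (auto simp: gegenbauer_op_def)
    then show "weight_integral n (gegenbauer_op n P * q) = 0"
      using P unfolding gegenbauer_op_adjoint[OF n] legendre_like_def by blast
  qed
  have eq: "gegenbauer_op n P = smult (poly (gegenbauer_op n P) 1) P"
    by (rule legendre_like_proportional[OF n L P P1])
  have deg: "degree P = k" using P1 by (intro legendre_like_degree[OF n P]) auto
  have "coeff (gegenbauer_op n P) k = poly (gegenbauer_op n P) 1 * coeff P k"
    using arg_cong[OF eq, of "\<lambda>p. coeff p k"] by simp
  moreover have "coeff P k \<noteq> 0" using deg P1 by auto
  moreover have "coeff P (Suc (Suc k)) = 0" using deg by (simp add: coeff_eq_0)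
  ultimately have "poly (gegenbauer_op n P) 1 * coeff P k = - (real k * (real k + real n - 2)) * coeff P k"
    by (simp add: coeff_gegenbauer_op)
  then have "poly (gegenbauer_op n P) 1 = - (real k * (real k + real n - 2))"
    using \<open>coeff P k \<noteq> 0\<close> mult_right_cancel by blast
  with eq show ?thesis by simp
qed

text \<open>
  By the differential equation, \<open>(1 - t\<^sup>2) powr ((n - 1) / 2) * (P' t - c)\<close> increases to \<open>0\<close>
  on \<open>[1/2, 1]\<close> for a suitable \<open>c\<close>, which bounds the derivative of \<open>P\<close> near \<open>1\<close>.
\<close>

lemma legendre_lower_bound:
  assumes n: "n \<ge> 2" and P: "legendre_like n k P" and P1: "poly P 1 = 1"
    and bd: "\<And>t. t \<in> {-1..1} \<Longrightarrow> poly P t \<le> 1" and t: "1/2 \<le> t" "t \<le> 1"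
  shows "poly P t \<ge> 1 - 2 * (real k)\<^sup>2 * (1 - t)"
proof -
  define L where "L = real k * (real k + real n - 2)"
  have L0: "L \<ge> 0" using n by (simp add: L_def)
  have Lk: "L \<le> (real n - 1) * (real k)\<^sup>2"
  proof (cases "k = 0")
    case False
    then have "real k + real n - 2 \<le> (real n - 1) * real k"
    proof -
      have "(real n - 2) * (real k - 1) \<ge> 0" using n False by (intro mult_nonneg_nonneg) auto
      then show ?thesis by (simp add: algebra_simps)
    qed
    then show ?thesis
      using mult_left_mono[of "real k + real n - 2" "(real n - 1) * real k" "real k"]
      by (simp add: L_def power2_eq_square mult_ac)
  qed (simp add: L_def)
  \<comment> \<open>This c makes the derivative of the function \<open>?g\<close> below equal to the
    weight times L (2 y - P y), which is nonnegative because y \<ge> 1/2 and P \<le> 1. By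
    \<open>Lk\<close>, c is at most 2 k^2.\<close>
  define c where "c = 2 * L / (real n - 1)"
  have c: "(real n - 1) * c = 2 * L" using n by (simp add: c_def)
  have ode: "(1 - x\<^sup>2) * poly (pderiv (pderiv P)) x - (real n - 1) * x * poly (pderiv P) x = - L * poly P x" for x
    using arg_cong[OF legendre_ode[OF n P P1], of "\<lambda>p. poly p x"]
    by (simp add: gegenbauer_op_def L_def power2_eq_square algebra_simps)
  have P': "poly (pderiv P) x \<le> c" if x: "1/2 \<le> x" "x < 1" for x
  proof -
    let ?g = "\<lambda>x. (1 - x\<^sup>2) powr ((real n - 1) / 2) * (poly (pderiv P) x - c)"
    have "?g x \<le> ?g 1"
    proof (rule DERIV_nonneg_imp_increasing_open[of x 1 ?g])
      show "x \<le> 1" using x by simp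
      show "continuous_on {x..1} ?g"
        using n x by (intro continuous_intros continuous_on_one_minus_square_powr) auto
      fix y assume y: "x < y" "y < 1"
      then have y': "\<bar>y\<bar> < 1" using x by auto
      have d: "((\<lambda>y. poly (pderiv P) y - c) has_real_derivative poly (pderiv (pderiv P)) y) (at y)"
        by (auto intro!: derivative_eq_intros)
      have "(?g has_real_derivative
         - ((real n - 1) * y * legendre_weight n y) * (poly (pderiv P) y - c)
         + poly (pderiv (pderiv P)) y * (1 - y\<^sup>2) powr ((real n - 1) / 2)) (at y)"
        by (rule DERIV_mult[OF one_minus_square_powr_derivative(1)[OF y'] d])
      moreover have "- ((real n - 1) * y * legendre_weight n y) * (poly (pderiv P) y - c)
         + poly (pderiv (pderiv P)) y * (1 - y\<^sup>2) powr ((real n - 1) / 2)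
         = legendre_weight n y * ((1 - y\<^sup>2) * poly (pderiv (pderiv P)) y
             - (real n - 1) * y * poly (pderiv P) y + y * ((real n - 1) * c))"
        unfolding one_minus_square_powr_derivative(2)[OF y'] by (simp add: algebra_simps)
      moreover have "\<dots> = legendre_weight n y * (L * (2 * y - poly P y))"
        unfolding ode c by (simp add: algebra_simps)
      moreover have "\<dots> \<ge> 0"
        using bd[of y] x y L0 by (intro mult_nonneg_nonneg) (auto simp: legendre_weight_def)
      ultimately show "\<exists>z. (?g has_real_derivative z) (at y) \<and> z \<ge> 0" by auto
    qed
    also have "?g 1 = 0" by simp
    finally have "(1 - x\<^sup>2) powr ((real n - 1) / 2) * (poly (pderiv P) x - c) \<le> 0" .
    moreover have "(1 - x\<^sup>2) powr ((real n - 1) / 2) > 0"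
    proof -
      have "x\<^sup>2 < 1" using x by (simp add: abs_square_less_1)
      then show ?thesis by simp
    qed
    ultimately show ?thesis by (simp add: mult_le_0_iff)
  qed
  show ?thesis
  proof (cases "t = 1")
    case False
    then have "t < 1" using t by simp
    then obtain z where z: "t < z" "z < 1" "poly P 1 - poly P t = (1 - t) * poly (pderiv P) z"
      using MVT2[of t 1 "poly P" "poly (pderiv P)"] poly_DERIV by blast
    have "(1 - t) * poly (pderiv P) z \<le> (1 - t) * c"
      using P'[of z] z t by (intro mult_left_mono) auto
    also have "\<dots> \<le> (1 - t) * (2 * (real k)\<^sup>2)"
    proof (intro mult_left_mono)
      have "(real n - 1) * c \<le> (real n - 1) * (2 * (real k)\<^sup>2)" using Lk by (simp add: c)
      then show "c \<le> 2 * (real k)\<^sup>2" using n by (simp add: mult_le_cancel_left)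
    qed (use t in auto)
    finally show ?thesis using z P1 by (simp add: algebra_simps)
  qed (simp add: P1)
qed

section \<open>Powers of a linear form and zonal integrals\<close>

lemma partial_deriv_inner: "partial_deriv i (\<lambda>x. x \<bullet> e) = (\<lambda>_. e $ i)"
proof -
  have "(\<lambda>x. x \<bullet> e) = (\<lambda>x. \<Sum>j\<in>UNIV. e $ j * x $ j)"
    by (simp add: inner_vec_def mult.commute)
  then have "partial_deriv i (\<lambda>x. x \<bullet> e) = (\<lambda>x. \<Sum>j\<in>UNIV. e $ j * (if i = j then 1 else 0))"
    by (simp, subst partial_deriv_sum[where k = 1])
       (auto intro!: hpoly_scale hpoly_coord[unfolded One_nat_def]
         simp: partial_deriv_scale[OF hpoly_coord] partial_deriv_coord)
  then show ?thesis by (simp add: if_distrib cong: if_cong)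
qed

lemma hpoly_inner_power: "hpoly m (\<lambda>x. (x \<bullet> e) ^ m)"
  using hpoly_power[OF hpoly_inner, of m] by simp

lemma partial_deriv_inner_power:
  "partial_deriv i (\<lambda>x. (x \<bullet> e) ^ m) = (\<lambda>x. real m * e $ i * (x \<bullet> e) ^ (m - 1))"
proof (induction m)
  case 0 show ?case by (simp add: partial_deriv_const)
next
  case (Suc m)
  have "partial_deriv i (\<lambda>x. (x \<bullet> e) * (x \<bullet> e) ^ m)
     = (\<lambda>x. e $ i * (x \<bullet> e) ^ m + (x \<bullet> e) * (real m * e $ i * (x \<bullet> e) ^ (m - 1)))"
    by (simp add: partial_deriv_mult[OF hpoly_inner hpoly_inner_power] partial_deriv_inner Suc)
  then show ?case by (cases m) (simp_all add: algebra_simps)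
qed

lemma laplacian_inner_power:
  assumes "norm e = 1"
  shows "laplacian (\<lambda>x. (x \<bullet> e) ^ m) x = real m * (real m - 1) * (x \<bullet> e) ^ (m - 2)"
proof -
  have "partial_deriv i (partial_deriv i (\<lambda>x. (x \<bullet> e) ^ m)) x
     = (real m * (real m - 1) * (x \<bullet> e) ^ (m - 2)) * (e $ i * e $ i)" for i
    unfolding partial_deriv_inner_power
    by (subst partial_deriv_scale[OF hpoly_inner_power])
       (cases m, simp_all add: partial_deriv_inner_power numeral_2_eq_2)
  moreover have "(\<Sum>i\<in>UNIV. e $ i * e $ i) = 1"
    using assms by (simp add: norm_eq_sqrt_inner inner_vec_def)
  ultimately show ?thesis by (simp add: laplacian_def sum_distrib_left[symmetric])
qed

text \<open>Both functionals satisfy the same moment recursion.\<close>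

lemma integral_zonal_poly:
  fixes e :: "real^'n::finite"
  assumes n: "CARD('n) \<ge> 2" and e: "norm e = 1"
  shows "(\<integral>x. poly q (x \<bullet> e) \<partial>surface_measure)
    = sphere_volume TYPE('n) / weight_integral CARD('n) 1 * weight_integral CARD('n) q"
proof -
  define n' where "n' = CARD('n)"
  define W where "W = weight_integral n' 1"
  define V where "V = sphere_volume TYPE('n)"
  have W: "W > 0" using weight_integral_1_pos n by (simp add: W_def n'_def)
  define M where "M = (\<lambda>m. \<integral>x. (x \<bullet> e) ^ m \<partial>surface_measure)"
  have mono: "M m * W = V * weight_integral n' (monom 1 m)" for m
  proof (induction m rule: less_induct)
    case (less m)
    show ?case
    proof (cases "m = 0")
      case True
      then show ?thesis by (simp add: M_def V_def sphere_volume_def W_def one_pCons monom_0)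
    next
      case False
      have c: "real m + real n' - 2 > 0" if "m \<ge> 1" using that n by (simp add: n'_def)
      have "real m * (real m + real n' - 2) * M m = real m * (real m - 1) * M (m - 2)"
      proof -
        have "(\<integral>x. laplacian (\<lambda>x. (x \<bullet> e) ^ m) x \<partial>surface_measure) = real m * (real m - 1) * M (m - 2)"
          unfolding laplacian_inner_power[OF e] M_def by (rule integral_mult_right_zero)
        then show ?thesis
          unfolding integral_laplacian[OF hpoly_inner_power] by (simp only: M_def n'_def)
      qed
      then have "(real m + real n' - 2) * M m = (real m - 1) * M (m - 2)" using False by simp
      then have "(real m + real n' - 2) * (M m * W) = (real m - 1) * (M (m - 2) * W)" by simp
      also have "\<dots> = V * ((real m - 1) * weight_integral n' (monom 1 (m - 2)))"
        using less[of "m - 2"] False by simp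
      also have "\<dots> = (real m + real n' - 2) * (V * weight_integral n' (monom 1 m))"
        using weight_integral_monom[of n' m] n False by (simp add: n'_def)
      finally show ?thesis using c False by simp
    qed
  qed
  have "(\<integral>x. poly q (x \<bullet> e) \<partial>surface_measure) * W = V * weight_integral n' q"
  proof -
    have "(\<integral>x. poly q (x \<bullet> e) \<partial>surface_measure) = (\<Sum>i\<le>degree q. coeff q i * M i)"
      unfolding poly_altdef M_def
      by (subst Bochner_Integration.integral_sum) (auto intro!: integrable_mult_right hpoly_integrable hpoly_inner_power)
    moreover have "weight_integral n' q = (\<Sum>i\<le>degree q. coeff q i * weight_integral n' (monom 1 i))"
    proof -
      have s: "weight_integral n' (\<Sum>i\<in>I. f i) = (\<Sum>i\<in>I. weight_integral n' (f i))" if "finite I" for I :: "nat set" and f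
        using that by induction (use n in \<open>simp_all add: weight_integral_add n'_def\<close>)
      have "q = (\<Sum>i\<le>degree q. smult (coeff q i) (monom 1 i))"
        using poly_as_sum_of_monoms[of q] by (simp add: smult_monom)
      then have "weight_integral n' q = weight_integral n' (\<Sum>i\<le>degree q. smult (coeff q i) (monom 1 i))" by simp
      then show ?thesis by (simp add: s weight_integral_smult)
    qed
    ultimately show ?thesis
      by (simp add: sum_distrib_left sum_distrib_right mult.assoc mono mult.left_commute)
  qed
  then show ?thesis using W by (simp add: W_def V_def n'_def field_simps)
qed

section \<open>The addition formula\<close>

lemma on_sphere_measurable:
  "p \<in> borel_measurable surface_measure \<Longrightarrow> on_sphere p \<in> borel_measurable (surface_measure :: (real^'n::finite) measure)"
  by (subst measurable_cong[of _ _ p]) (auto simp: on_sphere_def)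

lemma integral_surface_cong:
  fixes f g :: "real^'n::finite \<Rightarrow> real"
  shows "(\<And>x. x \<in> sphere 0 1 \<Longrightarrow> f x = g x) \<Longrightarrow> (\<integral>x. f x \<partial>surface_measure) = (\<integral>x. g x \<partial>surface_measure)"
  by (intro Bochner_Integration.integral_cong) auto

lemma spherical_harmonicsE:
  assumes "f \<in> spherical_harmonics k"
  obtains p where "hpoly k p" "\<And>x. laplacian p x = 0" "f = on_sphere p"
  using assms unfolding spherical_harmonics_def homogeneous_polys_eq by auto

lemma spherical_harmonicsI: "hpoly k p \<Longrightarrow> (\<And>x. laplacian p x = 0) \<Longrightarrow> on_sphere p \<in> spherical_harmonics k"
  unfolding spherical_harmonics_def homogeneous_polys_eq by auto

lemma spherical_harmonics_measurable: "f \<in> spherical_harmonics k \<Longrightarrow> f \<in> borel_measurable surface_measure"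
  by (auto elim!: spherical_harmonicsE intro: on_sphere_measurable hpoly_measurable)

lemma spherical_harmonics_bounded:
  assumes "f \<in> spherical_harmonics k"
  obtains B where "\<And>x. \<bar>f x\<bar> \<le> B"
proof -
  obtain p where p: "hpoly k p" "f = on_sphere p" using assms by (auto elim: spherical_harmonicsE)
  obtain B where B: "\<And>x. x \<in> sphere 0 1 \<Longrightarrow> \<bar>p x\<bar> \<le> B" using hpoly_bounded[OF p(1)] by blast
  have "\<bar>f x\<bar> \<le> max B 0" for x using B[of x] p(2) by (auto simp: on_sphere_def)
  then show ?thesis using that by blast
qed

lemma integrable_mult_bounded:
  fixes f h :: "real^'n::finite \<Rightarrow> real"
  assumes f: "integrable surface_measure f" and h: "h \<in> borel_measurable surface_measure" and B: "\<And>x. \<bar>h x\<bar> \<le> B"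
  shows "integrable surface_measure (\<lambda>x. f x * h x)"
proof (rule Bochner_Integration.integrable_bound[of _ "\<lambda>x. B * f x"])
  show "integrable surface_measure (\<lambda>x. B * f x)" using f by simp
  show "(\<lambda>x. f x * h x) \<in> borel_measurable surface_measure" using f h by measurable
  show "AE x in surface_measure. norm (f x * h x) \<le> norm (B * f x)"
  proof (rule AE_I2)
    fix x
    have "\<bar>h x\<bar> \<le> \<bar>B\<bar>" using B[of x] by linarith
    then show "norm (f x * h x) \<le> norm (B * f x)"
      using mult_left_mono[of "\<bar>h x\<bar>" "\<bar>B\<bar>" "\<bar>f x\<bar>"] by (simp add: abs_mult mult.commute)
  qed
qed

lemma spherical_harmonics_orthogonal_comp:
  fixes f :: "real^'n::finite \<Rightarrow> real" and R :: "real^'n \<Rightarrow> real^'n"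
  assumes R: "orthogonal_transformation R" and f: "f \<in> spherical_harmonics k"
  shows "(\<lambda>x. f (R x)) \<in> spherical_harmonics k"
proof -
  obtain p where p: "hpoly k p" "\<And>x. laplacian p x = 0" "f = on_sphere p"
    using f by (auto elim: spherical_harmonicsE)
  have "on_sphere (\<lambda>x. p (R x)) \<in> spherical_harmonics k"
    using hpoly_linear_comp[OF orthogonal_transformation_linear[OF R] p(1)] p(2)
    by (intro spherical_harmonicsI) (auto simp: laplacian_orthogonal[OF R p(1)])
  moreover have "on_sphere (\<lambda>x. p (R x)) = (\<lambda>x. f (R x))"
    by (auto simp: on_sphere_def p(3) orthogonal_transformation_norm[OF R])
  ultimately show ?thesis by simp
qed

text \<open>The reflection in the hyperplane orthogonal to y - y' exchanges y and y' and fixes x,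
  which lies in that hyperplane.\<close>

lemma reflection_exists:
  fixes x y y' :: "real^'n::finite"
  assumes "norm y = norm y'" "x \<bullet> y = x \<bullet> y'"
  obtains R where "orthogonal_transformation R" "R x = x" "R y = y'"
proof (cases "y = y'")
  case True
  then show ?thesis using that[of id] by (simp add: id_def)
next
  case False
  define a where "a = y - y'"
  define R where "R = (\<lambda>v. v - (2 * (v \<bullet> a) / (a \<bullet> a)) *\<^sub>R a)"
  have a: "a \<bullet> a \<noteq> 0" using False by (simp add: a_def)
  have "orthogonal_transformation R"
    unfolding orthogonal_transformation_def
  proof (intro conjI allI)
    show "linear R"
      by (rule linearI) (simp_all add: R_def inner_add_left add_divide_distrib algebra_simps)
    show "R v \<bullet> R w = v \<bullet> w" for v w
      using a by (simp add: R_def inner_diff_left inner_diff_right inner_commute field_simps)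
  qed
  moreover have "R x = x" using assms(2) by (simp add: R_def a_def inner_diff_right)
  moreover have "R y = y'"
  proof -
    have "y \<bullet> y = y' \<bullet> y'" using assms(1) by (simp add: norm_eq)
    then have "2 * (y \<bullet> a) = a \<bullet> a"
      by (simp add: a_def inner_diff_left inner_diff_right inner_commute)
    then show ?thesis using a by (simp add: R_def) (simp add: a_def)
  qed
  ultimately show ?thesis using that by blast
qed

text \<open>Even powers of r become polynomials in t, so at most one factor r survives. The bound on
  \<open>pCons 0 B\<close> encodes that B has degree at most k - 1, and that B = 0 when k =
  0.\<close>

lemma hpoly_great_circle:
  fixes e \<eta> :: "real^'n::finite"
  shows "hpoly k p \<Longrightarrow> \<exists>A B. degree A \<le> k \<and> degree (pCons 0 B) \<le> k \<and>
     (\<forall>t r. r\<^sup>2 = 1 - t\<^sup>2 \<longrightarrow> p (t *\<^sub>R e + r *\<^sub>R \<eta>) = poly A t + r * poly B t)"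
proof (induction rule: hpoly.induct)
  case (const c)
  show ?case by (rule exI[of _ "[:c:]"], rule exI[of _ 0]) simp
next
  case (mult_coord k p i)
  then obtain A B where AB: "degree A \<le> k" "degree (pCons 0 B) \<le> k"
    "\<And>t r. r\<^sup>2 = 1 - t\<^sup>2 \<Longrightarrow> p (t *\<^sub>R e + r *\<^sub>R \<eta>) = poly A t + r * poly B t" by blast
  define A' where "A' = smult (e $ i) (pCons 0 A) + smult (\<eta> $ i) (B - pCons 0 (pCons 0 B))"
  define B' where "B' = smult (\<eta> $ i) A + smult (e $ i) (pCons 0 B)"
  have dB: "degree B \<le> k" using AB(2) by (cases "B = 0") auto
  have s: "degree (smult c q) \<le> m" if "degree q \<le> m" for c m and q :: "real poly"
    using that degree_smult_le order_trans by blast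
  have p0: "degree (pCons 0 q) \<le> Suc m" if "degree q \<le> m" for m and q :: "real poly"
    using that by (cases "q = 0") auto
  have "degree A' \<le> Suc k"
    unfolding A'_def using dB AB by (intro degree_add_le s degree_diff_le p0) auto
  moreover have "degree (pCons 0 B') \<le> Suc k"
    unfolding B'_def using AB by (intro p0 degree_add_le s) auto
  moreover have "(t *\<^sub>R e + r *\<^sub>R \<eta>) $ i * p (t *\<^sub>R e + r *\<^sub>R \<eta>) = poly A' t + r * poly B' t"
    if r: "r\<^sup>2 = 1 - t\<^sup>2" for t r
  proof -
    have "(t *\<^sub>R e + r *\<^sub>R \<eta>) $ i * p (t *\<^sub>R e + r *\<^sub>R \<eta>)
       = t * e $ i * poly A t + r\<^sup>2 * (\<eta> $ i * poly B t) + r * (\<eta> $ i * poly A t + t * e $ i * poly B t)"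
      unfolding AB(3)[OF r] by (simp add: power2_eq_square algebra_simps)
    then show ?thesis unfolding r by (simp add: A'_def B'_def power2_eq_square algebra_simps)
  qed
  ultimately show ?case by blast
next
  case (add k p q)
  then obtain A B where AB: "degree A \<le> k" "degree (pCons 0 B) \<le> k"
    "\<And>t r. r\<^sup>2 = 1 - t\<^sup>2 \<Longrightarrow> p (t *\<^sub>R e + r *\<^sub>R \<eta>) = poly A t + r * poly B t" by blast
  from add obtain C D where CD: "degree C \<le> k" "degree (pCons 0 D) \<le> k"
    "\<And>t r. r\<^sup>2 = 1 - t\<^sup>2 \<Longrightarrow> q (t *\<^sub>R e + r *\<^sub>R \<eta>) = poly C t + r * poly D t" by blast
  have "pCons 0 (B + D) = pCons 0 B + pCons 0 D" by simp
  then have "degree (pCons 0 (B + D)) \<le> k" using AB(2) CD(2) degree_add_le by metis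
  moreover have "degree (A + C) \<le> k" using AB(1) CD(1) by (rule degree_add_le)
  moreover have "p (t *\<^sub>R e + r *\<^sub>R \<eta>) + q (t *\<^sub>R e + r *\<^sub>R \<eta>) = poly (A + C) t + r * poly (B + D) t"
    if "r\<^sup>2 = 1 - t\<^sup>2" for t r
    unfolding AB(3)[OF that] CD(3)[OF that] by (simp add: algebra_simps)
  ultimately show ?case by blast
qed

lemma orthogonal_unit_exists:
  fixes x :: "real^'n::finite"
  assumes n: "CARD('n) \<ge> 2"
  obtains \<eta> where "norm \<eta> = 1" "x \<bullet> \<eta> = 0"
proof -
  have "DIM(real^'n) > 1" using n by simp
  then obtain y where y: "y \<noteq> 0" "orthogonal x y"
    using orthogonal_to_vector_exists[of x] by (metis One_nat_def Suc_1 Suc_leI)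
  then show ?thesis using that[of "sgn y"] by (simp add: norm_sgn sgn_div_norm orthogonal_def)
qed

text \<open>Each power (y . x)^i with i < k is homogeneous of degree below k, so orthogonality to
  lower degrees applies termwise.\<close>

lemma spherical_harmonics_legendre_orthogonal:
  fixes x :: "real^'n::finite"
  assumes n: "CARD('n) \<ge> 2" and f: "f \<in> spherical_harmonics k" and q: "q = 0 \<or> degree q < k"
  shows "(\<integral>y. f y * poly q (y \<bullet> x) \<partial>surface_measure) = 0"
proof (cases "q = 0")
  case False
  obtain p where p: "hpoly k p" "\<And>x. laplacian p x = 0" "f = on_sphere p"
    using f by (auto elim: spherical_harmonicsE)
  have "(\<integral>y. f y * poly q (y \<bullet> x) \<partial>surface_measure)
     = (\<integral>y. (\<Sum>i\<le>degree q. coeff q i * (p y * (y \<bullet> x) ^ i)) \<partial>surface_measure)"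
    by (rule integral_surface_cong)
       (simp add: p(3) on_sphere_def poly_altdef sum_distrib_left mult.left_commute)
  also have "\<dots> = (\<Sum>i\<le>degree q. coeff q i * (\<integral>y. p y * (y \<bullet> x) ^ i \<partial>surface_measure))"
    using hpoly_integrable[OF hpoly_mult[OF p(1) hpoly_inner_power]]
    by (subst Bochner_Integration.integral_sum) auto
  also have "\<dots> = 0"
    using q False harmonic_orthogonal_lower[OF n p(1) p(2) hpoly_inner_power]
    by (intro sum.neutral) auto
  finally show ?thesis .
qed simp

text \<open>One great circle through x determines f, and its symmetry makes f a polynomial in x . y.
  Orthogonality on [-1, 1] is orthogonality on the sphere, transferred by the integral formula for
  zonal polynomials.\<close>

lemma zonal_harmonic:
  fixes x :: "real^'n::finite"
  assumes n: "CARD('n) \<ge> 2" and f: "f \<in> spherical_harmonics k" and x: "x \<in> sphere 0 1"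
    and inv: "\<And>y y'. y \<in> sphere 0 1 \<Longrightarrow> y' \<in> sphere 0 1 \<Longrightarrow> x \<bullet> y = x \<bullet> y' \<Longrightarrow> f y = f y'"
  obtains A where "legendre_like CARD('n) k A" "\<And>y. y \<in> sphere 0 1 \<Longrightarrow> f y = poly A (x \<bullet> y)"
proof -
  obtain p where p: "hpoly k p" "\<And>x. laplacian p x = 0" "f = on_sphere p"
    using f by (auto elim: spherical_harmonicsE)
  obtain \<eta> where \<eta>: "norm \<eta> = 1" "x \<bullet> \<eta> = 0" using orthogonal_unit_exists[OF n] by blast
  obtain A B where AB: "degree A \<le> k"
    "\<And>t r. r\<^sup>2 = 1 - t\<^sup>2 \<Longrightarrow> p (t *\<^sub>R x + r *\<^sub>R \<eta>) = poly A t + r * poly B t"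
    using hpoly_great_circle[OF p(1), of x \<eta>] by blast
  have fA: "f y = poly A (x \<bullet> y)" if y: "y \<in> sphere 0 1" for y
  proof -
    define t where "t = x \<bullet> y"
    have "\<bar>t\<bar> \<le> 1" using Cauchy_Schwarz_ineq2[of x y] x y by (simp add: t_def)
    then have t: "t\<^sup>2 \<le> 1" by (simp add: abs_square_le_1)
    define r where "r = sqrt (1 - t\<^sup>2)"
    have r: "r\<^sup>2 = 1 - t\<^sup>2" "(- r)\<^sup>2 = 1 - t\<^sup>2" using t by (simp_all add: r_def)
    have s: "t *\<^sub>R x + s *\<^sub>R \<eta> \<in> sphere 0 1" if "s\<^sup>2 = 1 - t\<^sup>2" for s
    proof -
      have "(t *\<^sub>R x + s *\<^sub>R \<eta>) \<bullet> (t *\<^sub>R x + s *\<^sub>R \<eta>) = t\<^sup>2 * (x \<bullet> x) + s\<^sup>2 * (\<eta> \<bullet> \<eta>)"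
        using \<eta>(2) by (simp add: inner_add_left inner_add_right inner_commute power2_eq_square)
      then show ?thesis using x \<eta>(1) that by (simp add: norm_eq_sqrt_inner)
    qed
    have d: "x \<bullet> (t *\<^sub>R x + s *\<^sub>R \<eta>) = x \<bullet> y" for s
      using x \<eta>(2) by (simp add: inner_add_right norm_eq_sqrt_inner t_def)
    \<comment> \<open>Both square roots of 1 - t^2 give points with the same inner product with x,
      hence the same value of f; comparing them removes the term with B.\<close>
    have "f y = poly A t + s * poly B t" if "s\<^sup>2 = 1 - t\<^sup>2" for s
      using inv[OF s[OF that] y d] AB(2)[OF that] s[OF that] by (simp add: p(3) on_sphere_def)
    from this[OF r(1)] this[OF r(2)] show ?thesis by (simp add: t_def)
  qed
  have "legendre_like CARD('n) k A"
    unfolding legendre_like_def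
  proof (intro conjI allI impI)
    fix q :: "real poly" assume q: "q = 0 \<or> degree q < k"
    have "(\<integral>y. poly (A * q) (y \<bullet> x) \<partial>surface_measure) = (\<integral>y. f y * poly q (y \<bullet> x) \<partial>surface_measure)"
      by (rule integral_surface_cong) (simp add: fA inner_commute)
    also have "\<dots> = 0" by (rule spherical_harmonics_legendre_orthogonal[OF n f q])
    finally have "sphere_volume TYPE('n) / weight_integral CARD('n) 1 * weight_integral CARD('n) (A * q) = 0"
      using integral_zonal_poly[OF n, of x "A * q"] x by simp
    then show "weight_integral CARD('n) (A * q) = 0"
      using sphere_volume_pos[where 'n = 'n] weight_integral_1_pos[OF n] by simp
  qed (rule AB(1))
  with fA show ?thesis using that by blast
qed

locale harmonic_basis =
  fixes Y :: "nat \<Rightarrow> nat \<Rightarrow> real^'n::finite \<Rightarrow> real"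
  assumes n2: "CARD('n) \<ge> 2" and onb: "harmonic_onb Y"
begin

text \<open>The reproducing kernel of the harmonics of degree k; its invariance under orthogonal
  maps is the source of the zonal formulas below.\<close>

abbreviation Z :: "nat \<Rightarrow> real^'n \<Rightarrow> real^'n \<Rightarrow> real" where
  "Z k x y \<equiv> \<Sum>l\<in>{1..harmonic_dim TYPE('n) k}. Y k l x * Y k l y"

lemma span_Y: "fun_vs.span (Y k ` {1..harmonic_dim TYPE('n) k}) = spherical_harmonics k"
  using onb by (auto simp: harmonic_onb_def)

lemma Y_orthonormal:
  "l \<in> {1..harmonic_dim TYPE('n) k} \<Longrightarrow> m \<in> {1..harmonic_dim TYPE('n) k} \<Longrightarrow> (\<integral>x. Y k l x * Y k m x \<partial>surface_measure) = (if l = m then 1 else 0)"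
  using onb unfolding harmonic_onb_def by blast

lemma Y_harmonic: "l \<in> {1..harmonic_dim TYPE('n) k} \<Longrightarrow> Y k l \<in> spherical_harmonics k"
  unfolding span_Y[symmetric] by (rule fun_vs.span_base) auto

lemma Y_measurable [measurable]: "l \<in> {1..harmonic_dim TYPE('n) k} \<Longrightarrow> Y k l \<in> borel_measurable surface_measure"
  by (rule spherical_harmonics_measurable[OF Y_harmonic])

lemma harmonic_comb: "(\<lambda>x. \<Sum>l\<in>{1..harmonic_dim TYPE('n) k}. c l * Y k l x) \<in> spherical_harmonics k"
proof -
  have "(\<lambda>x. \<Sum>l\<in>J. c l * Y k l x) \<in> fun_vs.span (Y k ` {1..harmonic_dim TYPE('n) k})" if "J \<subseteq> {1..harmonic_dim TYPE('n) k}" "finite J" for J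
    using that(2,1)
  proof (induction J)
    case empty show ?case using fun_vs.span_zero[of "Y k ` {1..harmonic_dim TYPE('n) k}"] by (simp add: zero_fun_def)
  next
    case (insert l J)
    have "(\<lambda>x. c l * Y k l x) \<in> fun_vs.span (Y k ` {1..harmonic_dim TYPE('n) k})"
      using insert by (intro fun_vs.span_scale fun_vs.span_base) auto
    from fun_vs.span_add[OF this insert(3)] insert show ?case by (simp add: plus_fun_def)
  qed
  from this[OF subset_refl finite_atLeastAtMost] show ?thesis unfolding span_Y .
qed

lemma integrable_mult_harmonic:
  assumes f: "integrable surface_measure f" and h: "h \<in> spherical_harmonics k"
  shows "integrable surface_measure (\<lambda>x. f x * h x)"
proof -
  obtain B where "\<And>x. \<bar>h x\<bar> \<le> B" using spherical_harmonics_bounded[OF h] by blast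
  then show ?thesis by (rule integrable_mult_bounded[OF f spherical_harmonics_measurable[OF h]])
qed

lemma harmonic_integrable: "h \<in> spherical_harmonics k \<Longrightarrow> integrable surface_measure (h :: real^'n \<Rightarrow> real)"
  using integrable_mult_harmonic[of "\<lambda>_. 1" h k] by simp

lemma harmonic_expand:
  assumes f: "f \<in> spherical_harmonics k"
  shows "f x = (\<Sum>l\<in>{1..harmonic_dim TYPE('n) k}. harmonic_coeff Y f k l * Y k l x)"
proof -
  let ?S = "{f. \<exists>c. \<forall>x. f x = (\<Sum>l\<in>{1..harmonic_dim TYPE('n) k}. c l * Y k l x)}"
  have "fun_vs.subspace ?S"
    unfolding fun_vs.subspace_def
  proof (intro conjI ballI allI)
    show "0 \<in> ?S" by (auto intro!: exI[of _ "\<lambda>_. 0"] simp: zero_fun_def)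
  next
    fix f g assume "f \<in> ?S" "g \<in> ?S"
    then obtain c c' where "\<forall>x. f x = (\<Sum>l\<in>{1..harmonic_dim TYPE('n) k}. c l * Y k l x)" "\<forall>x. g x = (\<Sum>l\<in>{1..harmonic_dim TYPE('n) k}. c' l * Y k l x)" by auto
    then show "f + g \<in> ?S"
      by (auto intro!: exI[of _ "\<lambda>l. c l + c' l"] simp: plus_fun_def distrib_right sum.distrib)
  next
    fix a f assume "f \<in> ?S"
    then obtain c where "\<forall>x. f x = (\<Sum>l\<in>{1..harmonic_dim TYPE('n) k}. c l * Y k l x)" by auto
    then show "(\<lambda>x. a * f x) \<in> ?S"
      by (auto intro!: exI[of _ "\<lambda>l. a * c l"] simp: sum_distrib_left mult.assoc)
  qed
  moreover have "Y k ` {1..harmonic_dim TYPE('n) k} \<subseteq> ?S"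
  proof clarify
    fix l assume l: "l \<in> {1..harmonic_dim TYPE('n) k}"
    have "(\<Sum>m\<in>{1..harmonic_dim TYPE('n) k}. (if m = l then 1 else 0) * Y k m x) = (\<Sum>m\<in>{1..harmonic_dim TYPE('n) k}. if m = l then Y k l x else 0)" for x
      by (rule sum.cong) auto
    with l show "\<exists>c. \<forall>x. Y k l x = (\<Sum>m\<in>{1..harmonic_dim TYPE('n) k}. c m * Y k m x)"
      by (intro exI[of _ "\<lambda>m. if m = l then 1 else 0"]) simp
  qed
  ultimately have "spherical_harmonics k \<subseteq> ?S"
    unfolding span_Y[symmetric] by (intro fun_vs.span_minimal)
  with f obtain c where c: "\<And>x. f x = (\<Sum>l\<in>{1..harmonic_dim TYPE('n) k}. c l * Y k l x)" by blast
  have "harmonic_coeff Y f k m = c m" if m: "m \<in> {1..harmonic_dim TYPE('n) k}" for m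
  proof -
    have i: "integrable surface_measure (\<lambda>x. Y k l x * Y k m x)" if "l \<in> {1..harmonic_dim TYPE('n) k}" for l
      by (rule integrable_mult_harmonic[OF harmonic_integrable[OF Y_harmonic[OF that]] Y_harmonic[OF m]])
    have "harmonic_coeff Y f k m = (\<integral>x. (\<Sum>l\<in>{1..harmonic_dim TYPE('n) k}. c l * (Y k l x * Y k m x)) \<partial>surface_measure)"
      by (simp add: harmonic_coeff_def c sum_distrib_right mult.assoc)
    also have "\<dots> = (\<Sum>l\<in>{1..harmonic_dim TYPE('n) k}. c l * (\<integral>x. Y k l x * Y k m x \<partial>surface_measure))"
      using i by (subst Bochner_Integration.integral_sum) auto
    also have "\<dots> = (\<Sum>l\<in>{1..harmonic_dim TYPE('n) k}. if l = m then c m else 0)"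
      using m by (intro sum.cong refl) (simp add: Y_orthonormal)
    finally show ?thesis using m by simp
  qed
  then show ?thesis by (simp add: c)
qed

lemma harmonic_degree_orthogonal:
  fixes f g :: "real^'n \<Rightarrow> real"
  assumes f: "f \<in> spherical_harmonics k" and g: "g \<in> spherical_harmonics j" and "j \<noteq> k"
  shows "(\<integral>x. f x * g x \<partial>surface_measure) = 0"
proof -
  have *: "(\<integral>x. f x * g x \<partial>surface_measure) = 0"
    if fg: "f \<in> spherical_harmonics k" "g \<in> spherical_harmonics j" "j < k" for f g :: "real^'n \<Rightarrow> real" and j k
  proof -
    obtain p where p: "hpoly k p" "\<And>x. laplacian p x = 0" "f = on_sphere p"
      using fg(1) by (auto elim: spherical_harmonicsE)
    obtain q where q: "hpoly j q" "\<And>x. laplacian q x = 0" "g = on_sphere q"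
      using fg(2) by (auto elim: spherical_harmonicsE)
    have "(\<integral>x. f x * g x \<partial>surface_measure) = (\<integral>x. p x * q x \<partial>surface_measure)"
      by (rule integral_surface_cong) (simp add: p q on_sphere_def)
    then show ?thesis using harmonic_orthogonal_lower[OF n2 p(1,2) q(1) fg(3)] by simp
  qed
  show ?thesis
    using *[OF f g] *[OF g f] \<open>j \<noteq> k\<close> by (cases "j < k") (auto simp: mult.commute)
qed

text \<open>\<open>?M\<close> is the matrix of composition with R in the basis; by invariance of the
  integral its transpose is the matrix of composition with the inverse. Expanding the values at R x
  by the first and collecting by the second turns one kernel into the other.\<close>

lemma Z_invariant:
  assumes R: "orthogonal_transformation R"
  shows "Z k (R x) (R y) = Z k x y"
proof -
  define R' where "R' = inv R"
  have R': "orthogonal_transformation R'" unfolding R'_def by (rule orthogonal_transformation_inv[OF R])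
  have inv: "R' (R x) = x" for x
    unfolding R'_def using orthogonal_transformation_inj[OF R] by simp
  let ?M = "\<lambda>l m. \<integral>x. Y k l (R x) * Y k m x \<partial>surface_measure"
  have YR: "(\<lambda>x. Y k l (R x)) \<in> spherical_harmonics k" if "l \<in> {1..harmonic_dim TYPE('n) k}" for l
    by (rule spherical_harmonics_orthogonal_comp[OF R Y_harmonic[OF that]])
  have 1: "Y k l (R x) = (\<Sum>m\<in>{1..harmonic_dim TYPE('n) k}. ?M l m * Y k m x)" if "l \<in> {1..harmonic_dim TYPE('n) k}" for l
    using harmonic_expand[OF YR[OF that], of x] by (simp add: harmonic_coeff_def)
  have 2: "Y k m y = (\<Sum>l\<in>{1..harmonic_dim TYPE('n) k}. ?M l m * Y k l (R y))" if m: "m \<in> {1..harmonic_dim TYPE('n) k}" for m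
  proof -
    have "(\<lambda>x. Y k m (R' x)) \<in> spherical_harmonics k"
      by (rule spherical_harmonics_orthogonal_comp[OF R' Y_harmonic[OF m]])
    from harmonic_expand[OF this, of "R y"]
    have "Y k m y = (\<Sum>l\<in>{1..harmonic_dim TYPE('n) k}. harmonic_coeff Y (\<lambda>x. Y k m (R' x)) k l * Y k l (R y))" by (simp add: inv)
    moreover have "harmonic_coeff Y (\<lambda>x. Y k m (R' x)) k l = ?M l m" if l: "l \<in> {1..harmonic_dim TYPE('n) k}" for l
    proof -
      have meas: "(\<lambda>x. Y k m (R' x) * Y k l x) \<in> borel_measurable surface_measure"
        using Y_measurable[OF l]
          measurable_compose[OF orthogonal_transformation_measurable_surface[OF R'] Y_measurable[OF m]]
        by measurable
      show ?thesis
        using integral_surface_orthogonal[OF R meas] by (simp add: harmonic_coeff_def inv mult.commute)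
    qed
    ultimately show ?thesis by simp
  qed
  have "Z k (R x) (R y) = (\<Sum>l\<in>{1..harmonic_dim TYPE('n) k}. (\<Sum>m\<in>{1..harmonic_dim TYPE('n) k}. ?M l m * Y k m x) * Y k l (R y))"
    by (intro sum.cong refl) (simp only: 1)
  also have "\<dots> = (\<Sum>m\<in>{1..harmonic_dim TYPE('n) k}. Y k m x * (\<Sum>l\<in>{1..harmonic_dim TYPE('n) k}. ?M l m * Y k l (R y)))"
    unfolding sum_distrib_left sum_distrib_right by (subst sum.swap) (simp add: mult_ac)
  also have "\<dots> = Z k x y"
    by (intro sum.cong refl) (simp only: 2[symmetric])
  finally show ?thesis .
qed

text \<open>Orthogonal maps act transitively on the sphere, so the diagonal is constant, and its
  integral counts the orthonormal basis.\<close>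

lemma Z_diag:
  assumes x: "x \<in> sphere 0 1"
  shows "Z k x x = real (harmonic_dim TYPE('n) k) / sphere_volume TYPE('n)"
proof -
  have const: "Z k y y = Z k x x" if y: "y \<in> sphere 0 1" for y
  proof -
    obtain R where "orthogonal_transformation R" "R x = y"
      using orthogonal_transformation_exists[of x y] x y by auto
    then show ?thesis using Z_invariant[of R k x x] by simp
  qed
  have "Z k x x * sphere_volume TYPE('n) = (\<integral>y. Z k y y \<partial>surface_measure)"
    using integral_surface_cong[of "\<lambda>y. Z k y y" "\<lambda>_. Z k x x"] const
    by (simp add: sphere_volume_def)
  also have "\<dots> = (\<Sum>l\<in>{1..harmonic_dim TYPE('n) k}. \<integral>y. Y k l y * Y k l y \<partial>surface_measure)"
    by (rule Bochner_Integration.integral_sum)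
       (rule integrable_mult_harmonic[OF harmonic_integrable[OF Y_harmonic] Y_harmonic])
  also have "\<dots> = real (harmonic_dim TYPE('n) k)" by (simp add: Y_orthonormal)
  finally show ?thesis using sphere_volume_pos[where 'n = 'n] by (simp add: field_simps)
qed

lemma Z_harmonic: "Z k x \<in> spherical_harmonics k"
  by (rule harmonic_comb)

text \<open>Existence of the Legendre polynomial comes from the kernel: as a function of y it is
  invariant under maps fixing x, hence a polynomial in x . y. Its value at 1 is the diagonal value,
  nonzero because the dimension is positive, so it can be normalised.\<close>

lemma
  assumes d: "harmonic_dim TYPE('n) k > 0"
  shows legendre_like_P: "legendre_like CARD('n) k (legendre_poly CARD('n) k)" and poly_P_1: "poly (legendre_poly CARD('n) k) 1 = 1"
proof -
  obtain i :: 'n where True by simp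
  define x where "x = (axis i 1 :: real^'n)"
  have x: "x \<in> sphere 0 1" by (simp add: x_def)
  have inv: "Z k x y = Z k x y'" if "y \<in> sphere 0 1" "y' \<in> sphere 0 1" "x \<bullet> y = x \<bullet> y'" for y y'
  proof -
    obtain R where "orthogonal_transformation R" "R x = x" "R y = y'"
      using reflection_exists[of y y' x] \<open>y \<in> sphere 0 1\<close> \<open>y' \<in> sphere 0 1\<close> \<open>x \<bullet> y = x \<bullet> y'\<close> by auto
    then show ?thesis using Z_invariant[of R k x y] by simp
  qed
  obtain A where A: "legendre_like CARD('n) k A" "\<And>y. y \<in> sphere 0 1 \<Longrightarrow> Z k x y = poly A (x \<bullet> y)"
    using zonal_harmonic[OF n2 Z_harmonic x inv] by blast
  have A1: "poly A 1 = real (harmonic_dim TYPE('n) k) / sphere_volume TYPE('n)"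
    using A(2)[OF x] Z_diag[OF x] x by (simp add: norm_eq_sqrt_inner)
  define Q where "Q = smult (1 / poly A 1) A"
  have "poly A 1 \<noteq> 0" using A1 d sphere_volume_pos[where 'n = 'n] by simp
  then have Q: "legendre_like CARD('n) k Q" "poly Q 1 = 1"
    using legendre_like_smult[OF A(1)] by (simp_all add: Q_def)
  have "legendre_poly CARD('n) k = Q" by (rule legendre_poly_eqI[OF n2 Q])
  with Q show "legendre_like CARD('n) k (legendre_poly CARD('n) k)" "poly (legendre_poly CARD('n) k) 1 = 1" by simp_all
qed

text \<open>Invariance under the stabiliser of x makes f a function of x . y, and such harmonics of
  one degree form a line spanned by the Legendre polynomial.\<close>

lemma zonal_harmonic_multiple:
  fixes x y :: "real^'n"
  assumes x: "x \<in> sphere 0 1" and f: "f \<in> spherical_harmonics k" and d: "harmonic_dim TYPE('n) k > 0"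
    and inv: "\<And>R y. orthogonal_transformation R \<Longrightarrow> R x = x \<Longrightarrow> y \<in> sphere 0 1 \<Longrightarrow> f (R y) = f y"
    and y: "y \<in> sphere 0 1"
  shows "f y = f x * poly (legendre_poly CARD('n) k) (x \<bullet> y)"
proof -
  have "f y = f y'" if "y \<in> sphere 0 1" "y' \<in> sphere 0 1" "x \<bullet> y = x \<bullet> y'" for y y'
  proof -
    obtain R where "orthogonal_transformation R" "R x = x" "R y = y'"
      using reflection_exists[of y y' x] \<open>y \<in> sphere 0 1\<close> \<open>y' \<in> sphere 0 1\<close> \<open>x \<bullet> y = x \<bullet> y'\<close> by auto
    then show ?thesis using inv[of R y] \<open>y \<in> sphere 0 1\<close> by simp
  qed
  from zonal_harmonic[OF n2 f x this]
  obtain A where A: "legendre_like CARD('n) k A" "\<And>y. y \<in> sphere 0 1 \<Longrightarrow> f y = poly A (x \<bullet> y)" by blast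
  have "A = smult (poly A 1) (legendre_poly CARD('n) k)"
    by (rule legendre_like_proportional[OF n2 A(1) legendre_like_P[OF d] poly_P_1[OF d]])
  moreover have "f x = poly A 1" using A(2)[OF x] x by (simp add: norm_eq_sqrt_inner)
  ultimately show ?thesis using A(2)[OF y] by (metis poly_smult)
qed

text \<open>The kernel is zonal about x, so its value on the diagonal determines it. In a degree of
  dimension 0 both sides are 0.\<close>

lemma addition_formula:
  assumes x: "x \<in> sphere 0 1" and y: "y \<in> sphere 0 1"
  shows "Z k x y = real (harmonic_dim TYPE('n) k) / sphere_volume TYPE('n) * poly (legendre_poly CARD('n) k) (x \<bullet> y)"
proof (cases "harmonic_dim TYPE('n) k > 0")
  case True
  have "Z k x (R y) = Z k x y" if "orthogonal_transformation R" "R x = x" for R y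
    using Z_invariant[OF that(1), of k x y] that(2) by simp
  then have "Z k x y = Z k x x * poly (legendre_poly CARD('n) k) (x \<bullet> y)"
    by (intro zonal_harmonic_multiple[where f = "Z k x" and k = k] x y Z_harmonic True)
  then show ?thesis by (simp only: Z_diag[OF x])
qed simp

lemma Z_bound:
  assumes x: "x \<in> sphere 0 1" and y: "y \<in> sphere 0 1"
  shows "\<bar>Z k x y\<bar> \<le> real (harmonic_dim TYPE('n) k) / sphere_volume TYPE('n)"
proof -
  have "(Z k x y)\<^sup>2 \<le> (\<Sum>l\<in>{1..harmonic_dim TYPE('n) k}. (Y k l x)\<^sup>2) * (\<Sum>l\<in>{1..harmonic_dim TYPE('n) k}. (Y k l y)\<^sup>2)"
    by (rule Cauchy_Schwarz_ineq_sum)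
  also have "\<dots> = (real (harmonic_dim TYPE('n) k) / sphere_volume TYPE('n))\<^sup>2"
    using Z_diag[OF x, of k] Z_diag[OF y, of k] by (simp add: power2_eq_square)
  finally show ?thesis
    using sphere_volume_pos[where 'n = 'n] by (simp add: abs_le_square_iff[symmetric])
qed

text \<open>Every t in [-1, 1] is an inner product of two points of the sphere, so the
  Cauchy-Schwarz bound for the kernel transfers.\<close>

lemma poly_P_le_1:
  assumes d: "harmonic_dim TYPE('n) k > 0" and t: "t \<in> {-1..1}"
  shows "\<bar>poly (legendre_poly CARD('n) k) t\<bar> \<le> 1"
proof -
  obtain i :: 'n where True by simp
  define x where "x = (axis i 1 :: real^'n)"
  have x: "x \<in> sphere 0 1" by (simp add: x_def)
  obtain \<eta> where \<eta>: "norm \<eta> = 1" "x \<bullet> \<eta> = 0" using orthogonal_unit_exists[OF n2] by blast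
  define r where "r = sqrt (1 - t\<^sup>2)"
  have "\<bar>t\<bar> \<le> 1" using t by auto
  then have r: "r\<^sup>2 = 1 - t\<^sup>2" by (simp add: r_def abs_square_le_1)
  define y where "y = t *\<^sub>R x + r *\<^sub>R \<eta>"
  have "y \<bullet> y = t\<^sup>2 * (x \<bullet> x) + r\<^sup>2 * (\<eta> \<bullet> \<eta>)"
    using \<eta>(2) by (simp add: y_def inner_add_left inner_add_right inner_commute power2_eq_square)
  then have y: "y \<in> sphere 0 1" using x \<eta>(1) r by (simp add: norm_eq_sqrt_inner)
  have xy: "x \<bullet> y = t" using x \<eta>(2) by (simp add: y_def inner_add_right norm_eq_sqrt_inner)
  define c where "c = real (harmonic_dim TYPE('n) k) / sphere_volume TYPE('n)"
  have c: "c > 0" using d sphere_volume_pos[where 'n = 'n] by (simp add: c_def)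
  have "\<bar>c * poly (legendre_poly CARD('n) k) t\<bar> \<le> c"
    using Z_bound[OF x y, of k] unfolding addition_formula[OF x y] xy c_def .
  then have "c * \<bar>poly (legendre_poly CARD('n) k) t\<bar> \<le> c * 1"
    using c by (simp add: abs_mult)
  then show ?thesis using c by (simp only: mult_le_cancel_left_pos)
qed

lemma poly_P_lower:
  assumes d: "harmonic_dim TYPE('n) k > 0" and t: "1/2 \<le> t" "t \<le> 1"
  shows "poly (legendre_poly CARD('n) k) t \<ge> 1 - 2 * (real k)\<^sup>2 * (1 - t)"
  using legendre_lower_bound[OF n2 legendre_like_P[OF d] poly_P_1[OF d] _ t] poly_P_le_1[OF d]
  by (meson abs_le_D1)

text \<open>The degree k component f of \<open>\<psi> (x \<bullet> z)\<close> is invariant under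
  maps fixing x, hence a multiple of \<open>Z k x\<close>. Comparing coefficients at
  \<open>Y k l\<close> gives the formula, with the multiple as eigenvalue.\<close>

lemma funk_hecke:
  fixes \<psi> :: "real \<Rightarrow> real"
  assumes [measurable]: "\<psi> \<in> borel_measurable borel" and bd: "\<And>t. \<bar>\<psi> t\<bar> \<le> B"
    and x: "x \<in> sphere 0 1" and l: "l \<in> {1..harmonic_dim TYPE('n) k}"
  shows "(\<integral>z. \<psi> (x \<bullet> z) * Y k l z \<partial>surface_measure)
    = (\<integral>z. \<psi> (x \<bullet> z) * poly (legendre_poly CARD('n) k) (x \<bullet> z) \<partial>surface_measure) * Y k l x"
proof -
  have d: "harmonic_dim TYPE('n) k > 0" using l by auto
  have \<psi>m [measurable]: "(\<lambda>z. \<psi> (x \<bullet> z)) \<in> borel_measurable surface_measure"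
    by (intro borel_measurable_surface) measurable
  have \<psi>i: "integrable surface_measure (\<lambda>z. \<psi> (x \<bullet> z))"
    using bd by (intro integrable_surface_bounded[OF \<psi>m]) auto
  let ?c = "\<lambda>l. \<integral>z. \<psi> (x \<bullet> z) * Y k l z \<partial>surface_measure"
  define f where "f = (\<lambda>y. \<Sum>l\<in>{1..harmonic_dim TYPE('n) k}. ?c l * Y k l y)"
  have f: "f \<in> spherical_harmonics k" unfolding f_def by (rule harmonic_comb)
  have fZ: "f y = (\<integral>z. \<psi> (x \<bullet> z) * Z k z y \<partial>surface_measure)" for y
  proof -
    have "(\<integral>z. \<psi> (x \<bullet> z) * Z k z y \<partial>surface_measure) = (\<integral>z. (\<Sum>l\<in>{1..harmonic_dim TYPE('n) k}. Y k l y * (\<psi> (x \<bullet> z) * Y k l z)) \<partial>surface_measure)"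
      by (simp add: sum_distrib_left mult_ac)
    also have "\<dots> = (\<Sum>l\<in>{1..harmonic_dim TYPE('n) k}. Y k l y * ?c l)"
      using integrable_mult_harmonic[OF \<psi>i Y_harmonic]
      by (subst Bochner_Integration.integral_sum) auto
    finally show ?thesis by (simp add: f_def mult.commute)
  qed
  have inv: "f (R y) = f y" if R: "orthogonal_transformation R" "R x = x" for R y
  proof -
    have m: "(\<lambda>z. \<psi> (x \<bullet> z) * Z k z (R y)) \<in> borel_measurable surface_measure"
      using Y_measurable by measurable
    have "f (R y) = (\<integral>z. \<psi> (x \<bullet> R z) * Z k (R z) (R y) \<partial>surface_measure)"
      unfolding fZ by (rule integral_surface_orthogonal[OF R(1) m, symmetric])
    also have "\<dots> = (\<integral>z. \<psi> (R x \<bullet> R z) * Z k z y \<partial>surface_measure)"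
      by (simp only: Z_invariant[OF R(1)] R(2))
    also have "\<dots> = f y"
      unfolding fZ using R(1) by (simp add: orthogonal_transformation_def)
    finally show ?thesis .
  qed
  have fP: "f y = f x * poly (legendre_poly CARD('n) k) (x \<bullet> y)" if "y \<in> sphere 0 1" for y
    using zonal_harmonic_multiple[OF x f d _ that] inv by blast
  have fx: "f x = real (harmonic_dim TYPE('n) k) / sphere_volume TYPE('n) * (\<integral>z. \<psi> (x \<bullet> z) * poly (legendre_poly CARD('n) k) (x \<bullet> z) \<partial>surface_measure)"
  proof -
    have "f x = (\<integral>z. real (harmonic_dim TYPE('n) k) / sphere_volume TYPE('n) * (\<psi> (x \<bullet> z) * poly (legendre_poly CARD('n) k) (x \<bullet> z)) \<partial>surface_measure)"
      unfolding fZ by (rule integral_surface_cong) (simp only: addition_formula[OF _ x] inner_commute mult_ac)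
    then show ?thesis by simp
  qed
  have fy: "f y = (\<integral>z. \<psi> (x \<bullet> z) * poly (legendre_poly CARD('n) k) (x \<bullet> z) \<partial>surface_measure) * Z k x y"
    if "y \<in> sphere 0 1" for y
    by (simp only: fP[OF that] fx addition_formula[OF x that] mult_ac)
  let ?a = "\<integral>z. \<psi> (x \<bullet> z) * poly (legendre_poly CARD('n) k) (x \<bullet> z) \<partial>surface_measure"
  have coef: "harmonic_coeff Y (\<lambda>y. \<Sum>l\<in>{1..harmonic_dim TYPE('n) k}. c l * Y k l y) k l = c l" for c
  proof -
    have "harmonic_coeff Y (\<lambda>y. \<Sum>l\<in>{1..harmonic_dim TYPE('n) k}. c l * Y k l y) k l
       = (\<integral>y. (\<Sum>m\<in>{1..harmonic_dim TYPE('n) k}. c m * (Y k m y * Y k l y)) \<partial>surface_measure)"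
      by (simp add: harmonic_coeff_def sum_distrib_right mult.assoc)
    also have "\<dots> = (\<Sum>m\<in>{1..harmonic_dim TYPE('n) k}. c m * (\<integral>y. Y k m y * Y k l y \<partial>surface_measure))"
      using integrable_mult_harmonic[OF harmonic_integrable[OF Y_harmonic] Y_harmonic[OF l]]
      by (subst Bochner_Integration.integral_sum) auto
    also have "\<dots> = (\<Sum>m\<in>{1..harmonic_dim TYPE('n) k}. if m = l then c l else 0)"
      using l by (intro sum.cong refl) (simp add: Y_orthonormal)
    finally show ?thesis using l by simp
  qed
  have "?c l = harmonic_coeff Y f k l" unfolding f_def by (rule coef[symmetric])
  also have "\<dots> = harmonic_coeff Y (\<lambda>y. \<Sum>l\<in>{1..harmonic_dim TYPE('n) k}. (?a * Y k l x) * Y k l y) k l"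
    unfolding harmonic_coeff_def
    by (rule integral_surface_cong) (simp add: fy sum_distrib_left mult.assoc)
  also have "\<dots> = ?a * Y k l x" by (rule coef)
  finally show ?thesis .
qed

end

section \<open>Mass of a quadrature rule on caps\<close>

lemma chebyshev_exists: "\<exists>T::real poly. degree T \<le> n \<and> (\<forall>\<theta>. poly T (cos \<theta>) = cos (real n * \<theta>))"
proof (induction n rule: induct_nat_012)
  case 0 show ?case by (rule exI[of _ 1]) simp
next
  case 1 show ?case by (rule exI[of _ "[:0, 1:]"]) simp
next
  case (ge2 n)
  then obtain T U where T: "degree T \<le> n" "\<And>\<theta>. poly T (cos \<theta>) = cos (real n * \<theta>)"
    and U: "degree U \<le> Suc n" "\<And>\<theta>. poly U (cos \<theta>) = cos (real (Suc n) * \<theta>)" by blast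
  have "degree (pCons 0 (smult 2 U) - T) \<le> Suc (Suc n)"
    using T(1) U(1) by (intro degree_diff_le) (auto intro: order_trans[OF degree_pCons_le])
  moreover have "poly (pCons 0 (smult 2 U) - T) (cos \<theta>) = cos (real (Suc (Suc n)) * \<theta>)" for \<theta>
  proof -
    have "cos (real (Suc (Suc n)) * \<theta>) + cos (real n * \<theta>) = 2 * cos \<theta> * cos (real (Suc n) * \<theta>)"
      using cos_plus_cos[of "real (Suc (Suc n)) * \<theta>" "real n * \<theta>"]
      by (simp add: algebra_simps add_divide_distrib)
    then show ?thesis by (simp add: T(2) U(2))
  qed
  ultimately show ?case by blast
qed

lemma abs_sin_mult_le: "\<bar>sin (real n * x)\<bar> \<le> real n * \<bar>sin x\<bar>"
proof (induction n)
  case (Suc n)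
  have "\<bar>sin (real (Suc n) * x)\<bar> = \<bar>sin (real n * x) * cos x + cos (real n * x) * sin x\<bar>"
    using sin_add[of "real n * x" x] by (simp add: algebra_simps)
  also have "\<dots> \<le> \<bar>sin (real n * x)\<bar> * \<bar>cos x\<bar> + \<bar>cos (real n * x)\<bar> * \<bar>sin x\<bar>"
    by (rule order_trans[OF abs_triangle_ineq]) (simp add: abs_mult)
  also have "\<dots> \<le> \<bar>sin (real n * x)\<bar> * 1 + 1 * \<bar>sin x\<bar>"
    by (intro add_mono mult_left_mono mult_right_mono) auto
  also have "\<dots> \<le> real (Suc n) * \<bar>sin x\<bar>" using Suc by (simp add: algebra_simps)
  finally show ?case .
qed simp

lemma one_minus_cos_mult_le: "1 - cos (real n * x) \<le> (real n)\<^sup>2 * (1 - cos x)"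
proof -
  have h: "1 - cos y = 2 * (sin (y / 2))\<^sup>2" for y :: real
    using cos_double_sin[of "y / 2"] by simp
  have "(sin (real n * (x / 2)))\<^sup>2 \<le> (real n * sin (x / 2))\<^sup>2"
    using abs_sin_mult_le[of n "x / 2"] by (subst abs_le_square_iff[symmetric]) (simp add: abs_mult)
  then show ?thesis unfolding h by (simp add: power_mult_distrib)
qed

lemma one_minus_cos_bounds:
  fixes x :: real
  shows "1 - cos x \<le> x\<^sup>2 / 2" and "x\<^sup>2 / 2 - x ^ 4 / 24 \<le> 1 - cos x"
proof -
  have *: "1 - cos x \<le> x\<^sup>2 / 2 \<and> x\<^sup>2 / 2 - x ^ 4 / 24 \<le> 1 - cos x" if x: "x > 0" for x :: real
  proof
    obtain t where "cos x = (\<Sum>m<2. cos_coeff m * x ^ m) + (cos (t + 1/2 * real 2 * pi) / fact 2) * x ^ 2"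
      using Maclaurin_cos_expansion2[OF x, of 2] by auto
    then have "1 - cos x = cos t * x\<^sup>2 / 2"
      by (simp add: numeral_2_eq_2 cos_coeff_def)
    also have "\<dots> \<le> 1 * x\<^sup>2 / 2" by (intro divide_right_mono mult_right_mono) auto
    finally show "1 - cos x \<le> x\<^sup>2 / 2" by simp
    obtain t where "cos x = (\<Sum>m<4. cos_coeff m * x ^ m) + (cos (t + 1/2 * real 4 * pi) / fact 4) * x ^ 4"
      using Maclaurin_cos_expansion2[OF x, of 4] by auto
    moreover have "(\<Sum>m<4. cos_coeff m * x ^ m) = 1 - x\<^sup>2 / 2"
    proof -
      have "(4::nat) = Suc (Suc (Suc (Suc 0)))" by simp
      then show ?thesis by (simp only: sum.lessThan_Suc) (simp add: cos_coeff_def power2_eq_square)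
    qed
    moreover have "cos (t + 1/2 * real 4 * pi) = cos t" by simp
    moreover have "fact 4 = (24::real)" by (simp add: fact_numeral)
    ultimately have "1 - cos x = x\<^sup>2 / 2 - cos t * (x ^ 4 / 24)" by simp
    moreover have "cos t * (x ^ 4 / 24) \<le> 1 * (x ^ 4 / 24)" by (intro mult_right_mono) auto
    ultimately show "x\<^sup>2 / 2 - x ^ 4 / 24 \<le> 1 - cos x" by simp
  qed
  have "1 - cos x \<le> x\<^sup>2 / 2 \<and> x\<^sup>2 / 2 - x ^ 4 / 24 \<le> 1 - cos x"
    using *[of x] *[of "- x"] by (cases "x = 0"; cases "x > 0") auto
  then show "1 - cos x \<le> x\<^sup>2 / 2" "x\<^sup>2 / 2 - x ^ 4 / 24 \<le> 1 - cos x" by auto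
qed

text \<open>Bounds obtained by dividing by 1 - t hold only for t < 1; continuity carries them to the
  endpoint.\<close>

lemma poly_ge_closure:
  fixes p :: "real poly"
  assumes "\<And>t. t \<in> {a..<b} \<Longrightarrow> c \<le> poly p t" "a < b" "t \<in> {a..b}"
  shows "c \<le> poly p t"
proof -
  have "t \<in> closure {a..<b}" using assms(2,3) by simp
  then show ?thesis
  proof (rule continuous_ge_on_closure[of "{a..<b}" "poly p", rotated])
    show "continuous_on (closure {a..<b}) (poly p)" by (intro continuous_intros)
  qed (rule assms(1))
qed

text \<open>The Fejer kernel \<open>(1 - cos (N \<theta>)) / (1 - cos \<theta>)\<close> as a polynomial in \<open>cos \<theta>\<close>.\<close>

lemma fejer_exists:
  assumes N: "N \<ge> 1"
  obtains F :: "real poly" where "degree F \<le> N - 1"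
    "\<And>t. t \<in> {-1..1} \<Longrightarrow> 0 \<le> poly F t"
    "\<And>t. t \<in> {-1..1} \<Longrightarrow> poly F t * (1 + (real N)\<^sup>2 * (1 - t)) \<le> 3 * (real N)\<^sup>2"
    "\<And>t. t \<in> {-1..1} \<Longrightarrow> (real N)\<^sup>2 * (1 - t) \<le> 1 \<Longrightarrow> 3/4 * (real N)\<^sup>2 \<le> poly F t"
proof -
  obtain T :: "real poly" where T: "degree T \<le> N" "\<And>\<theta>. poly T (cos \<theta>) = cos (real N * \<theta>)"
    using chebyshev_exists by blast
  \<comment> \<open>For the Chebyshev polynomial T, 1 - T(t) is divisible by 1 - t, and the quotient
    is the kernel.\<close>
  have "poly (T - 1) 1 = 0" using T(2)[of 0] by simp
  then have "[:-1, 1:] dvd T - 1" using poly_eq_0_iff_dvd[of "T - 1" 1] by simp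
  then obtain G where G: "T - 1 = [:-1, 1:] * G" by (elim dvdE)
  have dG: "degree G \<le> N - 1"
  proof (cases "G = 0")
    case False
    then have "degree (T - 1) = 1 + degree G" unfolding G by (subst degree_mult_eq) auto
    moreover have "degree (T - 1) \<le> N" using T(1) by (intro degree_diff_le) auto
    ultimately show ?thesis by simp
  qed simp
  have GT: "poly T t = 1 - (1 - t) * poly G t" for t
    using arg_cong[OF G, of "\<lambda>p. poly p t"] by (simp add: algebra_simps)
  have core: "0 \<le> poly G t \<and> poly G t \<le> (real N)\<^sup>2 \<and> poly G t * (1 - t) \<le> 2 \<and>
      ((real N)\<^sup>2 * (1 - t) \<le> 1 \<longrightarrow> 3/4 * (real N)\<^sup>2 \<le> poly G t)" if t: "t \<in> {-1..<1}" for t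
  proof -
    define \<theta> where "\<theta> = arccos t"
    have \<theta>: "cos \<theta> = t" "0 \<le> \<theta>" "\<theta> \<le> pi"
      using t arccos_bounded[of t] by (auto simp: \<theta>_def)
    have e: "poly G t * (1 - t) = 1 - cos (real N * \<theta>)"
      using GT[of t] T(2)[of \<theta>] by (simp add: \<theta> algebra_simps)
    have u: "1 - t > 0" using t by simp
    have "0 \<le> poly G t * (1 - t)" unfolding e by simp
    then have 1: "0 \<le> poly G t" using u by (simp add: zero_le_mult_iff)
    have 2: "poly G t * (1 - t) \<le> 2" unfolding e using cos_ge_minus_one[of "real N * \<theta>"] by linarith
    have "poly G t * (1 - t) \<le> (real N)\<^sup>2 * (1 - t)"
      unfolding e using one_minus_cos_mult_le[of N \<theta>] by (simp add: \<theta>)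
    then have 3: "poly G t \<le> (real N)\<^sup>2" using u by simp
    \<comment> \<open>First \<theta> \<le> 2 gives \<theta>^2 \<le> 3 (1 - t), so x = N \<theta> has
      x^2 \<le> 3. The quartic Taylor error of 1 - cos x is then at most a quarter of x^2/2, while 1
      - t \<le> \<theta>^2/2; the ratio is at least 3/4 N^2.\<close>
    have 4: "3/4 * (real N)\<^sup>2 \<le> poly G t" if nt: "(real N)\<^sup>2 * (1 - t) \<le> 1"
    proof -
      have "1 * (1 - t) \<le> (real N)\<^sup>2 * (1 - t)" using N u by (intro mult_right_mono) auto
      then have "t \<ge> 0" using nt by simp
      then have "\<theta> \<le> pi / 2" using t unfolding \<theta>_def by (intro arccos_le_pi2) auto
      then have "\<theta> \<le> 2" using pi_less_4 by linarith
      then have t4: "\<theta>\<^sup>2 \<le> 4" using power_mono[of \<theta> 2 2] \<theta>(2) by simp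
      have "\<theta> ^ 4 = \<theta>\<^sup>2 * \<theta>\<^sup>2" by (simp add: power4_eq_xxxx power2_eq_square)
      also have "\<dots> \<le> 4 * \<theta>\<^sup>2" using t4 by (intro mult_right_mono) auto
      finally have "\<theta>\<^sup>2 \<le> 3 * (1 - t)" using one_minus_cos_bounds(2)[of \<theta>] by (simp add: \<theta>)
      then have "(real N)\<^sup>2 * \<theta>\<^sup>2 \<le> (real N)\<^sup>2 * (3 * (1 - t))" by (intro mult_left_mono) auto
      moreover have "(real N)\<^sup>2 * (3 * (1 - t)) = 3 * ((real N)\<^sup>2 * (1 - t))" by simp
      ultimately have x3: "(real N * \<theta>)\<^sup>2 \<le> 3" using nt unfolding power_mult_distrib by linarith
      define x where "x = real N * \<theta>"
      have "x ^ 4 = x\<^sup>2 * x\<^sup>2" by (simp add: power4_eq_xxxx power2_eq_square)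
      also have "\<dots> \<le> 3 * x\<^sup>2" using x3 by (intro mult_right_mono) (auto simp: x_def)
      finally have "3/8 * x\<^sup>2 \<le> 1 - cos x" using one_minus_cos_bounds(2)[of x] by simp
      moreover have "3/4 * (real N)\<^sup>2 * (1 - t) \<le> 3/8 * x\<^sup>2"
      proof -
        have "3/4 * (real N)\<^sup>2 * (1 - t) \<le> 3/4 * (real N)\<^sup>2 * (\<theta>\<^sup>2 / 2)"
          using one_minus_cos_bounds(1)[of \<theta>] by (intro mult_left_mono) (auto simp: \<theta>)
        then show ?thesis by (simp add: x_def power_mult_distrib)
      qed
      ultimately have "3/4 * (real N)\<^sup>2 * (1 - t) \<le> poly G t * (1 - t)" unfolding e x_def by linarith
      then show ?thesis using u by simp
    qed
    show ?thesis using 1 2 3 4 by blast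
  qed
  show ?thesis
  proof (rule that[OF dG])
    show g0: "0 \<le> poly G t" if "t \<in> {-1..1}" for t
      using poly_ge_closure[of "-1" 1 0 G t] core that by auto
    have "poly G t * (1 + (real N)\<^sup>2 * (1 - t)) \<le> 3 * (real N)\<^sup>2" if "t \<in> {-1..<1}" for t
    proof -
      have "poly G t * (1 + (real N)\<^sup>2 * (1 - t)) = poly G t + (real N)\<^sup>2 * (poly G t * (1 - t))"
        by (simp add: algebra_simps)
      also have "\<dots> \<le> (real N)\<^sup>2 + (real N)\<^sup>2 * 2"
        using core[OF that] by (intro add_mono mult_left_mono) auto
      finally show ?thesis by simp
    qed
    then have low: "- (3 * (real N)\<^sup>2) \<le> poly (- (G * [:1 + (real N)\<^sup>2, - ((real N)\<^sup>2):])) t"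
      if "t \<in> {-1..<1}" for t
      using that by (force simp: algebra_simps)
    have "- (3 * (real N)\<^sup>2) \<le> poly (- (G * [:1 + (real N)\<^sup>2, - ((real N)\<^sup>2):])) t"
      if "t \<in> {-1..1}" for t
      by (rule poly_ge_closure[of "-1" 1, OF low _ that]) simp_all
    then show "poly G t * (1 + (real N)\<^sup>2 * (1 - t)) \<le> 3 * (real N)\<^sup>2" if "t \<in> {-1..1}" for t
      using that by (force simp: algebra_simps)
    show "3/4 * (real N)\<^sup>2 \<le> poly G t" if t: "t \<in> {-1..1}" "(real N)\<^sup>2 * (1 - t) \<le> 1" for t
    proof (cases "t = 1")
      case False then show ?thesis using core[of t] t by auto
    next
      case True
      \<comment> \<open>At t = 1 the bound is a limit from the left: every s in [a, 1) satisfies N^2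
        (1 - s) \<le> 1.\<close>
      define a where "a = max (-1) (1 - 1 / (real N)\<^sup>2)"
      have N2: "(real N)\<^sup>2 > 0" using N by simp
      have low: "3/4 * (real N)\<^sup>2 \<le> poly G s" if s: "s \<in> {a..<1}" for s
      proof -
        have "1 - s \<le> 1 / (real N)\<^sup>2" using s by (simp add: a_def)
        then have "(real N)\<^sup>2 * (1 - s) \<le> 1" using N2 by (simp add: field_simps)
        then show ?thesis using core[of s] s by (auto simp: a_def)
      qed
      show ?thesis
        by (rule poly_ge_closure[of a 1, OF low]) (use N2 True in \<open>auto simp: a_def\<close>)
    qed
  qed
qed

text \<open>The majorant \<open>u powr (b - 1) / (1 + M * u) powr (b + 1)\<close> is the derivative of \<open>(u / (1 + M * u)) powr b / b\<close>.\<close>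

lemma majorant_integral:
  fixes b M :: real
  assumes b: "b > 0" and M: "M > 0"
  defines "g \<equiv> \<lambda>t. (1 - t) powr (b - 1) * (1 + M * (1 - t)) powr (- b - 1)"
  shows "set_integrable lborel {0..1} g" and "(LBINT t:{0..1}. g t) \<le> M powr (- b) / b"
proof -
  let ?G = "\<lambda>t. - (((1 - t) / (1 + M * (1 - t))) powr b / b)"
  have "(g has_integral (?G 1 - ?G 0)) {0..1}"
  proof (rule fundamental_theorem_of_calculus_interior)
    have pos: "1 + M * (1 - t) > 0" if "t \<in> {0..1}" for t
      using M that by (intro add_pos_nonneg mult_nonneg_nonneg) auto
    have nn: "0 \<le> (1 - t) / (1 + M * (1 - t))" if "t \<in> {0..1}" for t
      using pos[OF that] that by (intro divide_nonneg_pos) auto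
    have "continuous_on {0..1} (\<lambda>t. (1 - t) / (1 + M * (1 - t)))"
      by (intro continuous_intros ballI less_imp_neq[symmetric] pos)
    then have "continuous_on {0..1} (\<lambda>t. ((1 - t) / (1 + M * (1 - t))) powr b)"
      using nn b by (intro continuous_on_powr' continuous_on_const) blast+
    then show "continuous_on {0..1} ?G"
      using b by (intro continuous_on_minus continuous_on_divide continuous_on_const) auto
    fix t :: real assume t: "t \<in> {0<..<1}"
    define u where "u = 1 - t"
    define D where "D = 1 + M * u"
    have u: "u > 0" and D: "D > 0" using t M by (auto simp: u_def D_def intro!: add_pos_pos)
    have "((\<lambda>t. (1 - t) / (1 + M * (1 - t))) has_real_derivative
        (- 1 * (1 + M * (1 - t)) - (1 - t) * (- M)) / ((1 + M * (1 - t)) * (1 + M * (1 - t)))) (at t)"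
    proof (rule DERIV_divide)
      show "((\<lambda>t. 1 + M * (1 - t)) has_real_derivative - M) (at t)"
        by (auto intro!: derivative_eq_intros)
      show "((\<lambda>t. 1 - t) has_real_derivative - 1) (at t)"
        by (auto intro!: derivative_eq_intros)
    qed (use D in \<open>simp add: D_def u_def\<close>)
    moreover have "- 1 * (1 + M * (1 - t)) - (1 - t) * (- M) = - 1" by (simp add: algebra_simps)
    ultimately have d: "((\<lambda>t. (1 - t) / (1 + M * (1 - t))) has_real_derivative (- 1 / D\<^sup>2)) (at t)"
      by (simp only: D_def u_def power2_eq_square)
    have "((\<lambda>t. ((1 - t) / (1 + M * (1 - t))) powr b) has_real_derivative
       (b * ((1 - t) / (1 + M * (1 - t))) powr (b - of_nat 1) * (- 1 / D\<^sup>2))) (at t)"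
      using u D unfolding u_def D_def by (intro DERIV_fun_powr d[unfolded u_def D_def] divide_pos_pos)
    then have "((\<lambda>t. ((1 - t) / (1 + M * (1 - t))) powr b) has_real_derivative
       (b * (u / D) powr (b - 1) * (- 1 / D\<^sup>2))) (at t)"
      by (simp add: u_def D_def)
    then have "(?G has_real_derivative (- (b * (u / D) powr (b - 1) * (- 1 / D\<^sup>2) / b))) (at t)"
      by (intro DERIV_minus DERIV_cdivide)
    moreover have "- (b * (u / D) powr (b - 1) * (- 1 / D\<^sup>2) / b) = g t"
    proof -
      have "- b - 1 = - (b - 1) + (- 2)" by simp
      then have "D powr (- b - 1) = D powr (- (b - 1)) * D powr (- 2)" by (simp only: powr_add)
      also have "D powr (- 2) = inverse (D\<^sup>2)" using D by (simp add: powr_minus)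
      finally have e: "D powr (- b - 1) = inverse (D powr (b - 1)) * inverse (D\<^sup>2)"
        by (simp only: powr_minus)
      have "g t = u powr (b - 1) * (inverse (D powr (b - 1)) * inverse (D\<^sup>2))"
        unfolding e[symmetric] by (simp add: g_def u_def D_def)
      moreover have "(u / D) powr (b - 1) = u powr (b - 1) * inverse (D powr (b - 1))"
      proof -
        have "(u / D) powr (b - 1) = u powr (b - 1) / D powr (b - 1)" by (rule powr_divide)
        then show ?thesis by (simp only: divide_inverse)
      qed
      ultimately show ?thesis using b by (simp add: divide_inverse)
    qed
    ultimately show "(?G has_vector_derivative g t) (at t)"
      by (simp add: has_real_derivative_iff_has_vector_derivative)
  qed simp
  then have hi: "(g has_integral ((1 / (1 + M)) powr b / b)) {0..1}"
    using b by simp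
  have "g absolutely_integrable_on {0..1}"
    using hi by (intro nonnegative_absolutely_integrable_1) (auto simp: integrable_on_def g_def)
  then show int: "set_integrable lborel {0..1} g"
    unfolding set_integrable_def by (subst (asm) integrable_completion) (simp_all add: g_def)
  have "(LBINT t:{0..1}. g t) = (1 / (1 + M)) powr b / b"
    using set_borel_integral_eq_integral(2)[OF int] hi by (simp add: integral_unique)
  also have "\<dots> \<le> (1 / M) powr b / b"
  proof -
    have "1 / (1 + M) \<le> 1 / M" using M by (intro divide_left_mono) auto
    then show ?thesis using b M by (intro divide_right_mono powr_mono2) auto
  qed
  also have "(1 / M) powr b = M powr (- b)"
    using powr_divide[of 1 M b] by (simp add: powr_minus inverse_eq_divide)
  finally show "(LBINT t:{0..1}. g t) \<le> M powr (- b) / b" .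
qed

text \<open>The power of 3 comes from the upper bound for the n-th power of the kernel. The two
  summands are the contributions of t \<ge> 0, through the majorant, and of t < 0, where the kernel
  is small.\<close>

definition peak_const :: "nat \<Rightarrow> real" where
  "peak_const n = 3 ^ n * (2 powr ((real n - 1) / 2) / ((real n - 1) / 2) + weight_integral n 1)"

lemma peak_const_nonneg: "n \<ge> 2 \<Longrightarrow> peak_const n \<ge> 0"
  using weight_integral_1_pos[of n] by (simp add: peak_const_def)

text \<open>The n-th power of the Fejer kernel divided by N^2. Power n gives decay (1 + N^2 (1 -
  t))^(-n), faster than the exponent (n + 1)/2 of the majorant, so the mass is of order
  N^(-(n-1)).\<close>

lemma peak_poly_exists:
  assumes n: "n \<ge> 2" and N: "N \<ge> 1"
  obtains q :: "real poly" where "degree q \<le> (N - 1) * n"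
    "\<And>t. t \<in> {-1..1} \<Longrightarrow> 0 \<le> poly q t"
    "\<And>t. t \<in> {-1..1} \<Longrightarrow> (real N)\<^sup>2 * (1 - t) \<le> 1 \<Longrightarrow> (3/4) ^ n \<le> poly q t"
    "weight_integral n q \<le> peak_const n * real N powr (- (real n - 1))"
proof -
  obtain F :: "real poly" where F: "degree F \<le> N - 1"
    "\<And>t. t \<in> {-1..1} \<Longrightarrow> 0 \<le> poly F t"
    "\<And>t. t \<in> {-1..1} \<Longrightarrow> poly F t * (1 + (real N)\<^sup>2 * (1 - t)) \<le> 3 * (real N)\<^sup>2"
    "\<And>t. t \<in> {-1..1} \<Longrightarrow> (real N)\<^sup>2 * (1 - t) \<le> 1 \<Longrightarrow> 3/4 * (real N)\<^sup>2 \<le> poly F t"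
    using fejer_exists[OF N] by metis
  define M where "M = (real N)\<^sup>2"
  have M: "M \<ge> 1" using N by (simp add: M_def)
  define b where "b = (real n - 1) / 2"
  have b: "b > 0" using n by (simp add: b_def)
  define q where "q = smult (1 / M) F ^ n"
  have "degree q \<le> degree (smult (1 / M) F) * n" unfolding q_def by (rule degree_power_le)
  also have "\<dots> \<le> (N - 1) * n" using F(1) by (intro mult_right_mono order_trans[OF degree_smult_le]) auto
  finally have dq: "degree q \<le> (N - 1) * n" .
  have q0: "0 \<le> poly q t" if "t \<in> {-1..1}" for t
    using F(2)[OF that] M by (simp add: q_def)
  have ql: "(3/4) ^ n \<le> poly q t" if "t \<in> {-1..1}" "(real N)\<^sup>2 * (1 - t) \<le> 1" for t
  proof -
    have "3/4 * M \<le> poly F t" using F(4)[OF that] by (simp add: M_def)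
    then have "3/4 \<le> 1 / M * poly F t" using M by (simp add: field_simps)
    then show ?thesis by (simp add: q_def power_mono)
  qed
  have qu: "poly q t \<le> 3 ^ n * (1 + M * (1 - t)) powr (- b - 1)" if t: "t \<in> {-1..1}" for t
  proof -
    define D where "D = 1 + M * (1 - t)"
    have D: "D \<ge> 1" using t M by (simp add: D_def)
    have "poly F t * D \<le> 3 * M" using F(3)[OF t] by (simp only: M_def D_def)
    then have "1 / M * poly F t \<le> 3 * (1 / D)" using M D by (simp add: field_simps)
    then have "(1 / M * poly F t) ^ n \<le> (3 * (1 / D)) ^ n" using F(2)[OF t] M by (intro power_mono) auto
    also have "\<dots> = 3 ^ n * D powr (- real n)"
      using D by (simp add: power_mult_distrib powr_minus powr_realpow divide_inverse power_inverse)
    also have "\<dots> \<le> 3 ^ n * D powr (- b - 1)"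
      using D n by (intro mult_left_mono powr_mono) (auto simp: b_def field_simps)
    finally show ?thesis by (simp add: q_def D_def)
  qed
  define g where "g = (\<lambda>t. (1 - t) powr (b - 1) * (1 + M * (1 - t)) powr (- b - 1))"
  note gi = majorant_integral[OF b, of M, folded g_def]
  have M0: "M > 0" using M by simp
  let ?h = "\<lambda>t. 3 ^ n * (2 powr b * (indicator {0..1} t * g t)) + (3 ^ n * M powr (- b)) * (poly 1 t * legendre_weight n t)"
  have i1: "set_integrable lborel {-1..1} (\<lambda>t. indicator {0..1} t * g t)"
  proof -
    have "(\<lambda>t. indicator {-1..1} t *\<^sub>R (indicator {0..1} t * g t)) = (\<lambda>t. indicator {0..1} t *\<^sub>R g t)"
      by (auto simp: indicator_def)
    then show ?thesis using gi(1)[OF M0] by (simp add: set_integrable_def)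
  qed
  have e1: "(LBINT t:{-1..1}. indicator {0..1} t * g t) = (LBINT t:{0..1}. g t)"
    unfolding set_lebesgue_integral_def by (rule Bochner_Integration.integral_cong) (auto simp: indicator_def)
  have i2: "set_integrable lborel {-1..1} (\<lambda>t. 3 ^ n * (2 powr b * (indicator {0..1} t * g t)))"
    using i1 by (intro set_integrable_mult_right)
  have i3: "set_integrable lborel {-1..1} (\<lambda>t. (3 ^ n * M powr (- b)) * (poly 1 t * legendre_weight n t))"
    using weight_integrable[OF n] by (intro set_integrable_mult_right)
  have "weight_integral n q \<le> (LBINT t:{-1..1}. ?h t)"
    unfolding weight_integral_def
  proof (rule set_integral_mono[OF weight_integrable[OF n] set_integral_add(1)[OF i2 i3]])
    fix t :: real assume t: "t \<in> {-1..1}"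
    have w0: "legendre_weight n t \<ge> 0" by (simp add: legendre_weight_def)
    have g0: "g t \<ge> 0" by (simp add: g_def)
    show "poly q t * legendre_weight n t \<le> ?h t"
    proof (cases "t \<ge> 0")
      case True
      have "legendre_weight n t = (1 - t) powr (b - 1) * (1 + t) powr (b - 1)"
      proof -
        have "1 - t\<^sup>2 = (1 - t) * (1 + t)" by (simp add: power2_eq_square algebra_simps)
        moreover have "(real n - 3) / 2 = b - 1" by (simp add: b_def field_simps)
        ultimately have "legendre_weight n t = ((1 - t) * (1 + t)) powr (b - 1)"
          by (simp only: legendre_weight_def)
        then show ?thesis using t by (simp add: powr_mult)
      qed
      also have "\<dots> \<le> (1 - t) powr (b - 1) * 2 powr b"
      proof (intro mult_left_mono)
        \<comment> \<open>For n = 2 the exponent b - 1 is negative; raising it to b keeps one bound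
          for all n.\<close>
        have "(1 + t) powr (b - 1) \<le> (1 + t) powr b" using True by (intro powr_mono) auto
        also have "\<dots> \<le> 2 powr b" using True t b by (intro powr_mono2) auto
        finally show "(1 + t) powr (b - 1) \<le> 2 powr b" .
      qed simp
      finally have "poly q t * legendre_weight n t
          \<le> (3 ^ n * (1 + M * (1 - t)) powr (- b - 1)) * ((1 - t) powr (b - 1) * 2 powr b)"
        using qu[OF t] q0[OF t] w0 by (intro mult_mono) auto
      also have "\<dots> = 3 ^ n * (2 powr b * g t)" by (simp add: g_def mult_ac)
      also have "\<dots> \<le> ?h t" using True t w0 by simp
      finally show ?thesis .
    next
      case False
      have "poly q t \<le> 3 ^ n * (1 + M * (1 - t)) powr (- b - 1)" by (rule qu[OF t])
      also have "\<dots> \<le> 3 ^ n * M powr (- b)"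
      proof (intro mult_left_mono)
        have "M * 1 \<le> M * (1 - t)" using False M by (intro mult_left_mono) auto
        then have "M \<le> 1 + M * (1 - t)" by simp
        then have "(1 + M * (1 - t)) powr (- b - 1) \<le> M powr (- b - 1)"
          using M b by (intro powr_mono2') auto
        also have "\<dots> \<le> M powr (- b)" using M by (intro powr_mono) auto
        finally show "(1 + M * (1 - t)) powr (- b - 1) \<le> M powr (- b)" .
      qed simp
      finally have "poly q t * legendre_weight n t \<le> 3 ^ n * M powr (- b) * legendre_weight n t"
        using w0 by (intro mult_right_mono)
      then show ?thesis using False g0 by simp
    qed
  qed
  also have "\<dots> = 3 ^ n * (2 powr b * (LBINT t:{0..1}. g t)) + 3 ^ n * M powr (- b) * weight_integral n 1"
    unfolding set_integral_add(2)[OF i2 i3] set_integral_mult_right e1 weight_integral_def ..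
  also have "\<dots> \<le> 3 ^ n * (2 powr b * (M powr (- b) / b)) + 3 ^ n * M powr (- b) * weight_integral n 1"
    using gi(2)[OF M0] by (intro add_right_mono mult_left_mono) auto
  also have "\<dots> = peak_const n * M powr (- b)"
    by (simp add: peak_const_def b_def[symmetric] algebra_simps)
  also have "M powr (- b) = real N powr (- (real n - 1))"
  proof -
    have "M = real N powr 2" using N by (simp add: M_def powr_numeral)
    then have "M powr (- b) = real N powr (2 * (- b))" by (simp only: powr_powr)
    also have "2 * (- b) = - (real n - 1)" by (simp add: b_def field_simps)
    finally show ?thesis .
  qed
  finally show ?thesis using that[OF dq q0 ql] by blast
qed

section \<open>Zonal polynomials as test functions for a quadrature rule\<close>

lemma spherical_polysI_sum:
  assumes "finite J" "\<And>i. i \<in> J \<Longrightarrow> on_sphere (f i) \<in> spherical_polys s"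
  shows "on_sphere (\<lambda>x. \<Sum>i\<in>J. c i * f i x) \<in> spherical_polys s"
  using assms
proof (induction J)
  case empty
  show ?case unfolding spherical_polys_def
    using fun_vs.span_zero by (intro image_eqI[of _ _ 0]) (auto simp: zero_fun_def)
next
  case (insert i J)
  then have "on_sphere (f i) \<in> spherical_polys s" "on_sphere (\<lambda>x. \<Sum>i\<in>J. c i * f i x) \<in> spherical_polys s"
    by auto
  then obtain p q where p: "p \<in> fun_vs.span (monomial_fun ` {\<alpha>. (\<Sum>i\<in>UNIV. \<alpha> i) \<le> s})" "on_sphere (f i) = on_sphere p"
    and q: "q \<in> fun_vs.span (monomial_fun ` {\<alpha>. (\<Sum>i\<in>UNIV. \<alpha> i) \<le> s})"
      "on_sphere (\<lambda>x. \<Sum>i\<in>J. c i * f i x) = on_sphere q"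
    unfolding spherical_polys_def by auto
  have "on_sphere (\<lambda>x. \<Sum>i\<in>insert i J. c i * f i x) = on_sphere ((\<lambda>x. c i * p x) + q)"
  proof
    fix x
    show "on_sphere (\<lambda>x. \<Sum>i\<in>insert i J. c i * f i x) x = on_sphere ((\<lambda>x. c i * p x) + q) x"
      using fun_cong[OF p(2), of x] fun_cong[OF q(2), of x] insert(1,2)
      by (auto simp: on_sphere_def plus_fun_def split: if_splits)
  qed
  then show ?case
    unfolding spherical_polys_def using fun_vs.span_add[OF fun_vs.span_scale[OF p(1)] q(1)] by blast
qed

lemma hpoly_spherical_polys:
  assumes "hpoly k p" "k \<le> s"
  shows "on_sphere p \<in> spherical_polys s"
proof -
  have "p \<in> fun_vs.span (monomial_fun ` {\<alpha>. (\<Sum>i\<in>UNIV. \<alpha> i) = k})"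
    using assms(1) homogeneous_polys_eq[of k] unfolding homogeneous_polys_def by auto
  also have "\<dots> \<subseteq> fun_vs.span (monomial_fun ` {\<alpha>. (\<Sum>i\<in>UNIV. \<alpha> i) \<le> s})"
    using assms(2) by (intro fun_vs.span_mono) auto
  finally show ?thesis unfolding spherical_polys_def by auto
qed

lemma zonal_poly_spherical_polys:
  assumes "degree q \<le> s"
  shows "on_sphere (\<lambda>x. poly q (x \<bullet> z)) \<in> spherical_polys s"
  unfolding poly_altdef using assms
  by (intro spherical_polysI_sum hpoly_spherical_polys[OF hpoly_inner_power]) auto

text \<open>In order: the inverse of the peak height, the ratio between integrals over the sphere
  and over the interval, the mass of the peak, and the price of passing from the kernel parameter to
  s.\<close>

definition cap_const :: "'n::finite itself \<Rightarrow> real" where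
  "cap_const _ = (4/3) ^ CARD('n) * (sphere_volume TYPE('n) / weight_integral CARD('n) 1) *
     peak_const CARD('n) * real CARD('n) ^ (CARD('n) - 1)"

text \<open>A peak polynomial centred at z, of degree at most s, dominates a constant times the
  indicator of the cap. Positivity of the weights and exactness bound the node sum by its integral,
  of order s^(1-n).\<close>

lemma quadrature_cap:
  fixes p :: "nat \<Rightarrow> real^'n::finite"
  assumes n: "CARD('n) \<ge> 2" and s: "s \<ge> 1" and quad: "positive_quadrature s N w p" and z: "z \<in> sphere 0 1"
  shows "(\<Sum>i = 1..N. w i * indicator {1 - 1 / (4 * (real s)\<^sup>2)..} (p i \<bullet> z))
    \<le> cap_const TYPE('n) / real s ^ (CARD('n) - 1)"
proof -
  define n' where "n' = CARD('n)"
  have n': "n' \<ge> 2" using n by (simp add: n'_def)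
  \<comment> \<open>The largest K with (K - 1) n \<le> s. From K \<le> 2 s the peak covers 1 - t
    \<le> 1/(4 s^2), and s \<le> n K turns the bound in K into one in s.\<close>
  define K where "K = s div n' + 1"
  have K1: "K \<ge> 1" by (simp add: K_def)
  obtain q :: "real poly" where q: "degree q \<le> (K - 1) * n'"
    "\<And>t. t \<in> {-1..1} \<Longrightarrow> 0 \<le> poly q t"
    "\<And>t. t \<in> {-1..1} \<Longrightarrow> (real K)\<^sup>2 * (1 - t) \<le> 1 \<Longrightarrow> (3/4) ^ n' \<le> poly q t"
    "weight_integral n' q \<le> peak_const n' * real K powr (- (real n' - 1))"
    using peak_poly_exists[OF n' K1] by metis
  have dq: "degree q \<le> s" using q(1) by (simp add: K_def) (meson div_times_less_eq_dividend order_trans)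
  have K2: "real K \<le> 2 * real s"
  proof -
    have "s div n' \<le> s" by simp
    then have "K \<le> 2 * s" using s unfolding K_def by linarith
    then show ?thesis by (metis of_nat_le_iff of_nat_mult of_nat_numeral)
  qed
  have K3: "real s \<le> real n' * real K"
  proof -
    have "s < n' * (s div n') + n'" using n' by (metis mult_div_mod_eq mod_less_divisor nat_add_left_cancel_less less_le_trans zero_less_numeral)
    then have "s \<le> n' * K" by (simp add: K_def)
    then show ?thesis by (metis of_nat_le_iff of_nat_mult)
  qed
  have w: "w i \<ge> 0" "p i \<in> sphere 0 1" if "i \<in> {1..N}" for i
    using quad that by (auto simp: positive_quadrature_def)
  have pz: "p i \<bullet> z \<in> {-1..1}" if "i \<in> {1..N}" for i
    using Cauchy_Schwarz_ineq2[of "p i" z] w(2)[OF that] z by (auto simp: abs_le_iff)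
  have "(\<Sum>i = 1..N. w i * indicator {1 - 1 / (4 * (real s)\<^sup>2)..} (p i \<bullet> z))
      \<le> (\<Sum>i = 1..N. w i * ((4/3) ^ n' * poly q (p i \<bullet> z)))"
  proof (intro sum_mono mult_left_mono)
    fix i assume i: "i \<in> {1..N}"
    show "indicator {1 - 1 / (4 * (real s)\<^sup>2)..} (p i \<bullet> z) \<le> (4/3) ^ n' * poly q (p i \<bullet> z)"
    proof (cases "p i \<bullet> z \<ge> 1 - 1 / (4 * (real s)\<^sup>2)")
      case True
      have "(real K)\<^sup>2 * (1 - p i \<bullet> z) \<le> (2 * real s)\<^sup>2 * (1 / (4 * (real s)\<^sup>2))"
        using True pz[OF i] K2 by (intro mult_mono power_mono) auto
      also have "\<dots> = 1" using s by (simp add: power_mult_distrib)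
      finally have "(3/4) ^ n' \<le> poly q (p i \<bullet> z)" using q(3) pz[OF i] by blast
      then have "(4/3) ^ n' * (3/4) ^ n' \<le> (4/3) ^ n' * poly q (p i \<bullet> z)" by (intro mult_left_mono) auto
      then show ?thesis using True by (simp add: power_mult_distrib[symmetric])
    qed (use q(2)[OF pz[OF i]] in simp)
  qed (use w in auto)
  also have "\<dots> = (4/3) ^ n' * (\<Sum>i = 1..N. w i * poly q (p i \<bullet> z))"
    by (simp add: sum_distrib_left mult.left_commute)
  also have "(\<Sum>i = 1..N. w i * poly q (p i \<bullet> z)) = (\<Sum>i = 1..N. w i * on_sphere (\<lambda>x. poly q (x \<bullet> z)) (p i))"
    using w(2) by (intro sum.cong) (auto simp: on_sphere_def)
  also have "\<dots> = (\<integral>x. on_sphere (\<lambda>x. poly q (x \<bullet> z)) x \<partial>surface_measure)"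
    using quad zonal_poly_spherical_polys[OF dq, of z] unfolding positive_quadrature_def by auto
  also have "\<dots> = (\<integral>x. poly q (x \<bullet> z) \<partial>surface_measure)"
    by (rule integral_surface_cong) (simp add: on_sphere_def)
  also have "\<dots> = sphere_volume TYPE('n) / weight_integral n' 1 * weight_integral n' q"
    using integral_zonal_poly[OF n, of z q] z by (simp add: n'_def)
  also have "(4/3) ^ n' * \<dots> \<le> (4/3) ^ n' * (sphere_volume TYPE('n) / weight_integral n' 1 *
      (peak_const n' * (real n' ^ (n' - 1) / real s ^ (n' - 1))))"
  proof (intro mult_left_mono)
    have "real K powr (- (real n' - 1)) = 1 / real K ^ (n' - 1)"
    proof -
      have "real n' - 1 = real (n' - 1)" using n' by simp
      then show ?thesis using K1 by (simp add: powr_minus powr_realpow divide_inverse del: of_nat_diff)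
    qed
    also have "\<dots> \<le> real n' ^ (n' - 1) / real s ^ (n' - 1)"
    proof -
      have "real s ^ (n' - 1) \<le> (real n' * real K) ^ (n' - 1)" using K3 by (intro power_mono) auto
      then show ?thesis using K1 s by (simp add: field_simps power_mult_distrib)
    qed
    finally have "real K powr (- (real n' - 1)) \<le> real n' ^ (n' - 1) / real s ^ (n' - 1)" .
    then show "weight_integral n' q \<le> peak_const n' * (real n' ^ (n' - 1) / real s ^ (n' - 1))"
      using peak_const_nonneg[OF n'] by (intro order_trans[OF q(4)] mult_left_mono)
    show "0 \<le> sphere_volume TYPE('n) / weight_integral n' 1"
      using sphere_volume_pos[where 'n = 'n] weight_integral_1_pos[OF n'] by simp
  qed simp
  also have "\<dots> = cap_const TYPE('n) / real s ^ (n' - 1)"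
    by (simp add: cap_const_def n'_def)
  finally show ?thesis by (simp add: n'_def)
qed

section \<open>A sampling inequality\<close>

definition coeff_sq :: "'n::finite itself \<Rightarrow> nat set \<Rightarrow> (nat \<Rightarrow> nat \<Rightarrow> real) \<Rightarrow> real" where
  "coeff_sq T A c = (\<Sum>k\<in>A. \<Sum>l = 1..harmonic_dim T k. (c k l)\<^sup>2)"

lemma coeff_sq_nonneg: "coeff_sq T A c \<ge> 0"
  by (simp add: coeff_sq_def sum_nonneg)

text \<open>Of 16 = 4 * 4, one factor comes from dividing by eigenvalues at least v/2, the other
  from the lower bound for the cap volume v, which also supplies the power of 8 n.\<close>

definition quad_const :: "'n::finite itself \<Rightarrow> real" where
  "quad_const T = 16 * cap_const T * (8 * real CARD('n)) ^ (CARD('n) - 1)"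

lemma zonal_integral_invariant:
  fixes x y :: "real^'n::finite" and h :: "real \<Rightarrow> real"
  assumes [measurable]: "h \<in> borel_measurable borel" and "x \<in> sphere 0 1" "y \<in> sphere 0 1"
  shows "(\<integral>z. h (x \<bullet> z) \<partial>surface_measure) = (\<integral>z. h (y \<bullet> z) \<partial>surface_measure)"
proof -
  obtain R where R: "orthogonal_transformation R" "R x = y"
    using orthogonal_transformation_exists[of x y] assms by auto
  have "(\<lambda>z. h (y \<bullet> z)) \<in> borel_measurable surface_measure"
    by (intro borel_measurable_surface) measurable
  from integral_surface_orthogonal[OF R(1) this]
  have "(\<integral>z. h (y \<bullet> z) \<partial>surface_measure) = (\<integral>z. h (R x \<bullet> R z) \<partial>surface_measure)" by (simp add: R(2))
  then show ?thesis using R(1) by (simp add: orthogonal_transformation_def)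
qed

text \<open>Expand the nonnegative integral of f (g - a/v)^2, where a/v is the mean of g with weight
  f.\<close>

lemma integral_square_weighted:
  fixes f g :: "'a \<Rightarrow> real"
  assumes f: "integrable M f" and fg: "integrable M (\<lambda>x. f x * g x)"
    and fgg: "integrable M (\<lambda>x. f x * (g x)\<^sup>2)" and nonneg: "\<And>x. f x \<ge> 0" and pos: "(\<integral>x. f x \<partial>M) > 0"
  shows "(\<integral>x. f x * g x \<partial>M)\<^sup>2 \<le> (\<integral>x. f x \<partial>M) * (\<integral>x. f x * (g x)\<^sup>2 \<partial>M)"
proof -
  define v where "v = (\<integral>x. f x \<partial>M)"
  define a where "a = (\<integral>x. f x * g x \<partial>M)"
  have "0 \<le> (\<integral>x. f x * (g x - a / v)\<^sup>2 \<partial>M)"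
    using nonneg by (intro Bochner_Integration.integral_nonneg) auto
  also have "(\<lambda>x. f x * (g x - a / v)\<^sup>2) = (\<lambda>x. f x * (g x)\<^sup>2 - 2 * (a / v) * (f x * g x) + (a / v)\<^sup>2 * f x)"
    by (auto simp: power2_diff algebra_simps)
  also have "(\<integral>x. f x * (g x)\<^sup>2 - 2 * (a / v) * (f x * g x) + (a / v)\<^sup>2 * f x \<partial>M)
      = (\<integral>x. f x * (g x)\<^sup>2 \<partial>M) - 2 * (a / v) * a + (a / v)\<^sup>2 * v"
    using f fg fgg by (simp add: a_def v_def)
  finally have "0 \<le> v * ((\<integral>x. f x * (g x)\<^sup>2 \<partial>M) - 2 * (a / v) * a + (a / v)\<^sup>2 * v)"
    using pos by (simp add: v_def)
  also have "\<dots> = v * (\<integral>x. f x * (g x)\<^sup>2 \<partial>M) - a\<^sup>2"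
    using pos by (simp add: v_def[symmetric] power2_eq_square field_simps)
  finally show ?thesis by (simp add: a_def v_def)
qed

section \<open>Finite harmonic sums and their values at the nodes\<close>

context harmonic_basis
begin

definition harm_sum :: "nat set \<Rightarrow> (nat \<Rightarrow> nat \<Rightarrow> real) \<Rightarrow> real^'n \<Rightarrow> real" where
  "harm_sum A c x = (\<Sum>k\<in>A. \<Sum>l = 1..harmonic_dim TYPE('n) k. c k l * Y k l x)"

lemma Y_orthonormal_degrees:
  assumes "l \<in> {1..harmonic_dim TYPE('n) k}" "m \<in> {1..harmonic_dim TYPE('n) j}"
  shows "(\<integral>x. Y k l x * Y j m x \<partial>surface_measure) = (if k = j \<and> l = m then 1 else 0)"
proof (cases "k = j")
  case True then show ?thesis using Y_orthonormal assms by auto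
next
  case False
  then show ?thesis
    using harmonic_degree_orthogonal[OF Y_harmonic[OF assms(1)] Y_harmonic[OF assms(2)]] by simp
qed

lemma harm_sum_measurable: "harm_sum A c \<in> borel_measurable surface_measure"
  unfolding harm_sum_def[abs_def] by (intro borel_measurable_sum borel_measurable_times Y_measurable) auto

lemma harm_sum_bounded:
  obtains B where "B \<ge> 0" "\<And>x. \<bar>harm_sum A c x\<bar> \<le> B"
proof -
  define b where "b = (\<lambda>k l. SOME b. \<forall>x. \<bar>Y k l x\<bar> \<le> b)"
  have b: "\<bar>Y k l x\<bar> \<le> b k l" if l: "l \<in> {1..harmonic_dim TYPE('n) k}" for k l x
  proof -
    have "\<exists>b. \<forall>x. \<bar>Y k l x\<bar> \<le> b"
      using spherical_harmonics_bounded[OF Y_harmonic[OF l]] by metis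
    from someI_ex[OF this] show ?thesis by (simp add: b_def)
  qed
  have "\<bar>harm_sum A c x\<bar> \<le> (\<Sum>k\<in>A. \<Sum>l = 1..harmonic_dim TYPE('n) k. \<bar>c k l\<bar> * b k l)" for x
    unfolding harm_sum_def
    by (intro order_trans[OF sum_abs] sum_mono) (auto simp: abs_mult intro!: mult_left_mono b)
  then have "\<bar>harm_sum A c x\<bar> \<le> max 0 (\<Sum>k\<in>A. \<Sum>l = 1..harmonic_dim TYPE('n) k. \<bar>c k l\<bar> * b k l)" for x
    by (rule order_trans) simp
  then show ?thesis by (rule that[rotated]) simp
qed

lemma integrable_mult_harm_sum:
  "integrable surface_measure f \<Longrightarrow> integrable surface_measure (\<lambda>x. f x * harm_sum A c x)"
  using harm_sum_bounded[of A c] integrable_mult_bounded[OF _ harm_sum_measurable] by metis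

lemma harm_sum_integrable: "integrable surface_measure (harm_sum A c)"
  using integrable_mult_harm_sum[of "\<lambda>_. 1" A c] by simp

lemma integral_mult_harm_sum:
  assumes A: "finite A" and f: "integrable surface_measure f"
  shows "(\<integral>x. f x * harm_sum A c x \<partial>surface_measure)
    = (\<Sum>k\<in>A. \<Sum>l = 1..harmonic_dim TYPE('n) k. c k l * harmonic_coeff Y f k l)"
proof -
  have i: "integrable surface_measure (\<lambda>x. c k l * (f x * Y k l x))" if "l \<in> {1..harmonic_dim TYPE('n) k}" for k l
    using integrable_mult_harmonic[OF f Y_harmonic[OF that]] by simp
  have "(\<integral>x. f x * harm_sum A c x \<partial>surface_measure)
      = (\<integral>x. (\<Sum>k\<in>A. \<Sum>l = 1..harmonic_dim TYPE('n) k. c k l * (f x * Y k l x)) \<partial>surface_measure)"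
    by (simp add: harm_sum_def sum_distrib_left mult_ac)
  also have "\<dots> = (\<Sum>k\<in>A. \<integral>x. (\<Sum>l = 1..harmonic_dim TYPE('n) k. c k l * (f x * Y k l x)) \<partial>surface_measure)"
    by (rule Bochner_Integration.integral_sum) (intro Bochner_Integration.integrable_sum i)
  also have "\<dots> = (\<Sum>k\<in>A. \<Sum>l = 1..harmonic_dim TYPE('n) k. \<integral>x. c k l * (f x * Y k l x) \<partial>surface_measure)"
    by (intro sum.cong refl Bochner_Integration.integral_sum i)
  finally show ?thesis by (simp add: harmonic_coeff_def)
qed

lemma harmonic_coeff_harm_sum:
  assumes A: "finite A" and l: "l \<in> {1..harmonic_dim TYPE('n) k}"
  shows "harmonic_coeff Y (harm_sum A c) k l = (if k \<in> A then c k l else 0)"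
proof -
  have "harmonic_coeff Y (harm_sum A c) k l = (\<integral>x. Y k l x * harm_sum A c x \<partial>surface_measure)"
    by (simp add: harmonic_coeff_def mult.commute)
  also have "\<dots> = (\<Sum>j\<in>A. \<Sum>m = 1..harmonic_dim TYPE('n) j. c j m * harmonic_coeff Y (Y k l) j m)"
    by (rule integral_mult_harm_sum[OF A harmonic_integrable[OF Y_harmonic[OF l]]])
  also have "\<dots> = (\<Sum>j\<in>A. \<Sum>m = 1..harmonic_dim TYPE('n) j. if j = k then if m = l then c k l else 0 else 0)"
    using l by (intro sum.cong refl) (simp add: harmonic_coeff_def Y_orthonormal_degrees)
  also have "\<dots> = (\<Sum>j\<in>A. if j = k then c k l else 0)"
    using l by (intro sum.cong refl) (auto simp: sum.delta)
  finally show ?thesis using A by simp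
qed

lemma integral_harm_sum_square:
  assumes A: "finite A"
  shows "(\<integral>x. (harm_sum A c x)\<^sup>2 \<partial>surface_measure) = coeff_sq TYPE('n) A c"
proof -
  have "(\<integral>x. (harm_sum A c x)\<^sup>2 \<partial>surface_measure)
     = (\<Sum>k\<in>A. \<Sum>l = 1..harmonic_dim TYPE('n) k. c k l * harmonic_coeff Y (harm_sum A c) k l)"
    using integral_mult_harm_sum[OF A harm_sum_integrable[of A c], of c] by (simp add: power2_eq_square)
  then show ?thesis
    by (simp add: harmonic_coeff_harm_sum[OF A] coeff_sq_def power2_eq_square)
qed

text \<open>
  Averaging over caps of radius about \<open>1/m\<close> inverts boundedly on harmonics of degree at most
  \<open>m\<close>, so the values of such a function are controlled by its mean square near each node, and
  the cap estimate bounds the mass of the nodes near each point.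
\<close>

lemma marcinkiewicz_zygmund:
  assumes s: "s \<ge> 1" and quad: "positive_quadrature s N w p" and sm: "s \<le> m"
    and A: "A \<subseteq> {..m}"
  shows "(\<Sum>i = 1..N. w i * (harm_sum A c (p i))\<^sup>2)
    \<le> quad_const TYPE('n) * (real m / real s) ^ (CARD('n) - 1) * coeff_sq TYPE('n) A c"
proof -
  have finA: "finite A" using A finite_subset by blast
  have m1: "m \<ge> 1" using s sm by simp
  \<comment> \<open>On the cap 1 - t \<le> u and for k \<le> m, \<open>poly_P_lower\<close> gives P
    \<ge> 1 - 2 m^2 u = 1/2. Since u \<le> 1/4, the cap lies in t \<ge> 1/2, where that bound is
    available.\<close>
  define u where "u = 1 / (4 * (real m)\<^sup>2)"
  have u: "0 < u" using m1 by (simp add: u_def)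
  have "u \<le> 1 / (4 * 1)" unfolding u_def using m1 by (intro divide_left_mono mult_left_mono) auto
  then have u4: "u \<le> 1/4" by simp
  define \<psi> :: "real \<Rightarrow> real" where "\<psi> = indicator {1 - u..}"
  have \<psi>m [measurable]: "\<psi> \<in> borel_measurable borel" by (simp add: \<psi>_def)
  have \<psi>b: "\<bar>\<psi> t\<bar> \<le> 1" "\<psi> t \<ge> 0" for t by (auto simp: \<psi>_def indicator_def)
  have \<psi>zm [measurable]: "(\<lambda>z. \<psi> (x \<bullet> z)) \<in> borel_measurable surface_measure" for x :: "real^'n"
    by (intro borel_measurable_surface) measurable
  have \<psi>i: "integrable surface_measure (\<lambda>z. \<psi> (x \<bullet> z))" for x :: "real^'n"
    by (intro integrable_surface_bounded[OF \<psi>zm]) (rule \<psi>b)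
  obtain i0 :: 'n where True by simp
  define e where "e = (axis i0 1 :: real^'n)"
  have e: "e \<in> sphere 0 1" by (simp add: e_def)
  define v where "v = (\<integral>z. \<psi> (e \<bullet> z) \<partial>surface_measure)"
  have vx: "(\<integral>z. \<psi> (x \<bullet> z) \<partial>surface_measure) = v" if "x \<in> sphere 0 1" for x :: "real^'n"
    unfolding v_def by (rule zonal_integral_invariant[OF \<psi>m that e])
  have vlow: "v \<ge> 1 / (4 * (8 * real CARD('n)) ^ (CARD('n) - 1) * real m ^ (CARD('n) - 1))"
  proof -
    let ?C = "{x \<in> sphere 0 1. x \<bullet> e \<ge> 1 - u}"
    have "v = (\<integral>z. indicator ?C z \<partial>surface_measure)"
      unfolding v_def by (rule integral_surface_cong) (auto simp: \<psi>_def indicator_def inner_commute)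
    also have "\<dots> = measure surface_measure (?C \<inter> space surface_measure)"
      by (rule Bochner_Integration.integral_indicator)
    also have "?C \<inter> space surface_measure = ?C" by auto
    finally have "v \<ge> (1/4) * (sqrt u / (4 * real CARD('n))) ^ (CARD('n) - 1)"
      using measure_cap_lower[of e u] e u u4 by simp
    also have "sqrt u = 1 / (2 * real m)"
      using m1 by (simp add: u_def real_sqrt_divide real_sqrt_mult)
    also have "(1/4) * (1 / (2 * real m) / (4 * real CARD('n))) ^ (CARD('n) - 1)
      = 1 / (4 * (8 * real CARD('n)) ^ (CARD('n) - 1) * real m ^ (CARD('n) - 1))"
    proof -
      have "1 / (2 * real m) / (4 * real CARD('n)) = 1 / (8 * real CARD('n) * real m)" by simp
      then show ?thesis by (simp only: power_divide power_mult_distrib power_one)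
    qed
    finally show ?thesis .
  qed
  moreover have "1 / (4 * (8 * real CARD('n)) ^ (CARD('n) - 1) * real m ^ (CARD('n) - 1)) > 0"
    using m1 by (intro divide_pos_pos mult_pos_pos zero_less_power) auto
  ultimately have v: "v > 0" by linarith
  define \<alpha> where "\<alpha> = (\<lambda>k. \<integral>z. \<psi> (e \<bullet> z) * poly (legendre_poly CARD('n) k) (e \<bullet> z) \<partial>surface_measure)"
  have \<alpha>x: "(\<integral>z. \<psi> (x \<bullet> z) * poly (legendre_poly CARD('n) k) (x \<bullet> z) \<partial>surface_measure) = \<alpha> k"
    if "x \<in> sphere 0 1" for x :: "real^'n" and k
    unfolding \<alpha>_def
    by (rule zonal_integral_invariant[OF _ that e, of "\<lambda>t. \<psi> t * poly (legendre_poly CARD('n) k) t"])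
       (intro borel_measurable_times \<psi>m borel_measurable_continuous_onI continuous_intros)
  have \<alpha>low: "\<alpha> k \<ge> v / 2" if k: "k \<in> A" and d: "harmonic_dim TYPE('n) k > 0" for k
  proof -
    have ez: "e \<bullet> z \<in> {-1..1}" if "z \<in> sphere 0 1" for z
      using Cauchy_Schwarz_ineq2[of e z] e that by (auto simp: abs_le_iff)
    have pm: "(\<lambda>z. poly (legendre_poly CARD('n) k) (e \<bullet> z)) \<in> borel_measurable surface_measure"
      by (intro borel_measurable_surface borel_measurable_continuous_onI continuous_intros)
    have "v / 2 = (\<integral>z. \<psi> (e \<bullet> z) * (1/2) \<partial>surface_measure)" by (simp add: v_def)
    also have "\<dots> \<le> \<alpha> k"
      unfolding \<alpha>_def
    proof (rule integral_mono)
      show "integrable surface_measure (\<lambda>z. \<psi> (e \<bullet> z) * poly (legendre_poly CARD('n) k) (e \<bullet> z))"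
      proof (rule integrable_surface_bounded[of _ 1])
        show "(\<lambda>z. \<psi> (e \<bullet> z) * poly (legendre_poly CARD('n) k) (e \<bullet> z)) \<in> borel_measurable surface_measure"
          by (intro borel_measurable_times \<psi>zm pm)
        show "\<bar>\<psi> (e \<bullet> z) * poly (legendre_poly CARD('n) k) (e \<bullet> z)\<bar> \<le> 1" if "z \<in> sphere 0 1" for z
          using \<psi>b[of "e \<bullet> z"] poly_P_le_1[OF d ez[OF that]] by (simp add: abs_mult mult_le_one)
      qed
      fix z :: "real^'n" assume "z \<in> space surface_measure"
      then have z: "z \<in> sphere 0 1" by simp
      show "\<psi> (e \<bullet> z) * (1/2) \<le> \<psi> (e \<bullet> z) * poly (legendre_poly CARD('n) k) (e \<bullet> z)"
      proof (cases "e \<bullet> z \<ge> 1 - u")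
        case True
        have "1/2 \<le> e \<bullet> z" using True u4 by simp
        then have "poly (legendre_poly CARD('n) k) (e \<bullet> z) \<ge> 1 - 2 * (real k)\<^sup>2 * (1 - e \<bullet> z)"
          using poly_P_lower[OF d] ez[OF z] by simp
        moreover have "2 * (real k)\<^sup>2 * (1 - e \<bullet> z) \<le> 2 * (real m)\<^sup>2 * u"
          using True ez[OF z] k A by (intro mult_mono power_mono) auto
        moreover have "2 * (real m)\<^sup>2 * u = 1/2" using m1 by (simp add: u_def)
        ultimately have "1/2 \<le> poly (legendre_poly CARD('n) k) (e \<bullet> z)" by linarith
        then show ?thesis using \<psi>b by (intro mult_left_mono) auto
      qed (simp add: \<psi>_def)
    qed (use \<psi>i in simp)
    finally show ?thesis .
  qed
  \<comment> \<open>Deconvolution: averaging multiplies degree k by \<open>\<alpha> k\<close>, so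
    dividing the coefficients first recovers \<open>harm_sum A c\<close> as the average of
    g.\<close>
  define g where "g = harm_sum A (\<lambda>k l. c k l / \<alpha> k)"
  have g2i: "integrable surface_measure (\<lambda>z. (g z)\<^sup>2)"
    using integrable_mult_harm_sum[OF harm_sum_integrable] by (simp add: g_def power2_eq_square)
  have \<psi>gg: "integrable surface_measure (\<lambda>z. \<psi> (x \<bullet> z) * (g z)\<^sup>2)" for x :: "real^'n"
    using integrable_mult_bounded[OF g2i \<psi>zm[of x] \<psi>b(1)] by (simp add: mult.commute)
  have conv: "harm_sum A c x = (\<integral>z. \<psi> (x \<bullet> z) * g z \<partial>surface_measure)" if x: "x \<in> sphere 0 1" for x
  proof -
    have "(\<integral>z. \<psi> (x \<bullet> z) * g z \<partial>surface_measure)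
      = (\<Sum>k\<in>A. \<Sum>l = 1..harmonic_dim TYPE('n) k. c k l / \<alpha> k * harmonic_coeff Y (\<lambda>z. \<psi> (x \<bullet> z)) k l)"
      unfolding g_def by (rule integral_mult_harm_sum[OF finA \<psi>i])
    also have "\<dots> = (\<Sum>k\<in>A. \<Sum>l = 1..harmonic_dim TYPE('n) k. c k l * Y k l x)"
    proof (intro sum.cong refl)
      fix k l assume kl: "k \<in> A" "l \<in> {1..harmonic_dim TYPE('n) k}"
      then have "\<alpha> k > 0" using \<alpha>low[of k] v by fastforce
      moreover have "harmonic_coeff Y (\<lambda>z. \<psi> (x \<bullet> z)) k l = \<alpha> k * Y k l x"
        unfolding harmonic_coeff_def using funk_hecke[OF \<psi>m \<psi>b(1) x kl(2)] \<alpha>x[OF x] by simp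
      ultimately show "c k l / \<alpha> k * harmonic_coeff Y (\<lambda>z. \<psi> (x \<bullet> z)) k l = c k l * Y k l x" by simp
    qed
    finally show ?thesis by (simp add: harm_sum_def)
  qed
  have w: "w i \<ge> 0" "p i \<in> sphere 0 1" if "i \<in> {1..N}" for i
    using quad that by (auto simp: positive_quadrature_def)
  have sq: "(harm_sum A c x)\<^sup>2 \<le> v * (\<integral>z. \<psi> (x \<bullet> z) * (g z)\<^sup>2 \<partial>surface_measure)" if x: "x \<in> sphere 0 1" for x
  proof -
    have "integrable surface_measure (\<lambda>z. \<psi> (x \<bullet> z) * g z)"
      unfolding g_def by (rule integrable_mult_harm_sum[OF \<psi>i])
    from integral_square_weighted[OF \<psi>i this \<psi>gg \<psi>b(2)] show ?thesis
      using v by (simp add: conv[OF x] vx[OF x])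
  qed
  define K where "K = cap_const TYPE('n) / real s ^ (CARD('n) - 1)"
  have capb: "(\<Sum>i = 1..N. w i * \<psi> (p i \<bullet> z)) \<le> K" if z: "z \<in> sphere 0 1" for z
  proof -
    \<comment> \<open>As s \<le> m, the averaging cap lies inside the larger cap whose mass a rule
      of degree s controls.\<close>
    have "1 - 1 / (4 * (real s)\<^sup>2) \<le> 1 - u"
      using s sm by (simp add: u_def) (intro divide_left_mono mult_left_mono power_mono, auto)
    then have "\<psi> t \<le> indicator {1 - 1 / (4 * (real s)\<^sup>2)..} t" for t
      by (auto simp: \<psi>_def indicator_def)
    then have "(\<Sum>i = 1..N. w i * \<psi> (p i \<bullet> z)) \<le> (\<Sum>i = 1..N. w i * indicator {1 - 1 / (4 * (real s)\<^sup>2)..} (p i \<bullet> z))"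
      using w(1) by (intro sum_mono mult_left_mono) auto
    also have "\<dots> \<le> K" unfolding K_def by (rule quadrature_cap[OF n2 s quad z])
    finally show ?thesis .
  qed
  have K0: "K \<ge> 0"
  proof -
    have "0 \<le> (\<Sum>i = 1..N. w i * \<psi> (p i \<bullet> e))"
      by (intro sum_nonneg mult_nonneg_nonneg w(1) \<psi>b(2))
    then show ?thesis using capb[OF e] by linarith
  qed
  have "(\<Sum>i = 1..N. w i * (harm_sum A c (p i))\<^sup>2)
      \<le> (\<Sum>i = 1..N. w i * (v * (\<integral>z. \<psi> (p i \<bullet> z) * (g z)\<^sup>2 \<partial>surface_measure)))"
    using w sq by (intro sum_mono mult_left_mono) auto
  also have "\<dots> = v * (\<integral>z. (\<Sum>i = 1..N. w i * \<psi> (p i \<bullet> z)) * (g z)\<^sup>2 \<partial>surface_measure)"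
    using \<psi>gg by (simp add: sum_distrib_right sum_distrib_left mult.assoc mult.left_commute)
  also have "\<dots> \<le> v * (\<integral>z. K * (g z)\<^sup>2 \<partial>surface_measure)"
  proof (intro mult_left_mono integral_mono)
    show "integrable surface_measure (\<lambda>z. (\<Sum>i = 1..N. w i * \<psi> (p i \<bullet> z)) * (g z)\<^sup>2)"
      using \<psi>gg by (simp add: sum_distrib_right mult.assoc)
  qed (use g2i capb v in \<open>auto intro!: mult_right_mono\<close>)
  also have "\<dots> = v * K * coeff_sq TYPE('n) A (\<lambda>k l. c k l / \<alpha> k)"
    using integral_harm_sum_square[OF finA, of "\<lambda>k l. c k l / \<alpha> k"] by (simp add: g_def)
  also have "\<dots> \<le> v * K * (4 / v\<^sup>2 * coeff_sq TYPE('n) A c)"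
  proof (intro mult_left_mono)
    show "coeff_sq TYPE('n) A (\<lambda>k l. c k l / \<alpha> k) \<le> 4 / v\<^sup>2 * coeff_sq TYPE('n) A c"
      unfolding coeff_sq_def sum_distrib_left
    proof (intro sum_mono)
      fix k l assume kl: "k \<in> A" "l \<in> {1..harmonic_dim TYPE('n) k}"
      then have a: "\<alpha> k \<ge> v / 2" using \<alpha>low[of k] by fastforce
      have "(c k l / \<alpha> k)\<^sup>2 = (c k l)\<^sup>2 / (\<alpha> k)\<^sup>2" by (simp add: power_divide)
      also have "\<dots> \<le> (c k l)\<^sup>2 / (v / 2)\<^sup>2"
        using a v by (intro divide_left_mono power_mono mult_pos_pos zero_less_power) auto
      also have "\<dots> = 4 / v\<^sup>2 * (c k l)\<^sup>2" by (simp add: power_divide)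
      finally show "(c k l / \<alpha> k)\<^sup>2 \<le> 4 / v\<^sup>2 * (c k l)\<^sup>2" .
    qed
  qed (use v K0 in auto)
  \<comment> \<open>Cauchy-Schwarz contributed v and the eigenvalues 4/v^2. The remaining 1/v is of
    order m^(n-1) by \<open>vlow\<close>, against K of order s^(1-n).\<close>
  also have "\<dots> = 4 * K * coeff_sq TYPE('n) A c * (1 / v)" using v by (simp add: power2_eq_square)
  also have "\<dots> \<le> 4 * K * coeff_sq TYPE('n) A c * (4 * (8 * real CARD('n)) ^ (CARD('n) - 1) * real m ^ (CARD('n) - 1))"
  proof (intro mult_left_mono)
    have "4 * (8 * real CARD('n)) ^ (CARD('n) - 1) * real m ^ (CARD('n) - 1) > 0"
      using m1 by (intro mult_pos_pos zero_less_power) auto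
    then show "1 / v \<le> 4 * (8 * real CARD('n)) ^ (CARD('n) - 1) * real m ^ (CARD('n) - 1)"
      using vlow v by (simp add: divide_le_eq mult.commute)
  qed (use K0 in \<open>simp add: coeff_sq_nonneg\<close>)
  also have "\<dots> = quad_const TYPE('n) * (real m / real s) ^ (CARD('n) - 1) * coeff_sq TYPE('n) A c"
    by (simp add: quad_const_def K_def power_divide)
  finally show ?thesis .
qed

end

section \<open>Quadrature error in the native space\<close>

text \<open>The sum of a geometric series over dyadic blocks; its ratio 2^(d/2 - gamma) is below 1
  because gamma > d/2. The factor 2^gamma pays for a block reaching down to half its top
  degree.\<close>

definition tail_const :: "'n::finite itself \<Rightarrow> real \<Rightarrow> real \<Rightarrow> real" where
  "tail_const T \<gamma> C = sqrt (quad_const T * C) * 2 powr \<gamma> / (1 - 2 powr (real (CARD('n) - 1) / 2 - \<gamma>))"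

text \<open>The summands belong to the tail of f against the low test part, to f against the high
  test part, and to the exact integral of the high parts.\<close>

definition error_const :: "'n::finite itself \<Rightarrow> real \<Rightarrow> real \<Rightarrow> real \<Rightarrow> real" where
  "error_const T \<gamma> C M = sqrt M * tail_const T \<gamma> C + (sqrt M + tail_const T \<gamma> C) * tail_const T \<gamma> C + C * 4 powr \<gamma>"

lemma quad_const_nonneg: "CARD('n::finite) \<ge> 2 \<Longrightarrow> quad_const TYPE('n) \<ge> 0"
  using peak_const_nonneg[of "CARD('n)"] weight_integral_1_pos[of "CARD('n)"] sphere_volume_pos[where 'n = 'n]
  by (simp add: quad_const_def cap_const_def)

lemma coeff_sq_inner:
  assumes "finite A"
  shows "\<bar>\<Sum>k\<in>A. \<Sum>l = 1..harmonic_dim T k. b k l * c k l\<bar> \<le> sqrt (coeff_sq T A b) * sqrt (coeff_sq T A c)"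
proof -
  let ?J = "Sigma A (\<lambda>k. {1..harmonic_dim T k})"
  have s: "(\<Sum>k\<in>A. \<Sum>l = 1..harmonic_dim T k. h k l) = (\<Sum>x\<in>?J. h (fst x) (snd x))" for h :: "nat \<Rightarrow> nat \<Rightarrow> real"
    using assms by (subst sum.Sigma) (auto simp: case_prod_unfold)
  have "(\<Sum>x\<in>?J. b (fst x) (snd x) * c (fst x) (snd x))\<^sup>2 \<le> coeff_sq T A b * coeff_sq T A c"
    unfolding coeff_sq_def s by (rule Cauchy_Schwarz_ineq_sum)
  then have "sqrt ((\<Sum>x\<in>?J. b (fst x) (snd x) * c (fst x) (snd x))\<^sup>2) \<le> sqrt (coeff_sq T A b * coeff_sq T A c)"
    by (rule real_sqrt_le_mono)
  then show ?thesis unfolding s by (simp add: real_sqrt_mult)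
qed

text \<open>The L2 seminorm of the values at the nodes, written with \<open>L2_set\<close> so that
  the triangle and Cauchy-Schwarz inequalities are those of Euclidean space.\<close>

definition quad_norm :: "nat \<Rightarrow> (nat \<Rightarrow> real) \<Rightarrow> (nat \<Rightarrow> 'a) \<Rightarrow> ('a \<Rightarrow> real) \<Rightarrow> real" where
  "quad_norm N w p h = L2_set (\<lambda>i. sqrt (w i) * h (p i)) {1..N}"

lemma quad_norm_nonneg: "quad_norm N w p h \<ge> 0"
  by (simp add: quad_norm_def)

lemma quad_norm_eq:
  "(\<And>i. i \<in> {1..N} \<Longrightarrow> w i \<ge> 0) \<Longrightarrow> quad_norm N w p h = sqrt (\<Sum>i = 1..N. w i * (h (p i))\<^sup>2)"
  unfolding quad_norm_def L2_set_def by (simp add: power_mult_distrib)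

lemma quad_norm_add_le: "quad_norm N w p (\<lambda>x. g x + h x) \<le> quad_norm N w p g + quad_norm N w p h"
  unfolding quad_norm_def distrib_left by (rule L2_set_triangle_ineq)

lemma quad_norm_sum_le: "quad_norm N w p (\<lambda>x. \<Sum>j\<in>J. h j x) \<le> (\<Sum>j\<in>J. quad_norm N w p (h j))"
proof (induction J rule: infinite_finite_induct)
  case (insert j J)
  then show ?case using quad_norm_add_le[of N w p "h j" "\<lambda>x. \<Sum>j\<in>J. h j x"] by simp
qed (simp_all add: quad_norm_def L2_set_def)

lemma quad_norm_mult:
  assumes w: "\<And>i. i \<in> {1..N} \<Longrightarrow> w i \<ge> 0"
  shows "\<bar>\<Sum>i = 1..N. w i * (g (p i) * h (p i))\<bar> \<le> quad_norm N w p g * quad_norm N w p h"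
proof -
  have "\<bar>\<Sum>i = 1..N. w i * (g (p i) * h (p i))\<bar> \<le> (\<Sum>i = 1..N. \<bar>sqrt (w i) * g (p i)\<bar> * \<bar>sqrt (w i) * h (p i)\<bar>)"
  proof (intro order_trans[OF sum_abs] sum_mono)
    fix i assume i: "i \<in> {1..N}"
    have q: "sqrt (w i) * sqrt (w i) = w i" using w[OF i] by simp
    have "(sqrt (w i) * g (p i)) * (sqrt (w i) * h (p i)) = (sqrt (w i) * sqrt (w i)) * (g (p i) * h (p i))"
      by (simp only: mult_ac)
    then show "\<bar>w i * (g (p i) * h (p i))\<bar> \<le> \<bar>sqrt (w i) * g (p i)\<bar> * \<bar>sqrt (w i) * h (p i)\<bar>"
      by (simp only: q abs_mult[symmetric] order_refl)
  qed
  also have "\<dots> \<le> quad_norm N w p g * quad_norm N w p h"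
    unfolding quad_norm_def by (rule L2_set_mult_ineq)
  finally show ?thesis .
qed

lemma quad_norm_tendsto:
  assumes "\<And>i. i \<in> {1..N} \<Longrightarrow> (\<lambda>n. h n (p i)) \<longlonglongrightarrow> g (p i)"
  shows "(\<lambda>n. quad_norm N w p (h n)) \<longlonglongrightarrow> quad_norm N w p g"
  unfolding quad_norm_def L2_set_def using assms by (intro tendsto_intros) auto

text \<open>\<open>M\<close> stands beside \<open>C\<close> for degree 0: the decay bound cannot
  extend to k = 0, where \<open>real k powr (-2 * \<gamma>)\<close> is 0.\<close>

locale decaying_basis = harmonic_basis Y for Y :: "nat \<Rightarrow> nat \<Rightarrow> real^'n::finite \<Rightarrow> real" +
  fixes ph :: "nat \<Rightarrow> real" and \<gamma> C M :: real
  assumes ph_pos: "\<And>k. ph k > 0" and C_pos: "C > 0"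
    and ph_decay: "\<And>k. k \<ge> 1 \<Longrightarrow> ph k \<le> C * real k powr (-2 * \<gamma>)"
    and ph_le_M: "\<And>k. ph k \<le> M" and \<gamma>_gt: "\<gamma> > real (CARD('n) - 1) / 2"
begin

definition weighted_sq :: "nat set \<Rightarrow> (nat \<Rightarrow> nat \<Rightarrow> real) \<Rightarrow> real" where
  "weighted_sq A c = (\<Sum>k\<in>A. inverse (ph k) * (\<Sum>l = 1..harmonic_dim TYPE('n) k. (c k l)\<^sup>2))"

lemma weighted_term_nonneg: "inverse (ph k) * (\<Sum>l = 1..harmonic_dim TYPE('n) k. (c k l)\<^sup>2) \<ge> 0"
  using ph_pos[of k] by (intro mult_nonneg_nonneg sum_nonneg) auto

lemma weighted_sq_nonneg: "weighted_sq A c \<ge> 0"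
  unfolding weighted_sq_def by (intro sum_nonneg weighted_term_nonneg)

lemma weighted_sq_mono: "A \<subseteq> B \<Longrightarrow> finite B \<Longrightarrow> weighted_sq A c \<le> weighted_sq B c"
  unfolding weighted_sq_def by (intro sum_mono2 weighted_term_nonneg)

lemma coeff_sq_le_weighted:
  assumes "\<And>k. k \<in> A \<Longrightarrow> ph k \<le> B"
  shows "coeff_sq TYPE('n) A c \<le> B * weighted_sq A c"
  unfolding coeff_sq_def weighted_sq_def sum_distrib_left[of B]
proof (rule sum_mono)
  fix k assume k: "k \<in> A"
  let ?a = "\<Sum>l = 1..harmonic_dim TYPE('n) k. (c k l)\<^sup>2"
  have a: "?a \<ge> 0" by (intro sum_nonneg) auto
  have "1 * ?a \<le> (B * inverse (ph k)) * ?a"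
    using assms[OF k] ph_pos[of k] a by (intro mult_right_mono) (auto simp: field_simps)
  then show "?a \<le> B * (inverse (ph k) * ?a)" by (simp add: mult.assoc)
qed

lemma M_pos: "M > 0" using ph_le_M[of 0] ph_pos[of 0] by linarith

lemma \<gamma>_pos: "\<gamma> > 0" using \<gamma>_gt by (meson divide_nonneg_nonneg le_less_trans of_nat_0_le_iff zero_le_numeral)

lemma ph_tail:
  assumes "a > 0" "a \<le> real k"
  shows "ph k \<le> C * a powr (-2 * \<gamma>)"
proof -
  have "k \<ge> 1" using assms by (cases k) auto
  then have "ph k \<le> C * real k powr (-2 * \<gamma>)" by (rule ph_decay)
  also have "\<dots> \<le> C * a powr (-2 * \<gamma>)"
    using assms C_pos \<gamma>_pos by (intro mult_left_mono powr_mono2') auto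
  finally show ?thesis .
qed

definition \<rho> :: real where "\<rho> = 2 powr (real (CARD('n) - 1) / 2 - \<gamma>)"

lemma \<rho>: "0 < \<rho>" "\<rho> < 1"
proof -
  have "2 powr (real (CARD('n) - 1) / 2 - \<gamma>) < 2 powr (0::real)" using \<gamma>_gt by (intro powr_less_mono) auto
  then show "0 < \<rho>" "\<rho> < 1" by (simp_all add: \<rho>_def)
qed

lemma tail_const_eq: "tail_const TYPE('n) \<gamma> C = sqrt (quad_const TYPE('n) * C) * 2 powr \<gamma> / (1 - \<rho>)"
  by (simp add: tail_const_def \<rho>_def)

lemma tail_const_nonneg: "tail_const TYPE('n) \<gamma> C \<ge> 0"
  unfolding tail_const_eq using \<rho> quad_const_nonneg[OF n2] C_pos
  by (intro divide_nonneg_nonneg mult_nonneg_nonneg) auto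

lemma error_const_nonneg: "error_const TYPE('n) \<gamma> C M \<ge> 0"
  unfolding error_const_def using tail_const_nonneg C_pos M_pos
  by (intro add_nonneg_nonneg mult_nonneg_nonneg) auto

text \<open>With m = 2^j s the degrees lie in (m/2, m]; the doubled inequalities avoid halving an
  odd number. Sampling costs (m/s)^d = 2^(j d) and the decay of \<open>ph\<close> gains (m/2)^(-2
  gamma); together they leave s^(-2 gamma) times the square of \<rho>^j.\<close>

lemma quad_norm_block:
  assumes s: "s \<ge> 1" and quad: "positive_quadrature s N w p"
    and A: "A \<subseteq> {k. 2 ^ j * s < 2 * k \<and> 2 * k \<le> 2 ^ Suc j * s}"
  shows "quad_norm N w p (harm_sum A c)
    \<le> sqrt (quad_const TYPE('n) * C) * 2 powr \<gamma> * real s powr (- \<gamma>) * sqrt (weighted_sq A c) * \<rho> ^ j"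
proof -
  define d where "d = CARD('n) - 1"
  define m where "m = 2 ^ j * s"
  have sm: "s \<le> m" by (simp add: m_def)
  have Am: "A \<subseteq> {..m}" using A by (auto simp: m_def)
  have w: "w i \<ge> 0" if "i \<in> {1..N}" for i using quad that by (auto simp: positive_quadrature_def)
  have m0: "real m > 0" using s by (simp add: m_def)
  have "coeff_sq TYPE('n) A c \<le> (C * (real m / 2) powr (-2 * \<gamma>)) * weighted_sq A c"
  proof (rule coeff_sq_le_weighted)
    fix k assume "k \<in> A"
    then have "m < 2 * k" using A by (auto simp: m_def)
    then have "real m < 2 * real k" by (metis of_nat_less_iff of_nat_mult of_nat_numeral)
    then show "ph k \<le> C * (real m / 2) powr (-2 * \<gamma>)" using m0 by (intro ph_tail) auto
  qed
  then have "quad_const TYPE('n) * (real m / real s) ^ d * coeff_sq TYPE('n) A c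
     \<le> quad_const TYPE('n) * (real m / real s) ^ d * ((C * (real m / 2) powr (-2 * \<gamma>)) * weighted_sq A c)"
    using quad_const_nonneg[OF n2] m0 s by (intro mult_left_mono) auto
  moreover have "(\<Sum>i = 1..N. w i * (harm_sum A c (p i))\<^sup>2)
      \<le> quad_const TYPE('n) * (real m / real s) ^ d * coeff_sq TYPE('n) A c"
    unfolding d_def by (rule marcinkiewicz_zygmund[OF s quad sm Am])
  ultimately have "(\<Sum>i = 1..N. w i * (harm_sum A c (p i))\<^sup>2)
      \<le> quad_const TYPE('n) * (real m / real s) ^ d * ((C * (real m / 2) powr (-2 * \<gamma>)) * weighted_sq A c)"
    by linarith
  also have "\<dots> = (quad_const TYPE('n) * C) * (2 powr \<gamma>)\<^sup>2 * (real s powr (- \<gamma>))\<^sup>2 * weighted_sq A c * (\<rho> ^ j)\<^sup>2"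
  proof -
    have ms: "real m / real s = 2 powr real j" using s by (simp add: m_def powr_realpow)
    have "(real m / 2) powr (-2 * \<gamma>) = (2 powr real j * real s / 2) powr (-2 * \<gamma>)"
      using s by (simp add: m_def powr_realpow)
    also have "2 powr real j * real s / 2 = 2 powr (real j - 1) * real s"
      by (simp add: powr_diff)
    also have "(2 powr (real j - 1) * real s) powr (-2 * \<gamma>) = 2 powr ((real j - 1) * (-2 * \<gamma>)) * real s powr (-2 * \<gamma>)"
      by (simp add: powr_mult powr_powr)
    also have "real s powr (-2 * \<gamma>) = (real s powr (- \<gamma>))\<^sup>2"
      by (simp add: power2_eq_square powr_add[symmetric])
    finally have e1: "(real m / 2) powr (-2 * \<gamma>) = 2 powr ((real j - 1) * (-2 * \<gamma>)) * (real s powr (- \<gamma>))\<^sup>2" .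
    have e2: "(2 powr real j) ^ d = 2 powr (real j * real d)"
      by (simp add: powr_realpow[symmetric] powr_powr)
    have e3: "(\<rho> ^ j)\<^sup>2 = 2 powr ((real d / 2 - \<gamma>) * real j * 2)"
      by (simp add: \<rho>_def d_def powr_realpow[symmetric] powr_powr power_mult[symmetric])
    have e4: "(2 powr \<gamma>)\<^sup>2 = 2 powr (2 * \<gamma>)" by (simp add: power2_eq_square powr_add[symmetric])
    have "2 powr (real j * real d) * 2 powr ((real j - 1) * (-2 * \<gamma>)) = 2 powr (2 * \<gamma>) * 2 powr ((real d / 2 - \<gamma>) * real j * 2)"
      unfolding powr_add[symmetric] by (rule arg_cong[where f = "\<lambda>x. 2 powr x"]) (simp add: algebra_simps)
    then show ?thesis unfolding ms e1 e2 e3 e4 by (simp add: mult_ac)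
  qed
  finally have "sqrt (\<Sum>i = 1..N. w i * (harm_sum A c (p i))\<^sup>2)
     \<le> sqrt ((quad_const TYPE('n) * C) * (2 powr \<gamma>)\<^sup>2 * (real s powr (- \<gamma>))\<^sup>2 * weighted_sq A c * (\<rho> ^ j)\<^sup>2)"
    by (rule real_sqrt_le_mono)
  also have "\<dots> = sqrt (quad_const TYPE('n) * C) * 2 powr \<gamma> * real s powr (- \<gamma>) * sqrt (weighted_sq A c) * \<rho> ^ j"
    using \<rho> by (simp add: real_sqrt_mult)
  also have "sqrt (\<Sum>i = 1..N. w i * (harm_sum A c (p i))\<^sup>2) = quad_norm N w p (harm_sum A c)"
    by (rule quad_norm_eq[symmetric]) (rule w)
  finally show ?thesis .
qed

lemma harm_sum_union:
  "finite A \<Longrightarrow> finite B \<Longrightarrow> A \<inter> B = {} \<Longrightarrow> harm_sum (A \<union> B) c x = harm_sum A c x + harm_sum B c x"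
  unfolding harm_sum_def by (rule sum.union_disjoint)

text \<open>Split into dyadic blocks and sum the geometric series of the block bounds. A is finite,
  but the constant does not depend on its size, so the bound survives the passage to infinite
  tails.\<close>

lemma quad_norm_tail:
  assumes s: "s \<ge> 1" and quad: "positive_quadrature s N w p" and A: "finite A" "A \<subseteq> {k. s < 2 * k}"
  shows "quad_norm N w p (harm_sum A c) \<le> tail_const TYPE('n) \<gamma> C * real s powr (- \<gamma>) * sqrt (weighted_sq A c)"
proof -
  define B where "B = (\<lambda>j. {k. 2 ^ j * s < 2 * k \<and> 2 * k \<le> 2 ^ Suc j * s})"
  define K where "K = sqrt (quad_const TYPE('n) * C) * 2 powr \<gamma> * real s powr (- \<gamma>) * sqrt (weighted_sq A c)"
  have K: "K \<ge> 0" unfolding K_def using quad_const_nonneg[OF n2] C_pos weighted_sq_nonneg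
    by (intro mult_nonneg_nonneg) auto
  obtain J where J: "\<And>k. k \<in> A \<Longrightarrow> k < J" using finite_nat_set_iff_bounded[of A] A(1) by blast
  have split: "harm_sum {k \<in> A. 2 * k \<le> 2 ^ J * s} c x = (\<Sum>j<J. harm_sum (A \<inter> B j) c x)" for J x
  proof (induction J)
    case 0
    have "{k \<in> A. 2 * k \<le> 2 ^ 0 * s} = {}" using A(2) by auto
    then show ?case by (simp only: harm_sum_def) simp
  next
    case (Suc J)
    have "{k \<in> A. 2 * k \<le> 2 ^ Suc J * s} = {k \<in> A. 2 * k \<le> 2 ^ J * s} \<union> (A \<inter> B J)"
      by (auto simp: B_def)
    moreover have "harm_sum ({k \<in> A. 2 * k \<le> 2 ^ J * s} \<union> (A \<inter> B J)) c x
      = harm_sum {k \<in> A. 2 * k \<le> 2 ^ J * s} c x + harm_sum (A \<inter> B J) c x"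
      using A(1) by (intro harm_sum_union) (auto simp: B_def)
    ultimately show ?case using Suc by simp
  qed
  \<comment> \<open>J bounds the degrees in A, and k < J < 2^J with s \<ge> 1, so the blocks 0 to J
    cover A.\<close>
  have "2 * k \<le> 2 ^ Suc J * s" if "k \<in> A" for k
  proof -
    have "k \<le> 2 ^ J" using J[OF that] less_exp[of J] by linarith
    then have "2 * k * 1 \<le> 2 ^ Suc J * s" using s by (intro mult_le_mono) auto
    then show ?thesis by simp
  qed
  then have "{k \<in> A. 2 * k \<le> 2 ^ Suc J * s} = A" by auto
  then have "harm_sum A c = (\<lambda>x. \<Sum>j<Suc J. harm_sum (A \<inter> B j) c x)"
    using split[of "Suc J"] by auto
  then have "quad_norm N w p (harm_sum A c) \<le> (\<Sum>j<Suc J. quad_norm N w p (harm_sum (A \<inter> B j) c))"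
    using quad_norm_sum_le by metis
  also have "\<dots> \<le> (\<Sum>j<Suc J. K * \<rho> ^ j)"
  proof (rule sum_mono)
    fix j
    have "quad_norm N w p (harm_sum (A \<inter> B j) c)
      \<le> sqrt (quad_const TYPE('n) * C) * 2 powr \<gamma> * real s powr (- \<gamma>) * sqrt (weighted_sq (A \<inter> B j) c) * \<rho> ^ j"
      by (rule quad_norm_block[OF s quad]) (auto simp: B_def)
    also have "\<dots> \<le> K * \<rho> ^ j"
      unfolding K_def using quad_const_nonneg[OF n2] C_pos \<rho> A(1)
      by (intro mult_right_mono mult_left_mono real_sqrt_le_mono weighted_sq_mono) auto
    finally show "quad_norm N w p (harm_sum (A \<inter> B j) c) \<le> K * \<rho> ^ j" .
  qed
  also have "\<dots> = K * (\<Sum>j<Suc J. \<rho> ^ j)" by (simp only: sum_distrib_left)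
  also have "\<dots> \<le> K * (1 / (1 - \<rho>))"
  proof (rule mult_left_mono[OF _ K])
    have "(\<Sum>j<Suc J. \<rho> ^ j) \<le> (\<Sum>j. \<rho> ^ j)"
      using \<rho> by (intro sum_le_suminf summable_geometric) auto
    then show "(\<Sum>j<Suc J. \<rho> ^ j) \<le> 1 / (1 - \<rho>)" using \<rho> by (simp add: suminf_geometric)
  qed
  also have "\<dots> = tail_const TYPE('n) \<gamma> C * real s powr (- \<gamma>) * sqrt (weighted_sq A c)"
    by (simp add: tail_const_eq K_def)
  finally show ?thesis .
qed

section \<open>Exactness on low degrees and the error coefficients\<close>

lemma quad_mult_harm_sum:
  "(\<Sum>i = 1..N. w i * (f (p i) * harm_sum A c (p i)))
    = (\<Sum>k\<in>A. \<Sum>l = 1..harmonic_dim TYPE('n) k. c k l * (\<Sum>i = 1..N. w i * (f (p i) * Y k l (p i))))"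
proof -
  have "(\<Sum>i = 1..N. w i * (f (p i) * harm_sum A c (p i)))
    = (\<Sum>i = 1..N. \<Sum>k\<in>A. \<Sum>l = 1..harmonic_dim TYPE('n) k. c k l * (w i * (f (p i) * Y k l (p i))))"
    unfolding harm_sum_def sum_distrib_left by (intro sum.cong refl) (simp add: mult_ac)
  also have "\<dots> = (\<Sum>k\<in>A. \<Sum>i = 1..N. \<Sum>l = 1..harmonic_dim TYPE('n) k. c k l * (w i * (f (p i) * Y k l (p i))))"
    by (rule sum.swap)
  also have "\<dots> = (\<Sum>k\<in>A. \<Sum>l = 1..harmonic_dim TYPE('n) k. \<Sum>i = 1..N. c k l * (w i * (f (p i) * Y k l (p i))))"
    by (intro sum.cong refl sum.swap)
  finally show ?thesis by (simp only: sum_distrib_left)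
qed

lemma quad_exact_Y:
  assumes quad: "positive_quadrature s N w p" and "l \<in> {1..harmonic_dim TYPE('n) k}" "m \<in> {1..harmonic_dim TYPE('n) j}"
    and kj: "k + j \<le> s"
  shows "(\<Sum>i = 1..N. w i * (Y k l (p i) * Y j m (p i))) = (\<integral>x. Y k l x * Y j m x \<partial>surface_measure)"
proof -
  obtain a where a: "hpoly k a" "Y k l = on_sphere a"
    using Y_harmonic[OF assms(2)] by (auto elim: spherical_harmonicsE)
  obtain b where b: "hpoly j b" "Y j m = on_sphere b"
    using Y_harmonic[OF assms(3)] by (auto elim: spherical_harmonicsE)
  have "(\<lambda>x. Y k l x * Y j m x) = on_sphere (\<lambda>x. a x * b x)"
    by (auto simp: a b on_sphere_def)
  then have mem: "(\<lambda>x. Y k l x * Y j m x) \<in> spherical_polys s"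
    using hpoly_spherical_polys[OF hpoly_mult[OF a(1) b(1)] kj] by simp
  have "\<forall>P\<in>spherical_polys s. (\<integral>x. P x \<partial>surface_measure) = (\<Sum>i = 1..N. w i * P (p i))"
    using quad by (simp add: positive_quadrature_def)
  from bspec[OF this mem] show ?thesis by (rule sym)
qed

lemma quad_exact_harm_sum:
  assumes quad: "positive_quadrature s N w p" and A: "finite A" "A \<subseteq> {k. 2 * k \<le> s}"
    and B: "finite B" "B \<subseteq> {k. 2 * k \<le> s}"
  shows "(\<Sum>i = 1..N. w i * (harm_sum A c (p i) * harm_sum B b (p i)))
    = (\<integral>x. harm_sum A c x * harm_sum B b x \<partial>surface_measure)"
proof -
  have "(\<Sum>i = 1..N. w i * (harm_sum A c (p i) * Y j m (p i))) = harmonic_coeff Y (harm_sum A c) j m"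
    if j: "j \<in> B" and m: "m \<in> {1..harmonic_dim TYPE('n) j}" for j m
  proof -
    have "(\<Sum>i = 1..N. w i * (harm_sum A c (p i) * Y j m (p i)))
      = (\<Sum>i = 1..N. w i * (Y j m (p i) * harm_sum A c (p i)))" by (simp only: mult.commute)
    also have "\<dots> = (\<Sum>k\<in>A. \<Sum>l = 1..harmonic_dim TYPE('n) k. c k l * (\<Sum>i = 1..N. w i * (Y j m (p i) * Y k l (p i))))"
      by (rule quad_mult_harm_sum)
    also have "\<dots> = (\<Sum>k\<in>A. \<Sum>l = 1..harmonic_dim TYPE('n) k. c k l * harmonic_coeff Y (Y j m) k l)"
    proof (intro sum.cong refl)
      fix k l assume "k \<in> A" "l \<in> {1..harmonic_dim TYPE('n) k}"
      note kl = this
      have "2 * k \<le> s" "2 * j \<le> s" using kl(1) j A(2) B(2) by auto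
      then have "j + k \<le> s" by linarith
      from quad_exact_Y[OF quad m kl(2) this]
      show "c k l * (\<Sum>i = 1..N. w i * (Y j m (p i) * Y k l (p i))) = c k l * harmonic_coeff Y (Y j m) k l"
        by (simp only: harmonic_coeff_def)
    qed
    also have "\<dots> = (\<integral>x. Y j m x * harm_sum A c x \<partial>surface_measure)"
      by (rule integral_mult_harm_sum[OF A(1) harmonic_integrable[OF Y_harmonic[OF m]], symmetric])
    finally show ?thesis by (simp add: harmonic_coeff_def mult.commute)
  qed
  then show ?thesis
    unfolding quad_mult_harm_sum integral_mult_harm_sum[OF B(1) harm_sum_integrable]
    by (intro sum.cong refl) simp
qed

text \<open>Squares of sums of degree at most s/2 are integrated exactly, so the seminorm is the L2
  norm, which \<open>M\<close> compares with the native norm.\<close>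

lemma quad_norm_low:
  assumes quad: "positive_quadrature s N w p" and A: "finite A" "A \<subseteq> {k. 2 * k \<le> s}"
  shows "quad_norm N w p (harm_sum A c) \<le> sqrt M * sqrt (weighted_sq A c)"
proof -
  have w: "w i \<ge> 0" if "i \<in> {1..N}" for i using quad that by (auto simp: positive_quadrature_def)
  have "(\<Sum>i = 1..N. w i * (harm_sum A c (p i))\<^sup>2) = coeff_sq TYPE('n) A c"
    using quad_exact_harm_sum[OF quad A A, of c c] integral_harm_sum_square[OF A(1), of c]
    by (simp add: power2_eq_square)
  also have "\<dots> \<le> M * weighted_sq A c" by (rule coeff_sq_le_weighted) (rule ph_le_M)
  finally have "sqrt (\<Sum>i = 1..N. w i * (harm_sum A c (p i))\<^sup>2) \<le> sqrt (M * weighted_sq A c)"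
    by (rule real_sqrt_le_mono)
  also have "sqrt (\<Sum>i = 1..N. w i * (harm_sum A c (p i))\<^sup>2) = quad_norm N w p (harm_sum A c)"
    by (rule quad_norm_eq[symmetric]) (rule w)
  finally show ?thesis by (simp add: real_sqrt_mult)
qed

text \<open>Multiplied by \<open>ph k\<close>, these are the harmonic coefficients of the empirical
  minus the integral operator applied to f.\<close>

definition quad_error :: "nat \<Rightarrow> (nat \<Rightarrow> real) \<Rightarrow> (nat \<Rightarrow> real^'n) \<Rightarrow> (real^'n \<Rightarrow> real) \<Rightarrow> nat \<Rightarrow> nat \<Rightarrow> real" where
  "quad_error N w p f k l = (\<Sum>i = 1..N. w i * (f (p i) * Y k l (p i))) - harmonic_coeff Y f k l"

text \<open>
  Testing the quadrature error of \<open>f * h\<close> on \<open>h = \<Sum> ph k * e k l * Y k l\<close>, where \<open>e\<close> is the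
  quadrature error, the products of low-degree parts are integrated exactly, and every other
  term contains a high-degree part.
\<close>

lemma quad_error_bound:
  assumes s: "s \<ge> 1" and quad: "positive_quadrature s N w p" and f: "f \<in> native_space Y ph"
  shows "(\<Sum>k<K. ph k * (\<Sum>l = 1..harmonic_dim TYPE('n) k. (quad_error N w p f k l)\<^sup>2))
    \<le> (error_const TYPE('n) \<gamma> C M * real s powr (- \<gamma>) * native_norm Y ph f)\<^sup>2"
proof -
  define c where "c = harmonic_coeff Y f"
  define F where "F = native_norm Y ph f"
  define e where "e = quad_error N w p f"
  \<comment> \<open>The test function is cut off at degree K, hence a finite sum. Its squared native
    norm equals S, the sum to be bounded, by \<open>wS\<close>.\<close>
  define b where "b = (\<lambda>k l. ph k * e k l)"
  define S where "S = (\<Sum>k<K. ph k * (\<Sum>l = 1..harmonic_dim TYPE('n) k. (e k l)\<^sup>2))"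
  define H where "H = sqrt S"
  define r where "r = real s powr (- \<gamma>)"
  define tc where "tc = tail_const TYPE('n) \<gamma> C"
  have tc: "tc \<ge> 0" unfolding tc_def by (rule tail_const_nonneg)
  have r: "r > 0" "r \<le> 1"
  proof -
    show "r > 0" using s by (simp add: r_def)
    have "r \<le> real s powr 0" unfolding r_def using s \<gamma>_pos by (intro powr_mono) auto
    then show "r \<le> 1" using s by simp
  qed
  have w: "w i \<ge> 0" "p i \<in> sphere 0 1" if "i \<in> {1..N}" for i
    using quad that by (auto simp: positive_quadrature_def)
  have S0: "S \<ge> 0" unfolding S_def using ph_pos by (intro sum_nonneg mult_nonneg_nonneg) (auto intro: less_imp_le)
  have wS: "weighted_sq {..<K} b = S"
    unfolding weighted_sq_def S_def
  proof (intro sum.cong refl)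
    fix k
    have "(\<Sum>l = 1..harmonic_dim TYPE('n) k. (b k l)\<^sup>2) = (ph k)\<^sup>2 * (\<Sum>l = 1..harmonic_dim TYPE('n) k. (e k l)\<^sup>2)"
      by (simp only: b_def power_mult_distrib sum_distrib_left)
    then show "inverse (ph k) * (\<Sum>l = 1..harmonic_dim TYPE('n) k. (b k l)\<^sup>2)
        = ph k * (\<Sum>l = 1..harmonic_dim TYPE('n) k. (e k l)\<^sup>2)"
      using ph_pos[of k] by (simp add: power2_eq_square)
  qed
  have summ: "summable (\<lambda>k. inverse (ph k) * (\<Sum>l = 1..harmonic_dim TYPE('n) k. (c k l)\<^sup>2))"
    using f by (simp add: native_space_def c_def)
  note termnn = weighted_term_nonneg[of _ c]
  have F: "F\<^sup>2 = (\<Sum>k. inverse (ph k) * (\<Sum>l = 1..harmonic_dim TYPE('n) k. (c k l)\<^sup>2))" "F \<ge> 0"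
    using suminf_nonneg[OF summ termnn] by (simp_all add: F_def native_norm_def c_def)
  have wF: "sqrt (weighted_sq A c) \<le> F" if "finite A" for A
  proof -
    have "weighted_sq A c \<le> F\<^sup>2"
      unfolding weighted_sq_def F(1) using that termnn by (intro sum_le_suminf[OF summ]) auto
    then have "sqrt (weighted_sq A c) \<le> sqrt (F\<^sup>2)" by (rule real_sqrt_le_mono)
    moreover have "sqrt (F\<^sup>2) = F" using F(2) by simp
    ultimately show ?thesis by (simp only:)
  qed
  have wH: "sqrt (weighted_sq A b) \<le> H" if "A \<subseteq> {..<K}" for A
    unfolding H_def wS[symmetric] using that by (intro real_sqrt_le_mono weighted_sq_mono) auto
  define lo where "lo = {k. 2 * k \<le> s}"
  have lo: "finite lo" "lo \<subseteq> {k. 2 * k \<le> s}"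
    unfolding lo_def by (auto intro: finite_subset[of _ "{..s}"])
  define lK where "lK = {k. k < K \<and> 2 * k \<le> s}"
  define hK where "hK = {k. k < K \<and> s < 2 * k}"
  have lK: "finite lK" "lK \<subseteq> {k. 2 * k \<le> s}" "lK \<subseteq> {..<K}" "lK \<subseteq> lo" by (auto simp: lK_def lo_def)
  have hK: "finite hK" "hK \<subseteq> {k. s < 2 * k}" "hK \<subseteq> {..<K}" by (auto simp: hK_def)
  have Kun: "{..<K} = lK \<union> hK" "lK \<inter> hK = {}" by (auto simp: lK_def hK_def)
  define Pf where "Pf = harm_sum lo c"
  define Rf where "Rf = (\<lambda>x. f x - Pf x)"
  have fconv: "(\<lambda>n. harm_sum {..<n} c x) \<longlonglongrightarrow> f x" if "x \<in> sphere 0 1" for x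
    using f that unfolding native_space_def harm_sum_def c_def sums_def by auto
  \<comment> \<open>The tail of f is an infinite series. At the nodes it is the limit of finite
    tails, because the series of a native function converges at each point of the sphere, so their
    common bound passes to the limit.\<close>
  have qR: "quad_norm N w p Rf \<le> tc * r * F"
  proof (rule LIMSEQ_le_const2)
    let ?A = "\<lambda>n. {k. k < n \<and> s < 2 * k}"
    have "(\<lambda>n. harm_sum (?A n) c x) \<longlonglongrightarrow> Rf x" if "x \<in> sphere 0 1" for x
    proof -
      have "harm_sum {..<n} c x - Pf x = harm_sum (?A n) c x" if "n > s" for n
      proof -
        have "{..<n} = lo \<union> ?A n" using that by (auto simp: lo_def)
        moreover have "harm_sum (lo \<union> ?A n) c x = harm_sum lo c x + harm_sum (?A n) c x"
        proof (rule harm_sum_union[OF lo(1)])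
          show "finite (?A n)" by simp
          show "lo \<inter> ?A n = {}" by (auto simp: lo_def)
        qed
        ultimately have "harm_sum {..<n} c x = harm_sum lo c x + harm_sum (?A n) c x" by (simp only:)
        then show ?thesis by (simp only: Pf_def add_diff_cancel_left')
      qed
      then have "eventually (\<lambda>n. harm_sum {..<n} c x - Pf x = harm_sum (?A n) c x) sequentially"
        using eventually_gt_at_top[of s] by (rule eventually_mono[rotated])
      moreover have "(\<lambda>n. harm_sum {..<n} c x - Pf x) \<longlonglongrightarrow> Rf x"
        unfolding Rf_def by (intro tendsto_intros fconv that)
      ultimately show ?thesis by (rule Lim_transform_eventually[rotated])
    qed
    then show "(\<lambda>n. quad_norm N w p (harm_sum (?A n) c)) \<longlonglongrightarrow> quad_norm N w p Rf"
      using w(2) by (intro quad_norm_tendsto) auto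
    have "quad_norm N w p (harm_sum (?A n) c) \<le> tc * r * F" for n
    proof -
      have "quad_norm N w p (harm_sum (?A n) c) \<le> tc * r * sqrt (weighted_sq (?A n) c)"
        unfolding tc_def r_def by (rule quad_norm_tail[OF s quad]) auto
      also have "\<dots> \<le> tc * r * F" using wF[of "?A n"] tc r by (intro mult_left_mono) auto
      finally show ?thesis .
    qed
    then show "\<exists>N'. \<forall>n\<ge>N'. quad_norm N w p (harm_sum (?A n) c) \<le> tc * r * F" by auto
  qed
  have qP: "quad_norm N w p Pf \<le> sqrt M * F"
    using quad_norm_low[OF quad lo, of c] wF[OF lo(1)] M_pos unfolding Pf_def
    by (meson mult_left_mono order_trans real_sqrt_ge_zero less_imp_le)
  have qf: "quad_norm N w p f \<le> (sqrt M + tc) * F"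
  proof -
    have "quad_norm N w p f \<le> quad_norm N w p Pf + quad_norm N w p Rf"
      using quad_norm_add_le[of N w p Pf Rf] by (simp add: Rf_def)
    also have "\<dots> \<le> sqrt M * F + tc * r * F" using qP qR by linarith
    also have "tc * r * F \<le> tc * 1 * F" using tc r F(2) by (intro mult_right_mono mult_left_mono) auto
    finally show ?thesis by (simp add: algebra_simps)
  qed
  have ql: "quad_norm N w p (harm_sum lK b) \<le> sqrt M * H"
    using quad_norm_low[OF quad lK(1,2), of b] wH[OF lK(3)] M_pos
    by (meson mult_left_mono order_trans real_sqrt_ge_zero less_imp_le)
  have qh: "quad_norm N w p (harm_sum hK b) \<le> tc * r * H"
  proof -
    have "quad_norm N w p (harm_sum hK b) \<le> tc * r * sqrt (weighted_sq hK b)"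
      unfolding tc_def r_def by (rule quad_norm_tail[OF s quad hK(1,2)])
    also have "\<dots> \<le> tc * r * H" using wH[OF hK(3)] tc r by (intro mult_left_mono) auto
    finally show ?thesis .
  qed
  let ?Q = "\<lambda>g h. \<Sum>i = 1..N. w i * (g (p i) * h (p i))"
  let ?I = "\<lambda>A. \<Sum>k\<in>A. \<Sum>l = 1..harmonic_dim TYPE('n) k. b k l * c k l"
  have SE: "S = ?Q f (harm_sum {..<K} b) - ?I {..<K}"
  proof -
    have "?Q f (harm_sum {..<K} b) - ?I {..<K} = (\<Sum>k<K. \<Sum>l = 1..harmonic_dim TYPE('n) k. b k l * e k l)"
      unfolding quad_mult_harm_sum e_def quad_error_def c_def
      by (simp add: sum_subtractf right_diff_distrib)
    also have "\<dots> = S"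
      unfolding S_def b_def by (simp add: sum_distrib_left power2_eq_square mult.assoc)
    finally show ?thesis by simp
  qed
  have "?Q f (harm_sum {..<K} b) = ?Q Rf (harm_sum lK b) + ?Q Pf (harm_sum lK b) + ?Q f (harm_sum hK b)"
    unfolding Kun(1) harm_sum_union[OF lK(1) hK(1) Kun(2)] Rf_def sum.distrib[symmetric]
    by (intro sum.cong refl) (simp add: algebra_simps)
  moreover have "?Q Pf (harm_sum lK b) = ?I lK"
  proof -
    have "?Q Pf (harm_sum lK b) = (\<integral>x. Pf x * harm_sum lK b x \<partial>surface_measure)"
      unfolding Pf_def by (rule quad_exact_harm_sum[OF quad lo lK(1,2)])
    also have "\<dots> = (\<Sum>k\<in>lK. \<Sum>l = 1..harmonic_dim TYPE('n) k. b k l * harmonic_coeff Y Pf k l)"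
      unfolding Pf_def by (rule integral_mult_harm_sum[OF lK(1) harm_sum_integrable])
    also have "\<dots> = ?I lK"
      using lK(4) unfolding Pf_def by (intro sum.cong refl) (auto simp: harmonic_coeff_harm_sum[OF lo(1)])
    finally show ?thesis .
  qed
  moreover have "?I {..<K} = ?I lK + ?I hK"
    unfolding Kun(1) by (rule sum.union_disjoint[OF lK(1) hK(1) Kun(2)])
  \<comment> \<open>The low-low quadrature term equals the low part of the integral and the two
    cancel; each remaining term carries a high part.\<close>
  ultimately have S3: "S = ?Q Rf (harm_sum lK b) + ?Q f (harm_sum hK b) - ?I hK"
    using SE by linarith
  have H0: "H \<ge> 0" by (simp add: H_def S0)
  have b1: "?Q Rf (harm_sum lK b) \<le> (tc * r * F) * (sqrt M * H)"
  proof -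
    have "\<bar>?Q Rf (harm_sum lK b)\<bar> \<le> quad_norm N w p Rf * quad_norm N w p (harm_sum lK b)"
      by (rule quad_norm_mult) (rule w(1))
    also have "\<dots> \<le> (tc * r * F) * (sqrt M * H)"
      using qR ql tc r F(2) by (intro mult_mono) (auto simp: quad_norm_nonneg)
    finally show ?thesis by linarith
  qed
  have b2: "?Q f (harm_sum hK b) \<le> ((sqrt M + tc) * F) * (tc * r * H)"
  proof -
    have "\<bar>?Q f (harm_sum hK b)\<bar> \<le> quad_norm N w p f * quad_norm N w p (harm_sum hK b)"
      by (rule quad_norm_mult) (rule w(1))
    also have "\<dots> \<le> ((sqrt M + tc) * F) * (tc * r * H)"
      using qf qh tc M_pos F(2) by (intro mult_mono) (auto simp: quad_norm_nonneg)
    finally show ?thesis by linarith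
  qed
  \<comment> \<open>Both factors are of high degree, which gives s^(-2 gamma), weakened to
    s^(-gamma) to match the other two terms.\<close>
  have b3: "\<bar>?I hK\<bar> \<le> (C * 4 powr \<gamma> * r) * (H * F)"
  proof -
    define B where "B = C * (real s / 2) powr (-2 * \<gamma>)"
    have B0: "B \<ge> 0" using C_pos by (simp add: B_def)
    have phB: "ph k \<le> B" if "k \<in> hK" for k
    proof -
      have "s < 2 * k" using that by (simp add: hK_def)
      then have "real s < 2 * real k" by (metis of_nat_less_iff of_nat_mult of_nat_numeral)
      then show ?thesis unfolding B_def using s by (intro ph_tail) auto
    qed
    have "\<bar>?I hK\<bar> \<le> sqrt (coeff_sq TYPE('n) hK b) * sqrt (coeff_sq TYPE('n) hK c)"
      by (rule coeff_sq_inner[OF hK(1)])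
    also have "\<dots> \<le> sqrt (B * weighted_sq hK b) * sqrt (B * weighted_sq hK c)"
      using phB by (intro mult_mono real_sqrt_le_mono coeff_sq_le_weighted)
        (auto simp: coeff_sq_nonneg B0 weighted_sq_nonneg)
    also have "\<dots> = B * (sqrt (weighted_sq hK b) * sqrt (weighted_sq hK c))"
      using B0 by (simp add: real_sqrt_mult)
    also have "\<dots> \<le> B * (H * F)"
      using wH[OF hK(3)] wF[OF hK(1)] B0 H0 weighted_sq_nonneg by (intro mult_left_mono mult_mono) auto
    also have "\<dots> \<le> (C * 4 powr \<gamma> * r) * (H * F)"
    proof (intro mult_right_mono)
      have "(real s / 2) powr (-2 * \<gamma>) = real s powr (-2 * \<gamma>) / 2 powr (-2 * \<gamma>)" by (rule powr_divide)
      also have "\<dots> = real s powr (-2 * \<gamma>) * 2 powr (2 * \<gamma>)" by (simp add: powr_minus divide_inverse)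
      also have "2 powr (2 * \<gamma>) = (2 powr 2) powr \<gamma>" by (simp only: powr_powr)
      also have "(2::real) powr 2 = 4" by simp
      finally have "B = C * 4 powr \<gamma> * real s powr (-2 * \<gamma>)" by (simp add: B_def)
      moreover have "real s powr (-2 * \<gamma>) \<le> r"
        unfolding r_def using s \<gamma>_pos by (intro powr_mono) auto
      ultimately show "B \<le> C * 4 powr \<gamma> * r" using C_pos by (simp add: mult_left_mono)
    qed (use H0 F(2) in simp)
    finally show ?thesis .
  qed
  have "S \<le> (tc * r * F) * (sqrt M * H) + ((sqrt M + tc) * F) * (tc * r * H) + (C * 4 powr \<gamma> * r) * (H * F)"
    using S3 b1 b2 b3 by linarith
  also have "\<dots> = (error_const TYPE('n) \<gamma> C M * r * F) * H"
    by (simp add: error_const_def tc_def algebra_simps)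
  \<comment> \<open>S is H^2 and the bound is linear in H, so one factor H cancels below.\<close>
  finally have SH: "H * H \<le> (error_const TYPE('n) \<gamma> C M * r * F) * H" using S0 by (simp add: H_def)
  have "H \<le> error_const TYPE('n) \<gamma> C M * r * F"
  proof (cases "H = 0")
    case True then show ?thesis using error_const_nonneg r F(2) by simp
  next
    case False then show ?thesis using SH H0 by simp
  qed
  then have "H\<^sup>2 \<le> (error_const TYPE('n) \<gamma> C M * r * F)\<^sup>2" using H0 by (intro power_mono)
  then show ?thesis using S0 by (simp add: H_def S_def e_def r_def F_def)
qed

end

section \<open>The operators\<close>

context decaying_basis
begin

text \<open>Domination by a summable sequence, uniform on the sphere, lets the series be integrated
  against a basis function term by term, and only its own coefficient survives. This is how
  coefficients are read off functions given by a series.\<close>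

lemma harmonic_series:
  assumes summ: "summable B"
    and bd: "\<And>k x. x \<in> sphere 0 1 \<Longrightarrow> \<bar>\<Sum>l = 1..harmonic_dim TYPE('n) k. c k l * Y k l x\<bar> \<le> B k"
  defines "G \<equiv> on_sphere (\<lambda>x. \<Sum>k. \<Sum>l = 1..harmonic_dim TYPE('n) k. c k l * Y k l x)"
  shows "l \<in> {1..harmonic_dim TYPE('n) k} \<Longrightarrow> harmonic_coeff Y G k l = c k l"
    and "x \<in> sphere 0 1 \<Longrightarrow> (\<lambda>k. \<Sum>l = 1..harmonic_dim TYPE('n) k. c k l * Y k l x) sums G x"
    and "G \<in> borel_measurable surface_measure"
    and "\<exists>b. \<forall>x. \<bar>G x\<bar> \<le> b"
proof -
  have sx: "summable (\<lambda>k. \<bar>\<Sum>l = 1..harmonic_dim TYPE('n) k. c k l * Y k l x\<bar>)" if "x \<in> sphere 0 1" for x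
    using bd[OF that] by (intro summable_comparison_test'[OF summ, of 0]) auto
  show sums: "(\<lambda>k. \<Sum>l = 1..harmonic_dim TYPE('n) k. c k l * Y k l x) sums G x" if "x \<in> sphere 0 1" for x
    using summable_sums[OF summable_rabs_cancel[OF sx[OF that]]] that by (simp add: G_def on_sphere_def)
  have lim: "(\<lambda>n. harm_sum {..<n} c x) \<longlonglongrightarrow> G x" if "x \<in> sphere 0 1" for x
    using sums[OF that] by (simp add: sums_def harm_sum_def)
  show Gm: "G \<in> borel_measurable surface_measure"
  proof (rule borel_measurable_LIMSEQ_metric)
    show "harm_sum {..<n} c \<in> borel_measurable surface_measure" for n by (rule harm_sum_measurable)
    show "(\<lambda>n. harm_sum {..<n} c x) \<longlonglongrightarrow> G x" if "x \<in> space surface_measure" for x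
      using that by (intro lim) simp
  qed
  have B0: "B k \<ge> 0" for k
  proof -
    obtain i :: 'n where True by simp
    have "axis i 1 \<in> sphere (0::real^'n) 1" by simp
    from bd[OF this, of k] show ?thesis by linarith
  qed
  have hb: "\<bar>harm_sum {..<n} c x\<bar> \<le> suminf B" if "x \<in> sphere 0 1" for n x
  proof -
    have "\<bar>harm_sum {..<n} c x\<bar> \<le> (\<Sum>k<n. B k)"
      unfolding harm_sum_def by (rule order_trans[OF sum_abs sum_mono]) (rule bd[OF that])
    also have "\<dots> \<le> suminf B" using B0 by (intro sum_le_suminf[OF summ]) auto
    finally show ?thesis .
  qed
  have "\<bar>G x\<bar> \<le> suminf B" for x
  proof (cases "x \<in> sphere 0 1")
    case True
    have "(\<lambda>n. \<bar>harm_sum {..<n} c x\<bar>) \<longlonglongrightarrow> \<bar>G x\<bar>" using lim[OF True] by (rule tendsto_rabs)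
    then show ?thesis using hb[OF True] by (intro LIMSEQ_le_const2) auto
  next
    case False then show ?thesis using suminf_nonneg[OF summ B0] by (simp add: G_def on_sphere_def)
  qed
  then show "\<exists>b. \<forall>x. \<bar>G x\<bar> \<le> b" by blast
  show "harmonic_coeff Y G k l = c k l" if l: "l \<in> {1..harmonic_dim TYPE('n) k}" for k l
  proof -
    obtain b where b: "\<And>x. \<bar>Y k l x\<bar> \<le> b" using spherical_harmonics_bounded[OF Y_harmonic[OF l]] by blast
    have "(\<lambda>n. \<integral>x. harm_sum {..<n} c x * Y k l x \<partial>surface_measure) \<longlonglongrightarrow> (\<integral>x. G x * Y k l x \<partial>surface_measure)"
    proof (rule integral_dominated_convergence[where w = "\<lambda>_. suminf B * b"])
      show "(\<lambda>x. G x * Y k l x) \<in> borel_measurable surface_measure"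
        using Gm Y_measurable[OF l] by measurable
      show "(\<lambda>x. harm_sum {..<n} c x * Y k l x) \<in> borel_measurable surface_measure" for n
        using harm_sum_measurable Y_measurable[OF l] by measurable
      show "AE x in surface_measure. (\<lambda>n. harm_sum {..<n} c x * Y k l x) \<longlonglongrightarrow> G x * Y k l x"
        by (intro AE_I2 tendsto_mult lim tendsto_const) simp
      show "AE x in surface_measure. norm (harm_sum {..<n} c x * Y k l x) \<le> suminf B * b" for n
      proof (rule AE_I2)
        fix x :: "real^'n" assume "x \<in> space surface_measure"
        then have x: "x \<in> sphere 0 1" by simp
        have "\<bar>harm_sum {..<n} c x\<bar> * \<bar>Y k l x\<bar> \<le> suminf B * b"
          using hb[OF x, of n] b[of x] suminf_nonneg[OF summ B0] by (intro mult_mono) auto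
        then show "norm (harm_sum {..<n} c x * Y k l x) \<le> suminf B * b" by (simp add: abs_mult)
      qed
    qed simp
    moreover have "eventually (\<lambda>n. (\<integral>x. harm_sum {..<n} c x * Y k l x \<partial>surface_measure) = c k l) sequentially"
      using eventually_gt_at_top[of k]
    proof eventually_elim
      case (elim n)
      then show ?case using harmonic_coeff_harm_sum[OF _ l, of "{..<n}" c] by (simp add: harmonic_coeff_def)
    qed
    ultimately have "(\<lambda>n. c k l) \<longlonglongrightarrow> (\<integral>x. G x * Y k l x \<partial>surface_measure)"
      by (rule Lim_transform_eventually)
    then show ?thesis unfolding harmonic_coeff_def using LIMSEQ_unique tendsto_const by blast
  qed
qed

section \<open>Harmonic expansions of the two operators\<close>

lemma native_space_integrable:
  assumes f: "f \<in> native_space Y ph"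
  shows "integrable surface_measure f"
proof (rule Bochner_Integration.integrable_bound[of _ "\<lambda>x. 1 + (f x)\<^sup>2"])
  show "integrable surface_measure (\<lambda>x. 1 + (f x)\<^sup>2)" using f by (simp add: native_space_def)
  show "f \<in> borel_measurable surface_measure" using f by (simp add: native_space_def)
  show "AE x in surface_measure. norm (f x) \<le> norm (1 + (f x)\<^sup>2)"
  proof (rule AE_I2)
    fix x
    have "0 \<le> (\<bar>f x\<bar> - 1)\<^sup>2 + \<bar>f x\<bar>" by simp
    then have "\<bar>f x\<bar> \<le> 1 + (f x)\<^sup>2" by (simp add: power2_eq_square algebra_simps)
    then show "norm (f x) \<le> norm (1 + (f x)\<^sup>2)" by simp
  qed
qed

lemma kernel_sums:
  assumes pd: "positive_definite_with TYPE('n) \<phi> ph" and x: "x \<in> sphere 0 1" and y: "y \<in> sphere 0 1"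
  shows "(\<lambda>k. ph k * Z k x y) sums \<phi> (x \<bullet> y)"
proof -
  have "x \<bullet> y \<in> {-1..1}" using Cauchy_Schwarz_ineq2[of x y] x y by (auto simp: abs_le_iff)
  then have "(\<lambda>k. ph k * (real (harmonic_dim TYPE('n) k) / sphere_volume TYPE('n)) *
      poly (legendre_poly CARD('n) k) (x \<bullet> y)) sums \<phi> (x \<bullet> y)"
    using pd unfolding positive_definite_with_def by blast
  then show ?thesis by (simp only: addition_formula[OF x y] mult.assoc)
qed

lemma empirical_sums:
  assumes pd: "positive_definite_with TYPE('n) \<phi> ph" and p: "\<And>i. i \<in> {1..N} \<Longrightarrow> p i \<in> sphere 0 1"
    and x: "x \<in> sphere 0 1"
  shows "(\<lambda>k. \<Sum>l = 1..harmonic_dim TYPE('n) k. ph k * (\<Sum>i = 1..N. w i * (f (p i) * Y k l (p i))) * Y k l x)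
    sums empirical_op \<phi> N w p f x"
proof -
  have "(\<lambda>k. \<Sum>i = 1..N. w i * f (p i) * (ph k * Z k (p i) x)) sums (\<Sum>i = 1..N. w i * f (p i) * \<phi> (p i \<bullet> x))"
    by (intro sums_sum sums_mult kernel_sums pd p x)
  moreover have "(\<Sum>i = 1..N. w i * f (p i) * (ph k * Z k (p i) x))
      = (\<Sum>l = 1..harmonic_dim TYPE('n) k. ph k * (\<Sum>i = 1..N. w i * (f (p i) * Y k l (p i))) * Y k l x)" for k
    unfolding sum_distrib_left sum_distrib_right by (subst sum.swap) (simp add: mult_ac)
  ultimately show ?thesis using x by (simp add: empirical_op_def on_sphere_def)
qed

text \<open>Crude, growing with the dimension of degree k; it serves to make the series summable
  once multiplied by \<open>ph k\<close>.\<close>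

lemma empirical_bound:
  assumes p: "\<And>i. i \<in> {1..N} \<Longrightarrow> p i \<in> sphere 0 1" and x: "x \<in> sphere 0 1"
  shows "\<bar>\<Sum>l = 1..harmonic_dim TYPE('n) k. (\<Sum>i = 1..N. w i * (f (p i) * Y k l (p i))) * Y k l x\<bar>
    \<le> real (harmonic_dim TYPE('n) k) / sphere_volume TYPE('n) * (\<Sum>i = 1..N. \<bar>w i * f (p i)\<bar>)"
proof -
  have "(\<Sum>l = 1..harmonic_dim TYPE('n) k. (\<Sum>i = 1..N. w i * (f (p i) * Y k l (p i))) * Y k l x)
     = (\<Sum>i = 1..N. w i * f (p i) * Z k (p i) x)"
    unfolding sum_distrib_left sum_distrib_right by (subst sum.swap) (simp add: mult_ac)
  also have "\<bar>\<dots>\<bar> \<le> (\<Sum>i = 1..N. real (harmonic_dim TYPE('n) k) / sphere_volume TYPE('n) * \<bar>w i * f (p i)\<bar>)"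
  proof (intro order_trans[OF sum_abs] sum_mono)
    fix i assume i: "i \<in> {1..N}"
    have "\<bar>w i * f (p i)\<bar> * \<bar>Z k (p i) x\<bar> \<le> \<bar>w i * f (p i)\<bar> * (real (harmonic_dim TYPE('n) k) / sphere_volume TYPE('n))"
      by (intro mult_left_mono Z_bound p i x) simp
    then show "\<bar>w i * f (p i) * Z k (p i) x\<bar> \<le> real (harmonic_dim TYPE('n) k) / sphere_volume TYPE('n) * \<bar>w i * f (p i)\<bar>"
      by (simp only: abs_mult mult.commute)
  qed
  finally show ?thesis by (simp only: sum_distrib_left)
qed

lemma integral_mult_Z:
  assumes f: "integrable surface_measure f"
  shows "(\<integral>y. f y * Z k x y \<partial>surface_measure) = (\<Sum>l = 1..harmonic_dim TYPE('n) k. harmonic_coeff Y f k l * Y k l x)"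
proof -
  have "(\<integral>y. f y * Z k x y \<partial>surface_measure)
      = (\<integral>y. (\<Sum>l = 1..harmonic_dim TYPE('n) k. (f y * Y k l y) * Y k l x) \<partial>surface_measure)"
    by (simp add: sum_distrib_left mult_ac)
  also have "\<dots> = (\<Sum>l = 1..harmonic_dim TYPE('n) k. \<integral>y. (f y * Y k l y) * Y k l x \<partial>surface_measure)"
    using integrable_mult_harmonic[OF f Y_harmonic] by (intro Bochner_Integration.integral_sum) auto
  finally show ?thesis by (simp add: harmonic_coeff_def)
qed

lemma coeff_bound:
  assumes f: "integrable surface_measure f" and x: "x \<in> sphere 0 1"
  shows "\<bar>\<Sum>l = 1..harmonic_dim TYPE('n) k. harmonic_coeff Y f k l * Y k l x\<bar>
    \<le> real (harmonic_dim TYPE('n) k) / sphere_volume TYPE('n) * (\<integral>y. \<bar>f y\<bar> \<partial>surface_measure)"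
proof -
  have "\<bar>\<integral>y. f y * Z k x y \<partial>surface_measure\<bar>
      \<le> (\<integral>y. real (harmonic_dim TYPE('n) k) / sphere_volume TYPE('n) * \<bar>f y\<bar> \<partial>surface_measure)"
  proof (rule order_trans[OF integral_abs_bound integral_mono])
    show "integrable surface_measure (\<lambda>y. \<bar>f y * Z k x y\<bar>)"
      using integrable_mult_harmonic[OF f Z_harmonic] by (rule integrable_abs)
    show "integrable surface_measure (\<lambda>y. real (harmonic_dim TYPE('n) k) / sphere_volume TYPE('n) * \<bar>f y\<bar>)"
      using f by (intro integrable_mult_right integrable_abs)
    fix y :: "real^'n" assume "y \<in> space surface_measure"
    then have y: "y \<in> sphere 0 1" by simp
    have "\<bar>f y\<bar> * \<bar>Z k x y\<bar> \<le> \<bar>f y\<bar> * (real (harmonic_dim TYPE('n) k) / sphere_volume TYPE('n))"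
      by (intro mult_left_mono Z_bound x y) simp
    then show "\<bar>f y * Z k x y\<bar> \<le> real (harmonic_dim TYPE('n) k) / sphere_volume TYPE('n) * \<bar>f y\<bar>"
      by (simp only: abs_mult mult.commute)
  qed
  then show ?thesis unfolding integral_mult_Z[OF f] by simp
qed

text \<open>The partial sums of the kernel are bounded by \<open>suminf ?D\<close>, uniformly in
  both arguments, so summation and integration against f may be exchanged by dominated
  convergence.\<close>

lemma integral_op_sums:
  assumes pd: "positive_definite_with TYPE('n) \<phi> ph" and f: "integrable surface_measure f"
    and x: "x \<in> sphere 0 1"
  shows "(\<lambda>k. \<Sum>l = 1..harmonic_dim TYPE('n) k. ph k * harmonic_coeff Y f k l * Y k l x) sums integral_op \<phi> f x"
proof -
  let ?D = "\<lambda>k. ph k * (real (harmonic_dim TYPE('n) k) / sphere_volume TYPE('n))"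
  have summ: "summable ?D" using pd by (simp add: positive_definite_with_def)
  have D0: "?D k \<ge> 0" for k
    using ph_pos[of k] sphere_volume_pos[where 'n = 'n] by (intro mult_nonneg_nonneg divide_nonneg_nonneg) auto
  have fm: "f \<in> borel_measurable surface_measure" using f by simp
  have Zm: "Z k x \<in> borel_measurable surface_measure" for k
    by (rule spherical_harmonics_measurable[OF Z_harmonic])
  let ?s = "\<lambda>n y. \<Sum>k<n. f y * (ph k * Z k x y)"
  have lim: "(\<lambda>n. ?s n y) \<longlonglongrightarrow> f y * \<phi> (x \<bullet> y)" if "y \<in> sphere 0 1" for y
    using sums_mult[OF kernel_sums[OF pd x that], of "f y"] by (simp add: sums_def)
  have sm: "?s n \<in> borel_measurable surface_measure" for n
    by (intro borel_measurable_sum borel_measurable_times fm Zm borel_measurable_const)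
  have "(\<lambda>n. \<integral>y. ?s n y \<partial>surface_measure) \<longlonglongrightarrow> (\<integral>y. f y * \<phi> (x \<bullet> y) \<partial>surface_measure)"
  proof (rule integral_dominated_convergence[where w = "\<lambda>y. suminf ?D * \<bar>f y\<bar>"])
    show "(\<lambda>y. f y * \<phi> (x \<bullet> y)) \<in> borel_measurable surface_measure"
      by (rule borel_measurable_LIMSEQ_metric[OF sm lim]) simp
    show "?s n \<in> borel_measurable surface_measure" for n by (rule sm)
    show "integrable surface_measure (\<lambda>y. suminf ?D * \<bar>f y\<bar>)"
      using f by (intro integrable_mult_right integrable_abs)
    show "AE y in surface_measure. (\<lambda>n. ?s n y) \<longlonglongrightarrow> f y * \<phi> (x \<bullet> y)"
      by (intro AE_I2 lim) simp
    show "AE y in surface_measure. norm (?s n y) \<le> suminf ?D * \<bar>f y\<bar>" for n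
    proof (rule AE_I2)
      fix y :: "real^'n" assume "y \<in> space surface_measure"
      then have y: "y \<in> sphere 0 1" by simp
      have "\<bar>?s n y\<bar> \<le> (\<Sum>k<n. \<bar>f y\<bar> * ?D k)"
      proof (intro order_trans[OF sum_abs] sum_mono)
        fix k
        have "\<bar>f y\<bar> * (ph k * \<bar>Z k x y\<bar>) \<le> \<bar>f y\<bar> * ?D k"
          using ph_pos[of k] by (intro mult_left_mono Z_bound x y) auto
        then show "\<bar>f y * (ph k * Z k x y)\<bar> \<le> \<bar>f y\<bar> * ?D k"
          using ph_pos[of k] by (simp only: abs_mult abs_of_pos)
      qed
      also have "\<dots> = \<bar>f y\<bar> * (\<Sum>k<n. ?D k)" by (simp only: sum_distrib_left)
      also have "\<dots> \<le> \<bar>f y\<bar> * suminf ?D"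
        using D0 by (intro mult_left_mono sum_le_suminf[OF summ]) auto
      finally show "norm (?s n y) \<le> suminf ?D * \<bar>f y\<bar>" by (simp only: real_norm_def mult.commute)
    qed
  qed
  moreover have "(\<integral>y. ?s n y \<partial>surface_measure)
      = (\<Sum>k<n. \<Sum>l = 1..harmonic_dim TYPE('n) k. ph k * harmonic_coeff Y f k l * Y k l x)" for n
  proof -
    have i: "integrable surface_measure (\<lambda>y. f y * (ph k * Z k x y))" for k
      using integrable_mult_right[OF integrable_mult_harmonic[OF f Z_harmonic], of "ph k"]
      by (simp only: mult.left_commute)
    have "(\<integral>y. ?s n y \<partial>surface_measure) = (\<Sum>k<n. \<integral>y. f y * (ph k * Z k x y) \<partial>surface_measure)"
      by (rule Bochner_Integration.integral_sum[OF i])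
    also have "\<dots> = (\<Sum>k<n. ph k * (\<integral>y. f y * Z k x y \<partial>surface_measure))"
      by (simp only: mult.left_commute[of "f _" "ph _"] integral_mult_right_zero)
    moreover have "(\<Sum>l = 1..harmonic_dim TYPE('n) k. ph k * harmonic_coeff Y f k l * Y k l x)
        = ph k * (\<integral>y. f y * Z k x y \<partial>surface_measure)" for k
      unfolding integral_mult_Z[OF f] by (simp only: sum_distrib_left mult.assoc)
    ultimately show ?thesis by (simp only:)
  qed
  moreover have "(\<integral>y. f y * \<phi> (x \<bullet> y) \<partial>surface_measure) = integral_op \<phi> f x"
    using x by (simp add: integral_op_def on_sphere_def mult.commute)
  ultimately show ?thesis by (simp only: sums_def)
qed

text \<open>In the basis everything is diagonal: the coefficients of g are the error coefficients
  times \<open>ph k\<close> and (ph k + lam)^(-v), and the latter is at most lam^(-v). So the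
  squared native norm is at most lam^(-2 v) times the sum in
  \<open>quad_error_bound\<close>.\<close>

lemma operator_bound:
  assumes pd: "positive_definite_with TYPE('n) \<phi> ph" and s: "s \<ge> 1" and quad: "positive_quadrature s N w p"
    and lam: "lam > 0" and v: "v \<ge> 0" and f: "f \<in> native_space Y ph"
  defines "g \<equiv> spectral_op Y ph (\<lambda>t. (t + lam) powr (- v)) (empirical_op \<phi> N w p f - integral_op \<phi> f)"
  shows "g \<in> native_space Y ph"
    and "native_norm Y ph g \<le> error_const TYPE('n) \<gamma> C M * (lam powr (- v) * real s powr (- \<gamma>)) * native_norm Y ph f"
proof -
  have p: "p i \<in> sphere 0 1" if "i \<in> {1..N}" for i
    using quad that by (auto simp: positive_quadrature_def)
  have fi: "integrable surface_measure f" by (rule native_space_integrable[OF f])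
  define e where "e = quad_error N w p f"
  \<comment> \<open>W depends on f and on the rule; it guarantees absolute convergence of the series
    and does not enter the final estimate.\<close>
  define W where "W = (\<Sum>i = 1..N. \<bar>w i * f (p i)\<bar>) + (\<integral>y. \<bar>f y\<bar> \<partial>surface_measure)"
  define D where "D = (\<lambda>k. ph k * (real (harmonic_dim TYPE('n) k) / sphere_volume TYPE('n)))"
  have summD: "summable D" using pd by (simp add: positive_definite_with_def D_def)
  have eb: "\<bar>\<Sum>l = 1..harmonic_dim TYPE('n) k. e k l * Y k l x\<bar>
      \<le> real (harmonic_dim TYPE('n) k) / sphere_volume TYPE('n) * W" if x: "x \<in> sphere 0 1" for k x
  proof -
    have "(\<Sum>l = 1..harmonic_dim TYPE('n) k. e k l * Y k l x)
       = (\<Sum>l = 1..harmonic_dim TYPE('n) k. (\<Sum>i = 1..N. w i * (f (p i) * Y k l (p i))) * Y k l x)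
         - (\<Sum>l = 1..harmonic_dim TYPE('n) k. harmonic_coeff Y f k l * Y k l x)"
      unfolding e_def quad_error_def by (simp only: left_diff_distrib sum_subtractf)
    then have "\<bar>\<Sum>l = 1..harmonic_dim TYPE('n) k. e k l * Y k l x\<bar>
       \<le> \<bar>\<Sum>l = 1..harmonic_dim TYPE('n) k. (\<Sum>i = 1..N. w i * (f (p i) * Y k l (p i))) * Y k l x\<bar>
         + \<bar>\<Sum>l = 1..harmonic_dim TYPE('n) k. harmonic_coeff Y f k l * Y k l x\<bar>"
      by (simp only: abs_triangle_ineq4)
    then show ?thesis
      using empirical_bound[where N = N and p = p and w = w and f = f, OF p x, of k] coeff_bound[OF fi x, of k]
      unfolding W_def distrib_left by linarith
  qed
  have scaled: "\<bar>\<Sum>l = 1..harmonic_dim TYPE('n) k. (a * e k l) * Y k l x\<bar> \<le> b * (real (harmonic_dim TYPE('n) k) / sphere_volume TYPE('n) * W)"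
    if x: "x \<in> sphere 0 1" and a: "\<bar>a\<bar> \<le> b" for k x a b
  proof -
    have "\<bar>\<Sum>l = 1..harmonic_dim TYPE('n) k. (a * e k l) * Y k l x\<bar>
      = \<bar>a\<bar> * \<bar>\<Sum>l = 1..harmonic_dim TYPE('n) k. e k l * Y k l x\<bar>"
      by (simp only: mult.assoc sum_distrib_left[symmetric] abs_mult)
    also have "\<dots> \<le> b * (real (harmonic_dim TYPE('n) k) / sphere_volume TYPE('n) * W)"
      using eb[OF x, of k] a by (intro mult_mono) auto
    finally show ?thesis .
  qed
  define h where "h = empirical_op \<phi> N w p f - integral_op \<phi> f"
  have h_sums: "(\<lambda>k. \<Sum>l = 1..harmonic_dim TYPE('n) k. (ph k * e k l) * Y k l x) sums h x" if x: "x \<in> sphere 0 1" for x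
  proof -
    have "(\<lambda>k. (\<Sum>l = 1..harmonic_dim TYPE('n) k. ph k * (\<Sum>i = 1..N. w i * (f (p i) * Y k l (p i))) * Y k l x)
      - (\<Sum>l = 1..harmonic_dim TYPE('n) k. ph k * harmonic_coeff Y f k l * Y k l x)) sums h x"
      using sums_diff[OF empirical_sums[where N = N and p = p and w = w and f = f, OF pd p x] integral_op_sums[OF pd fi x]]
      by (simp add: h_def fun_diff_def)
    then show ?thesis
      unfolding e_def quad_error_def by (simp only: sum_subtractf[symmetric] left_diff_distrib right_diff_distrib)
  qed
  have h_eq: "h = on_sphere (\<lambda>x. \<Sum>k. \<Sum>l = 1..harmonic_dim TYPE('n) k. (ph k * e k l) * Y k l x)"
  proof
    fix x
    show "h x = on_sphere (\<lambda>x. \<Sum>k. \<Sum>l = 1..harmonic_dim TYPE('n) k. (ph k * e k l) * Y k l x) x"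
    proof (cases "x \<in> sphere 0 1")
      case True
      then show ?thesis unfolding on_sphere_def if_P[OF True] by (rule sums_unique[OF h_sums])
    next
      case False
      then show ?thesis by (simp add: h_def fun_diff_def empirical_op_def integral_op_def on_sphere_def)
    qed
  qed
  have summ1: "summable (\<lambda>k. ph k * (real (harmonic_dim TYPE('n) k) / sphere_volume TYPE('n) * W))"
    using summable_mult2[OF summD, of W] by (simp only: D_def mult.assoc)
  have h_coeff: "harmonic_coeff Y h k l = ph k * e k l" if "l \<in> {1..harmonic_dim TYPE('n) k}" for k l
    unfolding h_eq using ph_pos that
    by (intro harmonic_series(1)[OF summ1] scaled) (auto intro: less_imp_le)
  define \<eta> where "\<eta> = (\<lambda>k. (ph k + lam) powr (- v))"
  have \<eta>: "0 \<le> \<eta> k" "\<eta> k \<le> lam powr (- v)" for k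
    unfolding \<eta>_def using lam v ph_pos[of k] by (auto intro: powr_mono2')
  define c where "c = (\<lambda>k l. (\<eta> k * ph k) * e k l)"
  have g_eq: "g = on_sphere (\<lambda>x. \<Sum>k. \<Sum>l = 1..harmonic_dim TYPE('n) k. c k l * Y k l x)"
  proof -
    have "\<eta> k * (\<Sum>l = 1..harmonic_dim TYPE('n) k. harmonic_coeff Y h k l * Y k l x)
       = (\<Sum>l = 1..harmonic_dim TYPE('n) k. c k l * Y k l x)" for k x
      unfolding sum_distrib_left by (intro sum.cong refl) (simp add: h_coeff c_def)
    then show ?thesis unfolding g_def spectral_op_def h_def[symmetric] \<eta>_def by (simp only:)
  qed
  let ?B = "\<lambda>k. (lam powr (- v) * ph k) * (real (harmonic_dim TYPE('n) k) / sphere_volume TYPE('n) * W)"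
  have summ2: "summable ?B"
    using summable_mult[OF summ1, of "lam powr (- v)"] by (simp only: mult.assoc)
  have cb: "\<bar>\<Sum>l = 1..harmonic_dim TYPE('n) k. c k l * Y k l x\<bar> \<le> ?B k" if "x \<in> sphere 0 1" for k x
    unfolding c_def
  proof (rule scaled[OF that])
    show "\<bar>\<eta> k * ph k\<bar> \<le> lam powr (- v) * ph k"
      using \<eta>[of k] ph_pos[of k] by (simp add: abs_mult mult_right_mono)
  qed
  have g_coeff: "harmonic_coeff Y g k l = c k l" if "l \<in> {1..harmonic_dim TYPE('n) k}" for k l
    unfolding g_eq by (rule harmonic_series(1)[OF summ2 _ that]) (rule cb)
  have g_sums: "(\<lambda>k. \<Sum>l = 1..harmonic_dim TYPE('n) k. c k l * Y k l x) sums g x" if "x \<in> sphere 0 1" for x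
    unfolding g_eq by (rule harmonic_series(2)[OF summ2 _ that]) (rule cb)
  have g_meas: "g \<in> borel_measurable surface_measure"
    unfolding g_eq by (rule harmonic_series(3)[OF summ2]) (rule cb)
  \<comment> \<open>Membership in the native space asks for square integrability, which boundedness
    gives on a finite measure.\<close>
  have g_bdd: "\<exists>b. \<forall>x. \<bar>g x\<bar> \<le> b"
    unfolding g_eq by (rule harmonic_series(4)[OF summ2]) (rule cb)
  define E where "E = error_const TYPE('n) \<gamma> C M * (lam powr (- v) * real s powr (- \<gamma>)) * native_norm Y ph f"
  have E0: "E \<ge> 0"
  proof -
    have "native_norm Y ph f \<ge> 0"
      unfolding native_norm_def using f weighted_term_nonneg
      by (intro real_sqrt_ge_zero suminf_nonneg) (auto simp: native_space_def)
    then show ?thesis unfolding E_def using error_const_nonneg by (intro mult_nonneg_nonneg) auto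
  qed
  \<comment> \<open>One factor \<open>ph k\<close> of the squared coefficient survives the division,
    which produces exactly the weights of the error sum.\<close>
  have cg: "inverse (ph k) * (\<Sum>l = 1..harmonic_dim TYPE('n) k. (harmonic_coeff Y g k l)\<^sup>2)
     \<le> (lam powr (- v))\<^sup>2 * (ph k * (\<Sum>l = 1..harmonic_dim TYPE('n) k. (e k l)\<^sup>2))" for k
  proof -
    let ?S = "\<Sum>l = 1..harmonic_dim TYPE('n) k. (e k l)\<^sup>2"
    have "(\<Sum>l = 1..harmonic_dim TYPE('n) k. (harmonic_coeff Y g k l)\<^sup>2) = (\<eta> k * ph k)\<^sup>2 * ?S"
    proof -
      have "(harmonic_coeff Y g k l)\<^sup>2 = (\<eta> k * ph k)\<^sup>2 * (e k l)\<^sup>2" if "l \<in> {1..harmonic_dim TYPE('n) k}" for l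
        unfolding g_coeff[OF that] c_def by (rule power_mult_distrib)
      then show ?thesis unfolding sum_distrib_left by (intro sum.cong refl)
    qed
    then have "inverse (ph k) * (\<Sum>l = 1..harmonic_dim TYPE('n) k. (harmonic_coeff Y g k l)\<^sup>2) = (\<eta> k)\<^sup>2 * (ph k * ?S)"
      using ph_pos[of k] by (simp add: power_mult_distrib power2_eq_square)
    also have "\<dots> \<le> (lam powr (- v))\<^sup>2 * (ph k * ?S)"
      using \<eta>[of k] ph_pos[of k] by (intro mult_right_mono power_mono mult_nonneg_nonneg sum_nonneg) auto
    finally show ?thesis .
  qed
  \<comment> \<open>The bound is uniform in K, so it yields summability and the norm estimate at
    once.\<close>
  have part: "(\<Sum>k<K. inverse (ph k) * (\<Sum>l = 1..harmonic_dim TYPE('n) k. (harmonic_coeff Y g k l)\<^sup>2)) \<le> E\<^sup>2" for K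
  proof -
    have "(\<Sum>k<K. inverse (ph k) * (\<Sum>l = 1..harmonic_dim TYPE('n) k. (harmonic_coeff Y g k l)\<^sup>2))
      \<le> (lam powr (- v))\<^sup>2 * (\<Sum>k<K. ph k * (\<Sum>l = 1..harmonic_dim TYPE('n) k. (e k l)\<^sup>2))"
      unfolding sum_distrib_left[of "(lam powr (- v))\<^sup>2"] by (intro sum_mono cg)
    also have "\<dots> \<le> (lam powr (- v))\<^sup>2 * (error_const TYPE('n) \<gamma> C M * real s powr (- \<gamma>) * native_norm Y ph f)\<^sup>2"
      unfolding e_def by (intro mult_left_mono quad_error_bound[OF s quad f]) simp
    also have "\<dots> = E\<^sup>2" by (simp add: E_def power_mult_distrib mult_ac)
    finally show ?thesis .
  qed
  have summg: "summable (\<lambda>k. inverse (ph k) * (\<Sum>l = 1..harmonic_dim TYPE('n) k. (harmonic_coeff Y g k l)\<^sup>2))"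
    using weighted_term_nonneg part by (rule summableI_nonneg_bounded)
  have "(\<lambda>k. \<Sum>l = 1..harmonic_dim TYPE('n) k. harmonic_coeff Y g k l * Y k l x) sums g x" if "x \<in> sphere 0 1" for x
  proof -
    have "(\<lambda>k. \<Sum>l = 1..harmonic_dim TYPE('n) k. harmonic_coeff Y g k l * Y k l x)
        = (\<lambda>k. \<Sum>l = 1..harmonic_dim TYPE('n) k. c k l * Y k l x)"
      by (intro ext sum.cong refl) (simp add: g_coeff)
    then show ?thesis using g_sums[OF that] by simp
  qed
  moreover have "g x = 0" if "x \<notin> sphere 0 1" for x
    using that by (simp add: g_def spectral_op_def on_sphere_def)
  moreover have "integrable surface_measure (\<lambda>x. (g x)\<^sup>2)"
  proof -
    obtain b where b: "\<And>x. \<bar>g x\<bar> \<le> b" using g_bdd by blast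
    have m: "(\<lambda>x. (g x)\<^sup>2) \<in> borel_measurable surface_measure" using g_meas by measurable
    show ?thesis
    proof (rule integrable_surface_bounded[OF m])
      fix x :: "real^'n"
      have "\<bar>g x\<bar>\<^sup>2 \<le> b\<^sup>2" using b[of x] by (intro power_mono) auto
      then show "\<bar>(g x)\<^sup>2\<bar> \<le> b\<^sup>2" by simp
    qed
  qed
  ultimately show "g \<in> native_space Y ph"
    unfolding native_space_def using g_meas summg by blast
  have "(\<Sum>k. inverse (ph k) * (\<Sum>l = 1..harmonic_dim TYPE('n) k. (harmonic_coeff Y g k l)\<^sup>2)) \<le> E\<^sup>2"
    using summg part by (rule suminf_le_const)
  then have "native_norm Y ph g \<le> sqrt (E\<^sup>2)"
    unfolding native_norm_def by (rule real_sqrt_le_mono)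
  also have "sqrt (E\<^sup>2) = E" using E0 by simp
  finally show "native_norm Y ph g \<le> error_const TYPE('n) \<gamma> C M * (lam powr (- v) * real s powr (- \<gamma>)) * native_norm Y ph f"
    by (simp only: E_def)
qed

end

theorem proposition3:
  fixes d :: nat and \<gamma> v :: real and \<phi> :: "real \<Rightarrow> real" and \<phi>h :: "nat \<Rightarrow> real"
  assumes dim: "CARD('n::finite) = d + 1" and d: "d \<ge> 1"
    and \<gamma>: "\<gamma> > real d / 2" and v: "0 \<le> v" "v < 1"
    and pd: "positive_definite_with TYPE('n) \<phi> \<phi>h"
    and decay: "\<exists>c1>0. \<exists>c2>0. \<forall>k\<ge>1.
        c1 * real k powr (-2 * \<gamma>) \<le> \<phi>h k \<and> \<phi>h k \<le> c2 * real k powr (-2 * \<gamma>)"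
  shows "\<exists>c>0. \<forall>(Y :: nat \<Rightarrow> nat \<Rightarrow> real ^ 'n \<Rightarrow> real) (s::nat) (N::nat) (w :: nat \<Rightarrow> real)
           (p :: nat \<Rightarrow> real ^ 'n) (lam::real).
       harmonic_onb Y \<longrightarrow> s \<ge> 1 \<longrightarrow> positive_quadrature s N w p \<longrightarrow> 0 < lam \<longrightarrow> lam < 1 \<longrightarrow>
       (let A = (\<lambda>f. spectral_op Y \<phi>h (\<lambda>t. (t + lam) powr (- v))
                       (empirical_op \<phi> N w p f - integral_op \<phi> f))
        in A ` native_space Y \<phi>h \<subseteq> native_space Y \<phi>h \<and>
           native_op_norm Y \<phi>h A \<le>
             ereal (c * (lam powr (- v) * real s powr (- \<gamma>) + real s powr (- (1 - v) * \<gamma>))))"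
proof -
  obtain C where C: "C > 0" "\<And>k. k \<ge> 1 \<Longrightarrow> \<phi>h k \<le> C * real k powr (-2 * \<gamma>)" using decay by blast
  \<comment> \<open>The decay gives \<phi>h k \<le> C for k \<ge> 1; degree 0 is added by
    hand.\<close>
  define M where "M = max (\<phi>h 0) C"
  have pos: "\<phi>h k > 0" for k using pd by (simp add: positive_definite_with_def)
  have \<gamma>0: "\<gamma> > 0" using \<gamma> by (meson divide_nonneg_nonneg le_less_trans of_nat_0_le_iff zero_le_numeral)
  have M: "\<phi>h k \<le> M" for k
  proof (cases "k = 0")
    case False
    then have "\<phi>h k \<le> C * real k powr (-2 * \<gamma>)" by (intro C(2)) simp
    also have "\<dots> \<le> C * real k powr 0"
      using False C(1) \<gamma>0 by (intro mult_left_mono powr_mono) auto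
    also have "\<dots> = C" using False by simp
    finally show ?thesis by (simp add: M_def)
  qed (simp add: M_def)
  \<comment> \<open>c is fixed before any basis is given, while nonnegativity of
    \<open>error_const\<close> is proved inside the locale; the maximum and the summand 1 make c
    positive outside it.\<close>
  define c where "c = max (error_const TYPE('n) \<gamma> C M) 0 + 1"
  have loc: "decaying_basis Y \<phi>h \<gamma> C M" if "harmonic_onb Y" for Y :: "nat \<Rightarrow> nat \<Rightarrow> real ^ 'n \<Rightarrow> real"
    using that dim d \<gamma> pos C M by unfold_locales auto
  have main: "(let A = (\<lambda>f. spectral_op Y \<phi>h (\<lambda>t. (t + lam) powr (- v))
                       (empirical_op \<phi> N w p f - integral_op \<phi> f))
        in A ` native_space Y \<phi>h \<subseteq> native_space Y \<phi>h \<and>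
           native_op_norm Y \<phi>h A \<le>
             ereal (c * (lam powr (- v) * real s powr (- \<gamma>) + real s powr (- (1 - v) * \<gamma>))))"
    if onb: "harmonic_onb Y" and s: "s \<ge> 1" and quad: "positive_quadrature s N w p" and lam: "0 < lam"
    for Y :: "nat \<Rightarrow> nat \<Rightarrow> real ^ 'n \<Rightarrow> real" and s N :: nat and w p and lam :: real
  proof -
    interpret decaying_basis Y \<phi>h \<gamma> C M by (rule loc[OF onb])
    note ob = operator_bound[OF pd s quad lam v(1)]
    define R where "R = lam powr (- v) * real s powr (- \<gamma>)"
    have R: "R \<ge> 0" by (simp add: R_def)
    have "native_norm Y \<phi>h (spectral_op Y \<phi>h (\<lambda>t. (t + lam) powr (- v)) (empirical_op \<phi> N w p f - integral_op \<phi> f))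
        \<le> c * (R + real s powr (- (1 - v) * \<gamma>))"
      if f: "f \<in> native_space Y \<phi>h" and f1: "native_norm Y \<phi>h f \<le> 1" for f
    proof -
      have "native_norm Y \<phi>h (spectral_op Y \<phi>h (\<lambda>t. (t + lam) powr (- v)) (empirical_op \<phi> N w p f - integral_op \<phi> f))
        \<le> error_const TYPE('n) \<gamma> C M * R * native_norm Y \<phi>h f"
        unfolding R_def by (rule ob(2)[OF f])
      also have "\<dots> \<le> error_const TYPE('n) \<gamma> C M * R * 1"
        using f1 R error_const_nonneg by (intro mult_left_mono mult_nonneg_nonneg)
      also have "\<dots> \<le> c * (R + real s powr (- (1 - v) * \<gamma>))"
        using R error_const_nonneg by (simp only: mult_1_right c_def) (intro mult_mono, auto)
      finally show ?thesis .
    qed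
    then show ?thesis
      unfolding Let_def native_op_norm_def R_def using ob(1) by (auto intro!: SUP_least)
  qed
  have "c > 0" by (simp add: c_def)
  then show ?thesis using main by blast
qed

end
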